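(* Let $\mu$ be a non-zero finite non-negative Borel measure on $\mathbb T$ and $n\in\mathbb N$. Let $\mathcal W$ be a closed subspace of the Hilbert space $(\mathcal H_{\mu,n},\|\cdot\|_{\mu,n})$ that is invariant under multiplication by $z$, and let $\phi\in\mathrm{Mult}(\mathcal H_{\sigma,n-1})$. If $f\in\mathcal W$ is such that $\phi f\in\mathcal H_{\mu,n}$, then $\phi f\in\mathcal W$.
   Context: $\mathbb D$ open unit disc, $\mathbb T$ unit circle, $dA$ normalized area measure, $H^2$ Hardy space. $P_\mu(z)=\int_{\mathbb T}\frac{1-|z|^2}{|z-\zeta|^2}d\mu(\zeta)$, $D_{\mu,n}(f)=\frac{1}{n!(n-1)!}\int_{\mathbb D}|f^{(n)}|^2P_\mu(1-|z|^2)^{n-1}dA$, $\mathcal H_{\mu,n}=\{f\in\mathcal O(\mathbb D):D_{\mu,n}(f)<\infty\}$ with norm $\|f\|_{\mu,n}^2=\|f\|_{H^2}^2+D_{\mu,n}(f)$ (it is a Hilbert space contained in $H^2$). For $f=\sum a_kz^k$ and $j\ge0$, $D_{\sigma,j}(f)=\sum_{k\ge j}\binom kj|a_k|^2$, $\mathcal H_{\sigma,j}=\{f:D_{\sigma,j}(f)<\infty\}$. $\mathrm{Mult}(\mathcal H)=\{\varphi\in\mathcal O(\mathbb D):\varphi f\in\mathcal H\ \forall f\in\mathcal H\}$. *)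

theory Defs
  imports "HOL-Analysis.Analysis"
begin

definition taylor_coeff :: "(complex \<Rightarrow> complex) \<Rightarrow> nat \<Rightarrow> complex" where
  "taylor_coeff f k = (deriv ^^ k) f 0 / of_nat (fact k)"

definition H2_norm2 :: "(complex \<Rightarrow> complex) \<Rightarrow> ennreal" where
  "H2_norm2 f = (\<Sum>k. ennreal ((cmod (taylor_coeff f k))\<^sup>2))"

definition poisson :: "complex measure \<Rightarrow> complex \<Rightarrow> real" where
  "poisson mu z = integral\<^sup>L mu (\<lambda>\<zeta>. (1 - (cmod z)\<^sup>2) / (cmod (z - \<zeta>))\<^sup>2)"

text \<open>D_{mu,n}(f), with normalized area measure dA = dx dy / pi on the disc.\<close>
definition D_mu :: "complex measure \<Rightarrow> nat \<Rightarrow> (complex \<Rightarrow> complex) \<Rightarrow> ennreal" where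
  "D_mu mu n f = ennreal (1 / (fact n * fact (n - 1) * pi)) *
     (\<integral>\<^sup>+ z \<in> ball 0 1. ennreal ((cmod ((deriv ^^ n) f z))\<^sup>2 * poisson mu z
                                 * (1 - (cmod z)\<^sup>2) ^ (n - 1)) \<partial>lborel)"

definition H_mu :: "complex measure \<Rightarrow> nat \<Rightarrow> (complex \<Rightarrow> complex) set" where
  "H_mu mu n = {f. f holomorphic_on ball 0 1 \<and> D_mu mu n f < \<infinity>}"

definition norm_mu2 :: "complex measure \<Rightarrow> nat \<Rightarrow> (complex \<Rightarrow> complex) \<Rightarrow> ennreal" where
  "norm_mu2 mu n f = H2_norm2 f + D_mu mu n f"

definition D_sigma :: "nat \<Rightarrow> (complex \<Rightarrow> complex) \<Rightarrow> ennreal" where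
  "D_sigma j f = (\<Sum>k. if j \<le> k then ennreal (real (k choose j) * (cmod (taylor_coeff f k))\<^sup>2) else 0)"

definition H_sigma :: "nat \<Rightarrow> (complex \<Rightarrow> complex) set" where
  "H_sigma j = {f. f holomorphic_on ball 0 1 \<and> D_sigma j f < \<infinity>}"

definition Mult :: "(complex \<Rightarrow> complex) set \<Rightarrow> (complex \<Rightarrow> complex) set" where
  "Mult H = {\<phi>. \<phi> holomorphic_on ball 0 1 \<and> (\<forall>f\<in>H. (\<lambda>z. \<phi> z * f z) \<in> H)}"

definition closed_subspace_mu :: "complex measure \<Rightarrow> nat \<Rightarrow> (complex \<Rightarrow> complex) set \<Rightarrow> bool" where
  "closed_subspace_mu mu n W \<longleftrightarrow>
     W \<subseteq> H_mu mu n \<and> (\<lambda>z. 0) \<in> W \<and>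
     (\<forall>f\<in>W. \<forall>g\<in>W. (\<lambda>z. f z + g z) \<in> W) \<and>
     (\<forall>c. \<forall>f\<in>W. (\<lambda>z. c * f z) \<in> W) \<and>
     (\<forall>F g. (\<forall>j. F j \<in> W) \<longrightarrow> g \<in> H_mu mu n \<longrightarrow>
        (\<lambda>j. norm_mu2 mu n (\<lambda>z. F j z - g z)) \<longlonglongrightarrow> 0 \<longrightarrow> g \<in> W)"

end

theory Submission
  imports Defs "HOL-Complex_Analysis.Complex_Analysis"
begin

text \<open>
  By Tonelli, \<open>D\<^sub>\<mu>\<^sub>,\<^sub>n(f)\<close> is the \<open>\<mu>\<close>-average over \<open>\<lambda>\<close> of local integrals \<open>D\<^sub>\<lambda>\<^sub>,\<^sub>n(f)\<close>. The higher order
  local Douglas formula says that \<open>D\<^sub>\<lambda>\<^sub>,\<^sub>n(f)\<close> is finite iff \<open>f = a + (z - \<lambda>) g\<close> with \<open>g\<close> in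
  \<open>H\<^sub>\<sigma>\<^sub>,\<^sub>n\<^sub>-\<^sub>1\<close>, and that it is then controlled by \<open>g\<close>. If also \<open>\<phi> f = b + (z - \<lambda>) q\<close>, then
  \<open>a \<phi> = b + (z - \<lambda>) (q - \<phi> g)\<close>. Fejer means preserve this form, and they do not increase the multiplier
  norm of \<open>\<phi>\<close> on \<open>H\<^sub>\<sigma>\<^sub>,\<^sub>n\<^sub>-\<^sub>1\<close>; hence the Fejer means \<open>p\<^sub>N\<close> of \<open>\<phi>\<close> give polynomial multiples \<open>p\<^sub>N f\<close>, elements
  of \<open>W\<close>, that are bounded in norm and converge coefficientwise to \<open>\<phi> f\<close>. By Mazur's argument
  \<open>\<phi> f\<close> is a norm limit of elements of \<open>W\<close>.
\<close>

section \<open>The local Douglas formula\<close>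

text \<open>The obstacle is that \<open>\<phi>\<close> is a multiplier of \<open>H_sigma\<close>,
  not of \<open>H_mu\<close>, so multiplication by its Fejer means has no a priori uniform bound on
  \<open>H_mu\<close>. What is known is that two particular functions, \<open>f\<close> and
  \<open>\<phi> f\<close>, lie there. The means are therefore estimated at each boundary point
  separately, by the local data of these two functions, with constants independent of the point and
  of \<open>N\<close>; such a bound can be integrated against \<open>mu\<close>. Where the boundary
  value \<open>a\<close> of \<open>f\<close> vanishes, nothing is learnt about
  \<open>\<phi>\<close>, but then \<open>f = (z - l) g\<close> and the multiplier bound on
  \<open>g\<close> suffices. Keeping the product \<open>a \<phi>\<close> undivided treats both cases
  at once. As \<open>Mult\<close> is a purely algebraic notion, the multiplier bound itself has to
  be derived, by a gliding hump. The estimates are made on formal power series, with squared norms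
  in \<open>ennreal\<close>: divergence needs no side conditions, and subadditivity takes the form
  of a harmless factor 2.\<close>

definition wnorm :: "(nat \<Rightarrow> real) \<Rightarrow> complex fps \<Rightarrow> ennreal" where
  "wnorm w g = (\<Sum>k. ennreal (w k * (cmod (fps_nth g k))\<^sup>2))"

abbreviation binw :: "nat \<Rightarrow> nat \<Rightarrow> real" where
  "binw j k \<equiv> real (k choose j)"

text \<open>\<open>loc_D n l f\<close> is \<open>D\<^sub>\<lambda>\<^sub>,\<^sub>n(f)\<close> for \<open>\<lambda> = l\<close> on the unit circle: up to a unimodular factor, \<open>loc_sum n l f m\<close>
  is the coefficient of index \<open>m\<close> of \<open>f\<^sup>(\<^sup>n\<^sup>) / (z - l)\<close>, and the weights are Beta integrals.\<close>

definition loc_sum :: "nat \<Rightarrow> complex \<Rightarrow> complex fps \<Rightarrow> nat \<Rightarrow> complex" where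
  "loc_sum n l f m = (\<Sum>i\<le>m. fact (i + n) / fact i * (l ^ (i + n) * fps_nth f (i + n)))"

definition loc_weight :: "nat \<Rightarrow> nat \<Rightarrow> real" where
  "loc_weight n m = fact m / (fact (m + n + 1) * fact (n - 1))"

definition loc_D :: "nat \<Rightarrow> complex \<Rightarrow> complex fps \<Rightarrow> ennreal" where
  "loc_D n l f = (\<Sum>m. ennreal (loc_weight n m * (cmod (loc_sum n l f m))\<^sup>2))"

lemma loc_weight_nonneg [simp]: "loc_weight n m \<ge> 0"
  by (simp add: loc_weight_def)

lemma ennreal_suminf_le_iff:
  fixes f :: "nat \<Rightarrow> real"
  assumes "\<And>k. f k \<ge> 0" "C \<ge> 0"
  shows "(\<Sum>k. ennreal (f k)) \<le> ennreal C \<longleftrightarrow> (\<forall>N. (\<Sum>k<N. f k) \<le> C)"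
  using assms by (subst suminf_eq_SUP) (simp_all add: SUP_le_iff sum_ennreal sum_nonneg)

lemma ennreal_suminf_leI:
  fixes f :: "nat \<Rightarrow> ennreal"
  assumes "\<And>N. (\<Sum>k<N. f k) \<le> C"
  shows "(\<Sum>k. f k) \<le> C"
  using assms by (subst suminf_eq_SUP) (simp_all add: SUP_le_iff)

lemma cmod_add_of_real_mult_sq:
  "(cmod (x + of_real c * t))\<^sup>2 = (cmod x)\<^sup>2 + 2 * c * Re (x * cnj t) + c\<^sup>2 * (cmod t)\<^sup>2"
  unfolding cmod_power2 by (simp add: power2_eq_square algebra_simps)

text \<open>Here \<open>T k = l\<^sup>k\<^sup>+\<^sup>1 g k\<close> when \<open>f = a + (z - l) g\<close>. Since \<open>S m\<close> is a combination of \<open>U m\<close> and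
  \<open>U (m + 1)\<close>, the weighted squares telescope.\<close>

lemma local_douglas_partial:
  fixes T :: "nat \<Rightarrow> complex" and j :: nat
  defines "S \<equiv> \<lambda>m. \<Sum>i\<le>m. fact (i + Suc j) / fact i * (T (i + j) - T (i + Suc j))"
    and "U \<equiv> \<lambda>m. \<Sum>k\<le>m. of_nat (Suc j) * fact (k + j) / fact k * T (k + j)"
  shows "(\<Sum>m<M. loc_weight (Suc j) m * (cmod (S m))\<^sup>2)
           + fact M / (fact (M + Suc j) * fact (Suc j)) * (cmod (U M))\<^sup>2
         = (\<Sum>k\<le>M. binw j (k + j) * (cmod (T (k + j)))\<^sup>2)"
proof -
  \<comment> \<open>Summation by parts: the weight \<open>fact (i + Suc j) / fact i\<close> exceeds
    its predecessor by exactly the weight of \<open>T (i + j)\<close> in \<open>U\<close>, because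
    \<open>(i + j + 1) - i = j + 1\<close>.\<close>
  have SU: "S m = U m - fact (m + Suc j) / fact m * T (m + Suc j)" for m
  proof (induction m)
    case 0
    show ?case by (simp add: S_def U_def algebra_simps)
  next
    case (Suc m)
    have "S (Suc m) = S m + fact (Suc m + Suc j) / fact (Suc m) * (T (Suc m + j) - T (Suc m + Suc j))"
      by (simp add: S_def)
    also have "\<dots> = U m + (fact (Suc m + Suc j) / fact (Suc m) - fact (m + Suc j) / fact m) * T (Suc m + j)
        - fact (Suc m + Suc j) / fact (Suc m) * T (Suc m + Suc j)"
    proof -
      have "u - p * x + q * (x - y) = u + (q - p) * x - q * y" for u p q x y :: complex
        by (simp add: algebra_simps)
      moreover have T: "T (m + Suc j) = T (Suc m + j)" by simp
      ultimately show ?thesis unfolding Suc.IH T by blast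
    qed
    also have "(fact (Suc m + Suc j) / fact (Suc m) - fact (m + Suc j) / fact m :: complex)
        = of_nat (Suc j) * fact (Suc m + j) / fact (Suc m)"
    proof -
      have "fact (Suc m + Suc j) = (of_nat (Suc m + Suc j) * fact (Suc m + j) :: complex)"
        by (simp del: of_nat_Suc of_nat_add)
      moreover have "fact (m + Suc j) / fact m = (of_nat (Suc m) * fact (Suc m + j) / fact (Suc m) :: complex)"
        by (simp del: of_nat_Suc)
      moreover have "(of_nat (Suc m + Suc j) :: complex) = of_nat (Suc m) + of_nat (Suc j)"
        by simp
      ultimately show ?thesis
        by (simp only: diff_divide_distrib[symmetric] ring_distribs add_diff_cancel_left')
    qed
    also have "U m + of_nat (Suc j) * fact (Suc m + j) / fact (Suc m) * T (Suc m + j) = U (Suc m)"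
      by (simp add: U_def)
    finally show ?case .
  qed
  show ?thesis
  proof (induction M)
    case 0
    show ?case by (simp add: U_def norm_mult norm_divide power_mult_distrib power_divide divide_simps del: of_nat_Suc)
       (simp add: power2_eq_square)
  next
    case (Suc M)
    define P Q J t x r where "P = (fact M :: real)" and "Q = (fact (M + Suc j) :: real)"
      and "J = (fact j :: real)" and "t = T (M + Suc j)" and "x = U M" and "r = real M"
    have pos: "P > 0" "Q > 0" "J > 0" "r \<ge> 0" by (simp_all add: P_def Q_def J_def r_def)
    define y where "y = Re (x * cnj t)"
    have S: "S M = x + of_real (- (Q / P)) * t"
      by (simp add: SU x_def P_def Q_def t_def)
    have U: "U (Suc M) = x + of_real (real (Suc j) * Q / (real (Suc M) * P)) * t"
      by (simp add: U_def x_def P_def Q_def t_def)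
    have w: "loc_weight (Suc j) M = P / ((r + real j + 2) * Q * J)"
      by (simp add: loc_weight_def P_def Q_def J_def r_def algebra_simps)
    have f1: "fact (Suc M) = (r + 1) * P" by (simp add: P_def r_def)
    have f2: "fact (Suc M + Suc j) = (r + real j + 2) * Q" by (simp add: Q_def r_def)
    have f3: "fact (Suc j) = (real j + 1) * J" by (simp add: J_def)
    have b: "binw j (Suc M + j) = Q / ((r + 1) * P * J)"
      by (subst binomial_fact) (simp_all add: P_def Q_def J_def r_def mult_ac)
    have IH: "(\<Sum>m<M. loc_weight (Suc j) m * (cmod (S m))\<^sup>2)
           + P / (Q * ((real j + 1) * J)) * (cmod x)\<^sup>2
         = (\<Sum>k\<le>M. binw j (k + j) * (cmod (T (k + j)))\<^sup>2)"
      using Suc.IH unfolding P_def Q_def x_def f3 .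
    \<comment> \<open>Both \<open>S M\<close> and \<open>U (Suc M)\<close> are \<open>x\<close> plus
      a real multiple of \<open>t\<close>. In the weighted sum of their squares the cross terms in
      \<open>Re (x * cnj t)\<close> cancel; what remains is the old boundary term and the new
      summand on the right.\<close>
    have key: "P / ((r + real j + 2) * Q * J) * (cmod (S M))\<^sup>2
        + (r + 1) * P / ((r + real j + 2) * Q * ((real j + 1) * J)) * (cmod (U (Suc M)))\<^sup>2
        = P / (Q * ((real j + 1) * J)) * (cmod x)\<^sup>2 + Q / ((r + 1) * P * J) * (cmod t)\<^sup>2"
    proof -
      have nz: "r + 1 \<noteq> 0" "real j + 1 \<noteq> 0" "r + real j + 2 \<noteq> 0" using pos by auto
      have e: "real (Suc j) = real j + 1" "real (Suc M) = r + 1" by (simp_all add: r_def)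
      define X Z where "X = (cmod x)\<^sup>2" and "Z = (cmod t)\<^sup>2"
      have "P / ((r + real j + 2) * Q * J) * (X + 2 * (- (Q / P)) * y + (- (Q / P))\<^sup>2 * Z)
        + (r + 1) * P / ((r + real j + 2) * Q * ((real j + 1) * J)) *
          (X + 2 * ((real j + 1) * Q / ((r + 1) * P)) * y + ((real j + 1) * Q / ((r + 1) * P))\<^sup>2 * Z)
        = P / (Q * ((real j + 1) * J)) * X + Q / ((r + 1) * P * J) * Z"
      proof -
        define a where "a = P / ((r + real j + 2) * Q * J)"
        define b where "b = (r + 1) * P / ((r + real j + 2) * Q * ((real j + 1) * J))"
        define d where "d = (real j + 1) * Q / ((r + 1) * P)"
        have ab: "a + b = P / (Q * ((real j + 1) * J))"
          unfolding a_def b_def using pos nz by (simp add: divide_simps) (simp add: algebra_simps)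
        have ad: "b * d = a * (Q / P)"
          unfolding a_def b_def d_def using pos nz by (simp add: divide_simps)
        have ac: "a * (Q / P)\<^sup>2 + b * d\<^sup>2 = Q / ((r + 1) * P * J)"
        proof -
          have "a * (Q / P)\<^sup>2 + b * d\<^sup>2 = a * (Q / P) * (Q / P) + b * d * d"
            by (simp add: power2_eq_square)
          also have "\<dots> = a * (Q / P) * (Q / P + d)"
            unfolding ad by (simp only: distrib_left)
          also have "\<dots> = Q / ((r + 1) * P * J)"
          proof -
            have "Q / P + d = Q * (r + real j + 2) / ((r + 1) * P)"
              unfolding d_def using pos nz by (simp add: divide_simps) (simp add: algebra_simps)
            then show ?thesis unfolding a_def using pos nz by (simp add: divide_simps)
          qed
          finally show ?thesis .
        qed
        have "a * (X + 2 * (- (Q / P)) * y + (- (Q / P))\<^sup>2 * Z) + b * (X + 2 * d * y + d\<^sup>2 * Z)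
          = (a + b) * X + 2 * (b * d - a * (Q / P)) * y + (a * (Q / P)\<^sup>2 + b * d\<^sup>2) * Z"
          by (simp add: algebra_simps)
        then show ?thesis using ab ad ac unfolding a_def b_def d_def by simp
      qed
      then show ?thesis
        unfolding S U cmod_add_of_real_mult_sq e X_def Z_def y_def .
    qed
    have "T (Suc M + j) = t" by (simp add: t_def)
    then show ?case
      unfolding sum.lessThan_Suc sum.atMost_Suc w f1 f2 f3 b using key IH by simp
  qed
qed

lemma fps_const_add_X_minus_nth:
  fixes l :: complex
  shows "fps_nth (fps_const a + (fps_X - fps_const l) * g) (Suc k) = fps_nth g k - l * fps_nth g (Suc k)"
    and "fps_nth (fps_const a + (fps_X - fps_const l) * g) 0 = a - l * fps_nth g 0"
  by (simp_all add: left_diff_distrib)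

text \<open>Dropping the nonnegative boundary term from \<open>local_douglas_partial\<close> gives
  the inequality. The constant \<open>a\<close> leaves no trace because \<open>loc_sum\<close> only
  reads coefficients of index at least \<open>Suc j\<close>.\<close>

lemma loc_D_le_wnorm:
  assumes l: "cmod l = 1" and f: "f = fps_const a + (fps_X - fps_const l) * g"
  shows "loc_D (Suc j) l f \<le> wnorm (binw j) g"
  unfolding loc_D_def
proof (rule ennreal_suminf_leI)
  fix M
  define T where "T k = l ^ Suc k * fps_nth g k" for k
  have "l ^ (i + Suc j) * fps_nth f (i + Suc j) = T (i + j) - T (i + Suc j)" for i
    by (simp add: f T_def fps_const_add_X_minus_nth algebra_simps)
  then have S: "loc_sum (Suc j) l f m = (\<Sum>i\<le>m. fact (i + Suc j) / fact i * (T (i + j) - T (i + Suc j)))" for m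
    by (simp add: loc_sum_def)
  have nT: "cmod (T k) = cmod (fps_nth g k)" for k
    using l by (simp add: T_def norm_mult norm_power del: power_Suc)
  have "(\<Sum>m<M. loc_weight (Suc j) m * (cmod (loc_sum (Suc j) l f m))\<^sup>2)
      \<le> (\<Sum>k\<le>M. binw j (k + j) * (cmod (T (k + j)))\<^sup>2)"
    unfolding S local_douglas_partial[symmetric] by simp
  also have "\<dots> = (\<Sum>k\<in>{j..M+j}. binw j k * (cmod (fps_nth g k))\<^sup>2)"
    unfolding nT by (rule sum.reindex_bij_witness[of _ "\<lambda>k. k - j" "\<lambda>k. k + j"]) auto
  finally have "ennreal (\<Sum>m<M. loc_weight (Suc j) m * (cmod (loc_sum (Suc j) l f m))\<^sup>2)
      \<le> ennreal (\<Sum>k\<in>{j..M+j}. binw j k * (cmod (fps_nth g k))\<^sup>2)"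
    by (rule ennreal_leI)
  also have "\<dots> = (\<Sum>k\<in>{j..M+j}. ennreal (binw j k * (cmod (fps_nth g k))\<^sup>2))"
    by (simp add: sum_ennreal)
  also have "\<dots> \<le> wnorm (binw j) g"
    unfolding wnorm_def by (rule sum_le_suminf) auto
  finally show "(\<Sum>m<M. ennreal (loc_weight (Suc j) m * (cmod (loc_sum (Suc j) l f m))\<^sup>2)) \<le> wnorm (binw j) g"
    by (simp add: sum_ennreal)
qed

text \<open>The free constant \<open>a\<close> is chosen for each \<open>M\<close> so that the boundary term \<open>U M\<close> vanishes; a limit point of
  these choices works for all \<open>M\<close>.\<close>

lemma wnorm_le_loc_D:
  assumes l: "cmod l = 1" and fin: "loc_D (Suc j) l f < \<infinity>"
  obtains a g where "f = fps_const a + (fps_X - fps_const l) * g"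
    and "wnorm (binw j) g \<le> loc_D (Suc j) l f"
proof -
  obtain E where E: "loc_D (Suc j) l f = ennreal E" "E \<ge> 0"
    using fin by (cases "loc_D (Suc j) l f") auto
  have Ele: "(\<Sum>m<M. loc_weight (Suc j) m * (cmod (loc_sum (Suc j) l f m))\<^sup>2) \<le> E" for M
    using E ennreal_suminf_le_iff[of "\<lambda>m. loc_weight (Suc j) m * (cmod (loc_sum (Suc j) l f m))\<^sup>2" E]
    unfolding loc_D_def by simp
  \<comment> \<open>Comparing coefficients in \<open>f = a + (z - l) g\<close> forces
    \<open>l ^ Suc k * fps_nth g k = a - s k\<close>, so \<open>a\<close> acts as the boundary value
    of \<open>f\<close> at \<open>l\<close>. With \<open>T k = c - s k\<close> the boundary term is
    \<open>U M = c * A M - B M\<close>; the choice that annihilates it is the weighted mean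
    \<open>\<alpha> M\<close> of \<open>s j, ..., s (j + M)\<close>.\<close>
  define s where "s k = (\<Sum>i\<le>k. l ^ i * fps_nth f i)" for k
  define A where "A M = (\<Sum>k\<le>M. of_nat (Suc j) * fact (k + j) / fact k :: complex)" for M
  define B where "B M = (\<Sum>k\<le>M. of_nat (Suc j) * fact (k + j) / fact k * s (k + j))" for M
  have A0: "A M \<noteq> 0" for M
  proof -
    have "A M = of_real (\<Sum>k\<le>M. real (Suc j) * fact (k + j) / fact k)"
      by (simp add: A_def)
    moreover have "(\<Sum>k\<le>M. real (Suc j) * fact (k + j) / fact k) > 0"
      by (rule sum_pos) auto
    ultimately show ?thesis by (simp only: of_real_eq_0_iff less_imp_neq[symmetric] not_False_eq_True)
  qed
  define \<alpha> where "\<alpha> M = B M / A M" for M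
  have bound: "(\<Sum>k\<le>M. binw j (k + j) * (cmod (\<alpha> M - s (k + j)))\<^sup>2) \<le> E" for M
  proof -
    define T where "T k = \<alpha> M - s k" for k
    have "l ^ (i + Suc j) * fps_nth f (i + Suc j) = T (i + j) - T (i + Suc j)" for i
      by (simp add: T_def s_def)
    then have S: "loc_sum (Suc j) l f m = (\<Sum>i\<le>m. fact (i + Suc j) / fact i * (T (i + j) - T (i + Suc j)))" for m
      by (simp add: loc_sum_def)
    have "(\<Sum>k\<le>M. of_nat (Suc j) * fact (k + j) / fact k * T (k + j)) = \<alpha> M * A M - B M"
      by (simp only: T_def A_def B_def left_diff_distrib right_diff_distrib sum_subtractf sum_distrib_left mult.commute)
    also have "\<dots> = 0" using A0[of M] by (simp add: \<alpha>_def)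
    finally show ?thesis
      using local_douglas_partial[of j T M] Ele[of M] unfolding S[symmetric] by (simp add: T_def)
  qed
  have "bounded (range \<alpha>)"
  proof -
    have "cmod (\<alpha> M) \<le> cmod (s j) + sqrt E" for M
    proof -
      \<comment> \<open>This summand has weight \<open>j choose j = 1\<close>, so it alone keeps
        \<open>\<alpha> M\<close> within \<open>sqrt E\<close> of the fixed number
        \<open>s j\<close>.\<close>
      have "binw j (0 + j) * (cmod (\<alpha> M - s (0 + j)))\<^sup>2
          \<le> (\<Sum>k\<le>M. binw j (k + j) * (cmod (\<alpha> M - s (k + j)))\<^sup>2)"
        by (rule member_le_sum) auto
      then have "(cmod (\<alpha> M - s j))\<^sup>2 \<le> E" using bound[of M] by simp
      then have "cmod (\<alpha> M - s j) \<le> sqrt E" by (rule real_le_rsqrt)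
      then show ?thesis using norm_triangle_ineq2[of "\<alpha> M" "s j"] by simp
    qed
    then show ?thesis by (auto simp: bounded_iff)
  qed
  then obtain a r where r: "strict_mono r" "(\<alpha> \<circ> r) \<longlonglongrightarrow> a"
    using bounded_imp_convergent_subsequence by blast
  define g where "g = Abs_fps (\<lambda>k. (a - s k) / l ^ Suc k)"
  have l0: "l \<noteq> 0" using l by auto
  have feq: "f = fps_const a + (fps_X - fps_const l) * g"
  proof (rule fps_ext)
    fix k
    show "fps_nth f k = fps_nth (fps_const a + (fps_X - fps_const l) * g) k"
      by (cases k) (auto simp: fps_const_add_X_minus_nth g_def s_def field_simps l0)
  qed
  \<comment> \<open>With \<open>K\<close> fixed, the bound at \<open>M = r i\<close> is first cut
    down to the terms up to \<open>K\<close>; then \<open>i\<close> tends to infinity.\<close>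
  have part: "(\<Sum>k\<le>K. binw j (k + j) * (cmod (a - s (k + j)))\<^sup>2) \<le> E" for K
  proof (rule LIMSEQ_le_const2)
    show "(\<lambda>i. \<Sum>k\<le>K. binw j (k + j) * (cmod ((\<alpha> \<circ> r) i - s (k + j)))\<^sup>2)
        \<longlonglongrightarrow> (\<Sum>k\<le>K. binw j (k + j) * (cmod (a - s (k + j)))\<^sup>2)"
      by (intro tendsto_intros r)
    have "(\<Sum>k\<le>K. binw j (k + j) * (cmod ((\<alpha> \<circ> r) i - s (k + j)))\<^sup>2) \<le> E" if "i \<ge> K" for i
    proof -
      have "K \<le> r i" using seq_suble[OF r(1), of i] that by simp
      then have "(\<Sum>k\<le>K. binw j (k + j) * (cmod ((\<alpha> \<circ> r) i - s (k + j)))\<^sup>2)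
         \<le> (\<Sum>k\<le>r i. binw j (k + j) * (cmod ((\<alpha> \<circ> r) i - s (k + j)))\<^sup>2)"
        by (intro sum_mono2) auto
      also have "\<dots> \<le> E" using bound[of "r i"] by simp
      finally show ?thesis .
    qed
    then show "\<exists>N. \<forall>i\<ge>N. (\<Sum>k\<le>K. binw j (k + j) * (cmod ((\<alpha> \<circ> r) i - s (k + j)))\<^sup>2) \<le> E" by blast
  qed
  have ng: "cmod (fps_nth g k) = cmod (a - s k)" for k
    using l by (simp add: g_def norm_divide norm_power norm_mult)
  have "(\<Sum>k<K. binw j k * (cmod (fps_nth g k))\<^sup>2) \<le> E" for K
  proof -
    have "(\<Sum>k<K. binw j k * (cmod (fps_nth g k))\<^sup>2) = (\<Sum>k\<in>{j..<K}. binw j k * (cmod (fps_nth g k))\<^sup>2)"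
      by (rule sum.mono_neutral_right) auto
    also have "\<dots> \<le> (\<Sum>k\<in>{j..K+j}. binw j k * (cmod (fps_nth g k))\<^sup>2)"
      by (rule sum_mono2) auto
    also have "\<dots> = (\<Sum>k\<le>K. binw j (k + j) * (cmod (a - s (k + j)))\<^sup>2)"
      unfolding ng by (rule sum.reindex_bij_witness[of _ "\<lambda>k. k + j" "\<lambda>k. k - j"]) auto
    also have "\<dots> \<le> E" by (rule part)
    finally show ?thesis .
  qed
  then have "wnorm (binw j) g \<le> ennreal E"
    unfolding wnorm_def using E by (subst ennreal_suminf_le_iff) auto
  with feq E that show ?thesis by simp
qed

section \<open>Boundedness of multipliers\<close>

lemma cmod_add_sq_le: "(cmod (x + y))\<^sup>2 \<le> 2 * (cmod x)\<^sup>2 + 2 * (cmod y)\<^sup>2"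
proof -
  have "(cmod (x + y))\<^sup>2 \<le> (cmod x + cmod y)\<^sup>2"
    by (intro power_mono norm_triangle_ineq) simp
  also have "\<dots> \<le> 2 * (cmod x)\<^sup>2 + 2 * (cmod y)\<^sup>2"
    using sum_squares_ge_zero[of "cmod x - cmod y" 0] by (simp add: power2_eq_square algebra_simps)
  finally show ?thesis .
qed

lemma wnorm_add_le:
  assumes "\<And>k. w k \<ge> 0"
  shows "wnorm w (f + g) \<le> 2 * wnorm w f + 2 * wnorm w g"
proof -
  have "wnorm w (f + g) \<le> (\<Sum>k. 2 * ennreal (w k * (cmod (fps_nth f k))\<^sup>2)
      + 2 * ennreal (w k * (cmod (fps_nth g k))\<^sup>2))"
    unfolding wnorm_def
  proof (intro suminf_le summableI)
    fix k
    have "w k * (cmod (fps_nth (f + g) k))\<^sup>2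
      \<le> w k * (2 * (cmod (fps_nth f k))\<^sup>2 + 2 * (cmod (fps_nth g k))\<^sup>2)"
      using assms cmod_add_sq_le by (intro mult_left_mono) auto
    then have "ennreal (w k * (cmod (fps_nth (f + g) k))\<^sup>2)
       \<le> ennreal (2 * (w k * (cmod (fps_nth f k))\<^sup>2) + 2 * (w k * (cmod (fps_nth g k))\<^sup>2))"
      by (intro ennreal_leI) (simp add: algebra_simps)
    then show "ennreal (w k * (cmod (fps_nth (f + g) k))\<^sup>2)
       \<le> 2 * ennreal (w k * (cmod (fps_nth f k))\<^sup>2) + 2 * ennreal (w k * (cmod (fps_nth g k))\<^sup>2)"
      using assms by (simp add: ennreal_plus ennreal_mult)
  qed
  also have "\<dots> = 2 * wnorm w f + 2 * wnorm w g"
    unfolding wnorm_def by (simp add: suminf_add[OF summableI summableI, symmetric])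
  finally show ?thesis .
qed

lemma wnorm_uminus [simp]: "wnorm w (- f) = wnorm w f"
  by (simp add: wnorm_def)

lemma wnorm_diff_le:
  assumes "\<And>k. w k \<ge> 0"
  shows "wnorm w (f - g) \<le> 2 * wnorm w f + 2 * wnorm w g"
  using wnorm_add_le[where w = w and f = f and g = "- g"] assms by simp

lemma wnorm_const_mult: "wnorm w (fps_const c * f) = ennreal ((cmod c)\<^sup>2) * wnorm w f"
  unfolding wnorm_def ennreal_suminf_cmult[symmetric]
  by (simp add: norm_mult power_mult_distrib ennreal_mult'[symmetric] mult_ac)

lemma wnorm_0 [simp]: "wnorm w 0 = 0"
  by (simp add: wnorm_def)

lemma wnorm_finite_support:
  assumes "\<And>k. k \<ge> m \<Longrightarrow> fps_nth f k = 0"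
  shows "wnorm w f = (\<Sum>k<m. ennreal (w k * (cmod (fps_nth f k))\<^sup>2))"
  unfolding wnorm_def using assms by (intro suminf_finite) auto

lemma wnorm_finite_support_lt:
  assumes "\<And>k. k \<ge> m \<Longrightarrow> fps_nth f k = 0"
  shows "wnorm w f < \<infinity>"
  using assms by (subst wnorm_finite_support[of m]) auto

text \<open>Iterates the factor 2 of \<open>wnorm_add_le\<close>. The growth in \<open>m\<close>
  does no harm, since only a fixed finite family of monomials will be summed.\<close>

lemma wnorm_sum_le:
  assumes "\<And>k. w k \<ge> 0"
  shows "wnorm w (\<Sum>i<m. F i) \<le> 2 ^ m * (\<Sum>i<m. wnorm w (F i))"
proof (induction m)
  case (Suc m)
  have one: "2 \<le> (2 ^ Suc m :: ennreal)"
    using mult_left_mono[of 1 "2 ^ m :: ennreal" 2] by (simp add: one_le_power)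
  have "wnorm w (\<Sum>i<Suc m. F i) \<le> 2 * wnorm w (\<Sum>i<m. F i) + 2 * wnorm w (F m)"
    using wnorm_add_le[OF assms] by simp
  also have "\<dots> \<le> 2 * (2 ^ m * (\<Sum>i<m. wnorm w (F i))) + 2 ^ Suc m * wnorm w (F m)"
    by (intro add_mono mult_left_mono mult_right_mono Suc.IH one) simp_all
  also have "\<dots> = 2 ^ Suc m * (\<Sum>i<Suc m. wnorm w (F i))"
    by (simp add: algebra_simps)
  finally show ?case .
qed simp

text \<open>A real-valued truncation of \<open>wnorm\<close>. Coefficient \<open>k\<close> of a
  product involves only coefficients up to \<open>k\<close> of the factors, so
  \<open>wpart w m (\<phi> * g)\<close> is determined by the first \<open>m\<close> coefficients of
  \<open>g\<close>; the gliding hump rests on this.\<close>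

definition wpart :: "(nat \<Rightarrow> real) \<Rightarrow> nat \<Rightarrow> complex fps \<Rightarrow> real" where
  "wpart w m g = (\<Sum>k<m. w k * (cmod (fps_nth g k))\<^sup>2)"

lemma wpart_cong:
  "(\<And>k. k < m \<Longrightarrow> fps_nth f k = fps_nth g k) \<Longrightarrow> wpart w m f = wpart w m g"
  by (simp add: wpart_def)

lemma wnorm_le_iff:
  assumes "\<And>k. w k \<ge> 0" "C \<ge> 0"
  shows "wnorm w g \<le> ennreal C \<longleftrightarrow> (\<forall>m. wpart w m g \<le> C)"
  unfolding wnorm_def wpart_def using assms by (intro ennreal_suminf_le_iff) auto

lemma wpart_le:
  assumes "\<And>k. w k \<ge> 0" "wnorm w g = ennreal C" "C \<ge> 0"
  shows "wpart w m g \<le> C"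
  using assms wnorm_le_iff[of w C g] by simp

lemma wpart_add_le:
  assumes "\<And>k. w k \<ge> 0"
  shows "wpart w m (f + g) \<le> 2 * wpart w m f + 2 * wpart w m g"
proof -
  have "w k * (cmod (fps_nth (f + g) k))\<^sup>2
      \<le> 2 * (w k * (cmod (fps_nth f k))\<^sup>2) + 2 * (w k * (cmod (fps_nth g k))\<^sup>2)" for k
    using mult_left_mono[OF cmod_add_sq_le[of "fps_nth f k" "fps_nth g k"] assms[of k]]
    by (simp add: algebra_simps)
  then show ?thesis
    unfolding wpart_def sum_distrib_left sum.distrib[symmetric] by (intro sum_mono)
qed

lemma wpart_const_mult: "wpart w m (fps_const c * g) = (cmod c)\<^sup>2 * wpart w m g"
  by (simp add: wpart_def sum_distrib_left norm_mult power_mult_distrib mult_ac)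

lemma wpart_mono:
  assumes "\<And>k. w k \<ge> 0" "m \<le> m'"
  shows "wpart w m g \<le> wpart w m' g"
  unfolding wpart_def using assms by (intro sum_mono2) auto

lemma fps_cutoff_eq_sum:
  fixes g :: "complex fps"
  shows "fps_cutoff m g = (\<Sum>i<m. fps_const (fps_nth g i) * fps_X ^ i)"
proof (rule fps_ext)
  fix k
  show "fps_nth (fps_cutoff m g) k = fps_nth (\<Sum>i<m. fps_const (fps_nth g i) * fps_X ^ i) k"
    by (simp add: fps_sum_nth if_distrib[of "\<lambda>x. _ * x"] cong: if_cong)
qed

text \<open>A polynomial of degree below \<open>m\<close> combines \<open>m\<close> monomials. Each
  \<open>\<phi> * fps_X ^ i\<close> has finite norm by hypothesis, and positivity of
  \<open>w i\<close> bounds coefficient \<open>i\<close> of \<open>g\<close> by the norm of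
  \<open>g\<close>.\<close>

lemma multiplier_bounded_on_cutoff:
  fixes w :: "nat \<Rightarrow> real" and \<phi> :: "complex fps"
  assumes w: "\<And>k. w k > 0"
    and mult: "\<And>g. wnorm w g < \<infinity> \<Longrightarrow> wnorm w (\<phi> * g) < \<infinity>"
  shows "\<exists>C<\<infinity>. \<forall>g. wnorm w (\<phi> * fps_cutoff m g) \<le> C * wnorm w g"
proof (intro exI conjI allI)
  define C where "C = 2 ^ m * (\<Sum>i<m. ennreal (inverse (w i)) * wnorm w (\<phi> * fps_X ^ i))"
  have "wnorm w (\<phi> * fps_X ^ i) < \<infinity>" for i
    by (rule mult, rule wnorm_finite_support_lt[of "Suc i"]) auto
  then show "C < \<infinity>"
    unfolding C_def by (auto simp: ennreal_mult_less_top power_less_top_ennreal)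
  fix g
  have "wnorm w (\<phi> * fps_cutoff m g) = wnorm w (\<Sum>i<m. fps_const (fps_nth g i) * (\<phi> * fps_X ^ i))"
    by (simp add: fps_cutoff_eq_sum sum_distrib_left mult_ac)
  also have "\<dots> \<le> 2 ^ m * (\<Sum>i<m. wnorm w (fps_const (fps_nth g i) * (\<phi> * fps_X ^ i)))"
    using w by (intro wnorm_sum_le) (auto intro: less_imp_le)
  also have "\<dots> \<le> 2 ^ m * (\<Sum>i<m. ennreal (inverse (w i)) * wnorm w (\<phi> * fps_X ^ i) * wnorm w g)"
  proof (intro mult_left_mono sum_mono)
    fix i
    have "ennreal ((cmod (fps_nth g i))\<^sup>2) = ennreal (inverse (w i)) * ennreal (w i * (cmod (fps_nth g i))\<^sup>2)"
      using w[of i] by (simp add: ennreal_mult[symmetric] less_imp_le)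
    also have "\<dots> \<le> ennreal (inverse (w i)) * wnorm w g"
      unfolding wnorm_def using sum_le_suminf[of "\<lambda>k. ennreal (w k * (cmod (fps_nth g k))\<^sup>2)" "{i}"]
      by (intro mult_left_mono) auto
    finally have "ennreal ((cmod (fps_nth g i))\<^sup>2) * wnorm w (\<phi> * fps_X ^ i)
        \<le> ennreal (inverse (w i)) * wnorm w g * wnorm w (\<phi> * fps_X ^ i)"
      by (rule mult_right_mono) simp
    then show "wnorm w (fps_const (fps_nth g i) * (\<phi> * fps_X ^ i))
        \<le> ennreal (inverse (w i)) * wnorm w (\<phi> * fps_X ^ i) * wnorm w g"
      unfolding wnorm_const_mult by (simp only: mult_ac)
  qed simp
  also have "\<dots> = C * wnorm w g"
    by (simp add: C_def sum_distrib_right mult.assoc)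
  finally show "wnorm w (\<phi> * fps_cutoff m g) \<le> C * wnorm w g" .
qed

text \<open>Multiplication by \<open>\<phi>\<close> is bounded on polynomials of degree below
  \<open>m\<close>, so its unboundedness must show on series that vanish to order \<open>m\<close>.
  A cut at a large \<open>M\<close> then turns the witness into a finite block.\<close>

lemma unbounded_multiplier_block:
  fixes w :: "nat \<Rightarrow> real" and \<phi> :: "complex fps"
  assumes w: "\<And>k. w k > 0"
    and mult: "\<And>g. wnorm w g < \<infinity> \<Longrightarrow> wnorm w (\<phi> * g) < \<infinity>"
    and unb: "\<And>B. B < \<infinity> \<Longrightarrow> \<exists>g. wnorm w (\<phi> * g) > B * wnorm w g"
    and c: "c \<ge> 0"
  obtains x M where "m < M" "\<And>k. k < m \<or> k \<ge> M \<Longrightarrow> fps_nth x k = 0"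
    "wpart w M x \<le> 1" "wpart w M (\<phi> * x) > c"
proof -
  have w0: "w k \<ge> 0" for k using w less_imp_le by blast
  obtain C where C: "C < \<infinity>" "\<And>g. wnorm w (\<phi> * fps_cutoff m g) \<le> C * wnorm w g"
    using multiplier_bounded_on_cutoff[where m = m, OF w mult] by blast
  \<comment> \<open>\<open>C\<close> pays for the low part \<open>fps_cutoff m h\<close>, and the
    factors 2 come from \<open>wnorm_add_le\<close>. The summand 1 keeps the factor nonzero, which
    rules out \<open>wnorm w g = \<infinity>\<close>, and leaves a strict inequality after
    normalisation.\<close>
  obtain g where g: "wnorm w (\<phi> * g) > (2 * ennreal c + 2 * C + 1) * wnorm w g"
    using unb[of "2 * ennreal c + 2 * C + 1"] C(1) by (auto simp: ennreal_mult_less_top)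
  have fin: "wnorm w g < \<infinity>"
  proof (rule ccontr)
    assume "\<not> wnorm w g < \<infinity>"
    then have "(2 * ennreal c + 2 * C + 1) * wnorm w g = \<infinity>"
      by (auto simp: ennreal_mult_eq_top_iff less_top)
    with g show False by simp
  qed
  have nz: "wnorm w g \<noteq> 0"
  proof
    assume 0: "wnorm w g = 0"
    have "fps_nth g k = 0" for k
    proof -
      have "ennreal (w k * (cmod (fps_nth g k))\<^sup>2) \<le> wnorm w g"
        unfolding wnorm_def using sum_le_suminf[of "\<lambda>k. ennreal (w k * (cmod (fps_nth g k))\<^sup>2)" "{k}"] by auto
      then show ?thesis using 0 w[of k]
        by (auto simp: ennreal_eq_0_iff mult_le_0_iff)
    qed
    then have "g = 0" by (intro fps_ext) simp
    with g show False by simp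
  qed
  then obtain s where s: "wnorm w g = ennreal s" "s > 0"
    using fin by (cases "wnorm w g") (auto simp: order_le_less)
  define h where "h = fps_const (of_real (1 / sqrt s)) * g"
  have h1: "wnorm w h = 1"
    using s by (simp add: h_def wnorm_const_mult norm_divide power_divide ennreal_mult[symmetric])
  have h2: "wnorm w (\<phi> * h) > 2 * ennreal c + 2 * C"
  proof -
    have e: "wnorm w (\<phi> * h) = ennreal (1 / s) * wnorm w (\<phi> * g)"
    proof -
      have eq: "\<phi> * h = fps_const (of_real (1 / sqrt s)) * (\<phi> * g)"
        unfolding h_def by (rule mult.left_commute)
      show ?thesis unfolding eq wnorm_const_mult using s by (simp add: norm_divide power_divide)
    qed
    have "2 * ennreal c + 2 * C < \<infinity>" using C(1) by (auto simp: ennreal_mult_less_top)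
    then have "2 * ennreal c + 2 * C < 2 * ennreal c + 2 * C + 1"
      by (cases "2 * ennreal c + 2 * C") (auto simp: ennreal_less_iff simp flip: ennreal_plus ennreal_1)
    also have "\<dots> = ennreal (1 / s) * ((2 * ennreal c + 2 * C + 1) * ennreal s)"
    proof -
      have "ennreal (1 / s) * ennreal s = 1" using s by (simp add: ennreal_mult[symmetric])
      then show ?thesis by (simp only: mult.commute[of _ "ennreal s"] mult.assoc[symmetric]) (simp add: mult.commute)
    qed
    also have "\<dots> \<le> wnorm w (\<phi> * h)"
      unfolding e s(1)[symmetric] using g by (intro mult_left_mono) auto
    finally show ?thesis .
  qed
  define q where "q = h - fps_cutoff m h"
  have "wnorm w (\<phi> * h) \<le> 2 * wnorm w (\<phi> * fps_cutoff m h) + 2 * wnorm w (\<phi> * q)"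
    using wnorm_add_le[where f = "\<phi> * fps_cutoff m h" and g = "\<phi> * q" and w = w] w0
    by (simp add: q_def algebra_simps)
  also have "\<dots> \<le> 2 * C + 2 * wnorm w (\<phi> * q)"
    using C(2)[of h] h1 by (intro add_mono mult_left_mono) auto
  finally have "2 * wnorm w (\<phi> * q) + 2 * C > 2 * ennreal c + 2 * C"
    using order.strict_trans2[OF h2] by (simp only: add.commute)
  then have "wnorm w (\<phi> * q) > ennreal c"
    by (meson add_mono leD leI mult_left_mono order_refl zero_le)
  then have "\<not> (\<forall>M. wpart w M (\<phi> * q) \<le> c)"
    unfolding wnorm_le_iff[where w = w and g = "\<phi> * q", OF w0 c, symmetric] by (simp add: not_le)
  then obtain M0 where M0: "wpart w M0 (\<phi> * q) > c"
    by (auto simp: not_le)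
  define M where "M = max M0 (Suc m)"
  define x where "x = fps_cutoff M q"
  show ?thesis
  proof
    show "m < M" by (simp add: M_def)
    show "fps_nth x k = 0" if "k < m \<or> k \<ge> M" for k
      using that by (auto simp: x_def q_def)
    have "wpart w M x \<le> wpart w M h"
      unfolding wpart_def by (intro sum_mono mult_left_mono) (auto simp: x_def q_def w0)
    also have "\<dots> \<le> 1" by (rule wpart_le[OF w0]) (use h1 in auto)
    finally show "wpart w M x \<le> 1" .
    have "c < wpart w M (\<phi> * q)"
      using M0 wpart_mono[where w = w and m = M0 and m' = M and g = "\<phi> * q"] w0 by (simp add: M_def)
    also have "wpart w M (\<phi> * q) = wpart w M (\<phi> * x)"
      by (intro wpart_cong) (simp add: x_def fps_cutoff_right_mult_nth)
    finally show "wpart w M (\<phi> * x) > c" .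
  qed
qed

text \<open>A gliding hump: multiplication by \<open>\<phi>\<close> does not lower the order of vanishing, so
  the blocks added after stage \<open>i\<close> leave the first \<open>m i\<close> coefficients of the product unchanged.\<close>

lemma multiplier_bounded:
  fixes w :: "nat \<Rightarrow> real" and \<phi> :: "complex fps"
  assumes w: "\<And>k. w k > 0"
    and mult: "\<And>g. wnorm w g < \<infinity> \<Longrightarrow> wnorm w (\<phi> * g) < \<infinity>"
  shows "\<exists>B<\<infinity>. \<forall>g. wnorm w (\<phi> * g) \<le> B * wnorm w g"
proof (rule ccontr)
  assume "\<not> ?thesis"
  then have unb: "\<exists>g. wnorm w (\<phi> * g) > B * wnorm w g" if "B < \<infinity>" for B
    using that by (meson not_le)
  have w0: "w k \<ge> 0" for k using w less_imp_le by blast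
  \<comment> \<open>A state \<open>(m, y)\<close> is the polynomial built so far and a bound beyond
    its support. The norm budget grows by \<open>1 / 2 ^ Suc i\<close> at each stage and so stays
    below 2; \<open>i \<le> m\<close> ensures that every coefficient is eventually frozen.\<close>
  define P where "P i s = (case s of (m, y) \<Rightarrow> i \<le> m \<and> (\<forall>k\<ge>m. fps_nth y k = 0) \<and>
      wpart w m y \<le> 2 - 1 / 2 ^ i)" for i :: nat and s :: "nat \<times> complex fps"
  define Q where "Q i s t = (case s of (m, y) \<Rightarrow> case t of (m', y') \<Rightarrow> m < m' \<and>
      (\<forall>k<m. fps_nth y' k = fps_nth y k) \<and> wpart w m' (\<phi> * y') \<ge> real i)"
    for i :: nat and s t :: "nat \<times> complex fps"
  have "\<exists>s. \<forall>i. P i (s i) \<and> Q i (s i) (s (Suc i))"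
  proof (rule dependent_nat_choice)
    show "\<exists>s. P 0 s" by (rule exI[of _ "(0, 0)"]) (simp add: P_def wpart_def)
    fix s i assume "P i s"
    moreover obtain m y where s: "s = (m, y)" by fastforce
    ultimately have m: "i \<le> m" and y: "\<And>k. k \<ge> m \<Longrightarrow> fps_nth y k = 0" and yn: "wpart w m y \<le> 2 - 1 / 2 ^ i"
      by (auto simp: P_def)
    have "wnorm w (\<phi> * y) < \<infinity>" by (intro mult wnorm_finite_support_lt[of m] y)
    then obtain Y where Y: "wnorm w (\<phi> * y) = ennreal Y" "Y \<ge> 0" by (cases "wnorm w (\<phi> * y)") auto
    \<comment> \<open>The block will be scaled by \<open>1 / 2 ^ Suc i\<close>, which divides its
      squared norm by \<open>4 ^ Suc i\<close>. The factor 2 comes from \<open>wpart_add_le\<close>,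
      and \<open>Y\<close> absorbs the contribution of the earlier \<open>y\<close>.\<close>
    have c0: "4 ^ Suc i * (2 * (real i + Y)) \<ge> 0" using Y(2) by simp
    have "\<exists>x M. m < M \<and> (\<forall>k. k < m \<or> k \<ge> M \<longrightarrow> fps_nth x k = 0) \<and>
      wpart w M x \<le> 1 \<and> wpart w M (\<phi> * x) > 4 ^ Suc i * (2 * (real i + Y))"
      by (rule unbounded_multiplier_block[where m = m, OF w mult unb c0]) blast+
    then obtain x M where x: "m < M" "\<And>k. k < m \<or> k \<ge> M \<Longrightarrow> fps_nth x k = 0"
      "wpart w M x \<le> 1" "wpart w M (\<phi> * x) > 4 ^ Suc i * (2 * (real i + Y))" by blast
    define c where "c = (of_real (1 / 2 ^ Suc i) :: complex)"
    have c2: "(cmod c)\<^sup>2 = 1 / 4 ^ Suc i"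
    proof -
      have "((2::real) ^ Suc i)\<^sup>2 = (2\<^sup>2) ^ Suc i" by (simp only: power_mult[symmetric] mult.commute)
      then have "((2::real) ^ Suc i)\<^sup>2 = 4 ^ Suc i" by simp
      moreover have "cmod c = 1 / 2 ^ Suc i" by (simp add: c_def norm_divide norm_power norm_mult)
      ultimately show ?thesis by (simp only: power_divide power_one)
    qed
    define y' where "y' = y + fps_const c * x"
    have y'1: "fps_nth y' k = (if k < m then fps_nth y k else c * fps_nth x k)" for k
      using y[of k] x(2)[of k] by (simp add: y'_def)
    have "P (Suc i) (M, y')"
    proof -
      \<comment> \<open>The supports of \<open>y\<close> and \<open>x\<close> are disjoint, so
        squared norms add exactly and no factor 2 accumulates over the stages.\<close>
      have "wpart w M y' = wpart w m y + (\<Sum>k=m..<M. w k * (cmod (c * fps_nth x k))\<^sup>2)"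
      proof -
        have "wpart w M y' = (\<Sum>k<m. w k * (cmod (fps_nth y' k))\<^sup>2) + (\<Sum>k=m..<M. w k * (cmod (fps_nth y' k))\<^sup>2)"
          unfolding wpart_def lessThan_atLeast0
          by (rule sum.atLeastLessThan_concat[symmetric]) (use x(1) in auto)
        then show ?thesis by (simp add: y'1 wpart_def)
      qed
      also have "(\<Sum>k=m..<M. w k * (cmod (c * fps_nth x k))\<^sup>2)
          = (\<Sum>k=m..<M. w k * (cmod (fps_nth (fps_const c * x) k))\<^sup>2)" by simp
      also have "\<dots> \<le> wpart w M (fps_const c * x)"
        unfolding wpart_def using w0 by (intro sum_mono2) auto
      also have "\<dots> \<le> 1 / 4 ^ Suc i" using x(3) unfolding wpart_const_mult c2
        by (simp add: divide_simps)
      also have "1 / 4 ^ Suc i \<le> (1 / 2 ^ Suc i :: real)"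
        by (intro divide_left_mono power_mono) auto
      finally have "wpart w M y' \<le> wpart w m y + 1 / 2 ^ Suc i" by simp
      also have "\<dots> \<le> 2 - 1 / 2 ^ Suc i"
      proof -
        have "1 / 2 ^ i = 2 * (1 / 2 ^ Suc i :: real)" by simp
        with yn show ?thesis by linarith
      qed
      finally show ?thesis using m x(1,2) by (auto simp: P_def y'1)
    qed
    moreover have "Q i s (M, y')"
    proof -
      have "1 / 4 ^ Suc i * wpart w M (\<phi> * x) = wpart w M (fps_const c * (\<phi> * x))"
        by (simp add: wpart_const_mult c2)
      also have "fps_const c * (\<phi> * x) = \<phi> * y' + - (\<phi> * y)"
        by (simp add: y'_def algebra_simps)
      also have "wpart w M (\<phi> * y' + - (\<phi> * y)) \<le> 2 * wpart w M (\<phi> * y') + 2 * wpart w M (- (\<phi> * y))"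
        by (rule wpart_add_le[OF w0])
      also have "wpart w M (- (\<phi> * y)) = wpart w M (\<phi> * y)" by (simp add: wpart_def)
      also have "wpart w M (\<phi> * y) \<le> Y" by (rule wpart_le[OF w0 Y])
      finally have "1 / 4 ^ Suc i * wpart w M (\<phi> * x) \<le> 2 * wpart w M (\<phi> * y') + 2 * Y" by simp
      moreover have "2 * (real i + Y) \<le> 1 / 4 ^ Suc i * wpart w M (\<phi> * x)"
        using x(4) by (simp add: field_simps)
      ultimately have "wpart w M (\<phi> * y') \<ge> real i" by simp
      then show ?thesis using x(1) by (simp add: Q_def s y'1)
    qed
    ultimately show "\<exists>t. P (Suc i) t \<and> Q i s t" by blast
  qed
  then obtain s where PQ: "\<And>i. P i (s i)" "\<And>i. Q i (s i) (s (Suc i))" by blast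
  define m y where "m i = fst (s i)" and "y i = snd (s i)" for i
  have P: "i \<le> m i" "wpart w (m i) (y i) \<le> 2 - 1 / 2 ^ i" for i
    using PQ(1)[of i] by (auto simp: P_def m_def y_def split: prod.splits)
  have Q: "m i < m (Suc i)" "\<And>k. k < m i \<Longrightarrow> fps_nth (y (Suc i)) k = fps_nth (y i) k"
    "wpart w (m (Suc i)) (\<phi> * y (Suc i)) \<ge> real i" for i
    using PQ(2)[of i] by (auto simp: Q_def m_def y_def split: prod.splits)
  have mono: "m i \<le> m i'" if "i \<le> i'" for i i'
    using that Q(1) by (simp add: lift_Suc_mono_le less_imp_le)
  have comp: "fps_nth (y i') k = fps_nth (y i) k" if "i \<le> i'" "k < m i" for i i' k
    using that
  proof (induction i' rule: dec_induct)
    case (step i')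
    then show ?case using Q(2)[of k i'] mono[of i i'] by simp
  qed simp
  \<comment> \<open>The coefficientwise limit of the \<open>y i\<close>: coefficient
    \<open>k\<close> is frozen from stage \<open>Suc k\<close> on, because
    \<open>k < Suc k \<le> m (Suc k)\<close>.\<close>
  define g where "g = Abs_fps (\<lambda>k. fps_nth (y (Suc k)) k)"
  have g: "fps_nth g k = fps_nth (y i) k" if "k < m i" for i k
  proof -
    have "k < m (Suc k)" using P(1)[of "Suc k"] by simp
    then show ?thesis
      using comp[of i "Suc k" k] comp[of "Suc k" i k] that by (cases "i \<le> Suc k") (auto simp: g_def)
  qed
  have "wpart w k g \<le> 2" for k
  proof -
    have "wpart w k g \<le> wpart w (m k) g" by (intro wpart_mono w0 P)
    also have "\<dots> = wpart w (m k) (y k)" by (intro wpart_cong g)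
    also have "\<dots> \<le> 2" using P(2)[of k] by (rule order.trans) simp
    finally show ?thesis .
  qed
  then have "wnorm w g \<le> ennreal 2" by (subst wnorm_le_iff) (auto simp: w0)
  then have "wnorm w (\<phi> * g) < \<infinity>" by (intro mult) (auto intro: le_less_trans)
  then obtain G where G: "wnorm w (\<phi> * g) = ennreal G" "G \<ge> 0" by (cases "wnorm w (\<phi> * g)") auto
  obtain i :: nat where i: "real i > G" using reals_Archimedean2 by blast
  have "real i \<le> wpart w (m (Suc i)) (\<phi> * y (Suc i))" by (rule Q)
  also have "\<dots> = wpart w (m (Suc i)) (\<phi> * fps_cutoff (m (Suc i)) (y (Suc i)))"
    by (intro wpart_cong) (simp add: fps_cutoff_right_mult_nth)
  also have "fps_cutoff (m (Suc i)) (y (Suc i)) = fps_cutoff (m (Suc i)) g"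
    by (simp add: fps_cutoff_eq_fps_cutoff_iff g)
  also have "wpart w (m (Suc i)) (\<phi> * \<dots>) = wpart w (m (Suc i)) (\<phi> * g)"
    by (intro wpart_cong) (simp add: fps_cutoff_right_mult_nth)
  also have "\<dots> \<le> G" by (rule wpart_le[OF w0 G])
  finally show False using i by simp
qed

section \<open>Fejer means\<close>

text \<open>The truncated subtraction makes the coefficients of index above \<open>N\<close> vanish.\<close>

definition fejer :: "nat \<Rightarrow> complex fps \<Rightarrow> complex fps" where
  "fejer N \<phi> = Abs_fps (\<lambda>k. of_nat (Suc N - k) / of_nat (Suc N) * fps_nth \<phi> k)"

lemma fejer_const_mult: "fejer N (fps_const c * \<phi>) = fps_const c * fejer N \<phi>"
  by (rule fps_ext) (simp add: fejer_def mult_ac)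

lemma cmod_sum_sq_le:
  fixes x :: "'a \<Rightarrow> complex"
  shows "(cmod (\<Sum>i\<in>A. x i))\<^sup>2 \<le> real (card A) * (\<Sum>i\<in>A. (cmod (x i))\<^sup>2)"
proof -
  have "(cmod (\<Sum>i\<in>A. x i))\<^sup>2 \<le> (\<Sum>i\<in>A. cmod (x i))\<^sup>2"
    by (intro power_mono norm_sum) simp
  also have "\<dots> \<le> (\<Sum>i\<in>A. (cmod (x i))\<^sup>2) * real (card A)"
    by (rule sum_squared_le_sum_of_squares)
  finally show ?thesis by (simp add: mult.commute)
qed

lemma ennreal_suminf_commute:
  fixes f :: "nat \<Rightarrow> nat \<Rightarrow> ennreal"
  shows "(\<Sum>i. \<Sum>k. f i k) = (\<Sum>k. \<Sum>i. f i k)"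
proof -
  have "(\<Sum>k. \<Sum>i. f i k) = (\<integral>\<^sup>+ k. (\<Sum>i. f i k) \<partial>count_space UNIV)"
    by (simp only: nn_integral_count_space_nat)
  also have "\<dots> = (\<Sum>i. \<integral>\<^sup>+ k. f i k \<partial>count_space UNIV)"
    by (rule nn_integral_suminf) simp
  finally show ?thesis by (simp only: nn_integral_count_space_nat)
qed

lemma suminf_window:
  fixes c :: ennreal
  shows "(\<Sum>m. if k \<le> m \<and> m \<le> k + N then c else 0) = of_nat (Suc N) * c"
proof -
  have "(\<Sum>m. if k \<le> m \<and> m \<le> k + N then c else 0) = (\<Sum>m\<in>{k..k+N}. if k \<le> m \<and> m \<le> k + N then c else 0)"
    by (rule suminf_finite) auto
  also have "\<dots> = (\<Sum>m\<in>{k..k+N}. c)" by (rule sum.cong) auto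
  finally show ?thesis by simp
qed

text \<open>The Fejer weight \<open>(N + 1 - |k - i|)\<^sup>+\<close> counts the windows \<open>{m - N..m}\<close> that contain both \<open>i\<close>
  and \<open>k\<close>, so the Fejer mean of a multiplication operator is an average of its compressions to windows.\<close>

lemma wnorm_fejer_mult_le:
  assumes w: "\<And>k. w k \<ge> 0" and B: "\<And>g. wnorm w (\<phi> * g) \<le> B * wnorm w g"
  shows "wnorm w (fejer N \<phi> * g) \<le> B * wnorm w g"
proof -
  define Q where "Q m = Abs_fps (\<lambda>k. if k \<le> m \<and> m \<le> k + N then fps_nth g k else 0)" for m
  have repr: "of_nat (Suc N) * fps_nth (fejer N \<phi> * g) k = (\<Sum>m\<in>{k..k+N}. fps_nth (\<phi> * Q m) k)" for k
  proof -
    have "(\<Sum>m\<in>{k..k+N}. fps_nth (\<phi> * Q m) k)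
        = (\<Sum>i=0..k. \<Sum>m\<in>{k..k+N}. fps_nth \<phi> i * fps_nth (Q m) (k - i))"
      unfolding fps_mult_nth by (rule sum.swap)
    also have "\<dots> = (\<Sum>i=0..k. of_nat (Suc N - i) * fps_nth \<phi> i * fps_nth g (k - i))"
    proof (rule sum.cong[OF refl])
      fix i assume i: "i \<in> {0..k}"
      \<comment> \<open>Of the windows ending in \<open>{k..k+N}\<close>, those that still contain
        \<open>k - i\<close> have \<open>m \<le> k - i + N\<close>; there are
        \<open>Suc N - i\<close> of them, none if \<open>i > N\<close>.\<close>
      have "(\<Sum>m\<in>{k..k+N}. fps_nth \<phi> i * fps_nth (Q m) (k - i))
          = (\<Sum>m\<in>{k..<k + (Suc N - i)}. fps_nth \<phi> i * fps_nth g (k - i))"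
        using i by (intro sum.mono_neutral_cong_right) (auto simp: Q_def)
      then show "(\<Sum>m\<in>{k..k+N}. fps_nth \<phi> i * fps_nth (Q m) (k - i))
          = of_nat (Suc N - i) * fps_nth \<phi> i * fps_nth g (k - i)" by simp
    qed
    also have "\<dots> = of_nat (Suc N) * fps_nth (fejer N \<phi> * g) k"
      unfolding fps_mult_nth sum_distrib_left by (rule sum.cong) (simp_all add: fejer_def del: of_nat_Suc)
    finally show ?thesis by simp
  qed
  define e where "e m k = ennreal (w k * (cmod (fps_nth (\<phi> * Q m) k))\<^sup>2)" for m k
  \<comment> \<open>Cauchy-Schwarz over the windows containing \<open>k\<close> costs one factor
    \<open>N + 1\<close>, and the windows cover each index \<open>N + 1\<close> times. Together
    these cancel the square of \<open>N + 1\<close> on the left, so the constant \<open>B\<close> is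
    not enlarged.\<close>
  have term_le: "of_nat (Suc N) * ennreal (w k * (cmod (fps_nth (fejer N \<phi> * g) k))\<^sup>2) \<le> (\<Sum>m. e m k)" for k
  proof -
    define X where "X = cmod (fps_nth (fejer N \<phi> * g) k)"
    define Y where "Y = (\<Sum>m\<in>{k..k+N}. (cmod (fps_nth (\<phi> * Q m) k))\<^sup>2)"
    have "(cmod (of_nat (Suc N) * fps_nth (fejer N \<phi> * g) k))\<^sup>2 \<le> real (card {k..k+N}) * Y"
      unfolding repr Y_def by (rule cmod_sum_sq_le)
    then have "real (Suc N) * (real (Suc N) * X\<^sup>2) \<le> real (Suc N) * Y"
      by (simp add: norm_mult power_mult_distrib X_def power2_eq_square mult_ac del: of_nat_Suc)
    then have "real (Suc N) * X\<^sup>2 \<le> Y" by (simp del: of_nat_Suc)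
    then have "w k * (real (Suc N) * X\<^sup>2) \<le> w k * Y" by (intro mult_left_mono w)
    then have "ennreal (real (Suc N) * (w k * X\<^sup>2)) \<le> ennreal (w k * Y)"
      by (intro ennreal_leI) (simp add: mult_ac)
    also have "\<dots> = (\<Sum>m\<in>{k..k+N}. e m k)"
      unfolding Y_def e_def sum_distrib_left by (subst sum_ennreal) (auto simp: w)
    also have "\<dots> \<le> (\<Sum>m. e m k)" by (rule sum_le_suminf) auto
    finally show ?thesis
      using w[of k] by (simp add: ennreal_mult X_def ennreal_of_nat_eq_real_of_nat del: of_nat_Suc)
  qed
  have "of_nat (Suc N) * wnorm w (fejer N \<phi> * g) \<le> (\<Sum>k. \<Sum>m. e m k)"
    unfolding wnorm_def ennreal_suminf_cmult[symmetric] by (intro suminf_le summableI term_le)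
  also have "\<dots> = (\<Sum>m. wnorm w (\<phi> * Q m))"
    unfolding e_def wnorm_def by (rule ennreal_suminf_commute)
  also have "\<dots> \<le> (\<Sum>m. B * wnorm w (Q m))"
    by (intro suminf_le summableI B)
  also have "\<dots> = B * (\<Sum>k. \<Sum>m. ennreal (w k * (cmod (fps_nth (Q m) k))\<^sup>2))"
    unfolding wnorm_def ennreal_suminf_cmult by (subst ennreal_suminf_commute) simp
  also have "(\<lambda>k. \<Sum>m. ennreal (w k * (cmod (fps_nth (Q m) k))\<^sup>2))
      = (\<lambda>k. of_nat (Suc N) * ennreal (w k * (cmod (fps_nth g k))\<^sup>2))"
  proof
    fix k
    have "(\<Sum>m. ennreal (w k * (cmod (fps_nth (Q m) k))\<^sup>2))
       = (\<Sum>m. if k \<le> m \<and> m \<le> k + N then ennreal (w k * (cmod (fps_nth g k))\<^sup>2) else 0)"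
      by (intro suminf_cong) (simp add: Q_def)
    then show "(\<Sum>m. ennreal (w k * (cmod (fps_nth (Q m) k))\<^sup>2))
       = of_nat (Suc N) * ennreal (w k * (cmod (fps_nth g k))\<^sup>2)"
      by (simp only: suminf_window)
  qed
  also have "B * (\<Sum>k. of_nat (Suc N) * ennreal (w k * (cmod (fps_nth g k))\<^sup>2)) = of_nat (Suc N) * (B * wnorm w g)"
    by (simp add: wnorm_def mult_ac del: of_nat_Suc)
  finally show ?thesis
    by (subst (asm) ennreal_mult_le_mult_iff) (auto simp del: of_nat_Suc)
qed

text \<open>Up to powers of \<open>l\<close>, the new quotient \<open>\<psi>'\<close> is a factor at
  most 1 times \<open>\<psi>\<close>, minus \<open>1 / (N + 1)\<close> times a sum of later
  coefficients. Cauchy-Schwarz bounds the square of the second part by \<open>1 / (N + 1)\<close>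
  times a tail sum, and only \<open>N\<close> indices \<open>k\<close> occur, so each part
  contributes at most \<open>2 * wnorm w \<psi>\<close>. Monotonicity of \<open>w\<close> allows
  \<open>w k\<close> to be replaced by \<open>w i\<close> for \<open>i > k\<close> in the
  tail.\<close>

lemma fejer_linear_factor:
  assumes l: "cmod l = 1" and \<phi>: "\<phi> = fps_const b + (fps_X - fps_const l) * \<psi>"
    and w: "\<And>k. w k \<ge> 0" "mono w"
  obtains b' \<psi>' where "fejer N \<phi> = fps_const b' + (fps_X - fps_const l) * \<psi>'"
    and "wnorm w \<psi>' \<le> 4 * wnorm w \<psi>"
proof
  have l0: "l \<noteq> 0" using l by auto
  define T where "T k = l ^ Suc k * fps_nth \<psi> k" for k
  \<comment> \<open>Coefficient \<open>k + 1\<close> of the Fejer mean carries the factor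
    \<open>(N - k) / (N + 1)\<close>, so \<open>T'\<close> has to satisfy \<open>T'diff\<close>
    below. Summation by parts from infinity gives this solution, which vanishes for
    \<open>k \<ge> N\<close>.\<close>
  define T' where "T' k = (of_nat (N - k) * T k - (\<Sum>i=Suc k..N. T i)) / of_nat (Suc N)" for k
  define \<psi>' where "\<psi>' = Abs_fps (\<lambda>k. T' k / l ^ Suc k)"
  define b' where "b' = fps_nth (fejer N \<phi>) 0 + l * fps_nth \<psi>' 0"
  have nT: "cmod (T k) = cmod (fps_nth \<psi> k)" "cmod (T' k) = cmod (fps_nth \<psi>' k)" for k
    using l by (simp_all add: T_def \<psi>'_def norm_mult norm_divide norm_power)
  have T'diff: "T' k - T' (Suc k) = of_nat (N - k) / of_nat (Suc N) * (T k - T (Suc k))" for k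
  proof (cases "k < N")
    case True
    then have "(\<Sum>i=Suc k..N. T i) = T (Suc k) + (\<Sum>i=Suc (Suc k)..N. T i)"
      by (intro sum.atLeast_Suc_atMost) simp
    moreover have "(of_nat (N - k) :: complex) = of_nat (N - Suc k) + 1"
      using True by (simp add: of_nat_diff)
    ultimately show ?thesis
      by (simp add: T'_def diff_divide_distrib[symmetric] del: of_nat_Suc) (simp add: algebra_simps del: of_nat_Suc)
  next
    case False
    then show ?thesis by (simp add: T'_def)
  qed
  show "fejer N \<phi> = fps_const b' + (fps_X - fps_const l) * \<psi>'"
  proof (rule fps_ext)
    fix k
    show "fps_nth (fejer N \<phi>) k = fps_nth (fps_const b' + (fps_X - fps_const l) * \<psi>') k"
    proof (cases k)
      case (Suc i)
      have "l ^ Suc i * fps_nth (fejer N \<phi>) (Suc i) = of_nat (N - i) / of_nat (Suc N) * (T i - T (Suc i))"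
        by (simp add: fejer_def \<phi> fps_const_add_X_minus_nth T_def algebra_simps del: of_nat_Suc)
      also have "\<dots> = T' i - T' (Suc i)" by (simp add: T'diff)
      finally show ?thesis
        using l0 by (simp add: Suc fps_const_add_X_minus_nth \<psi>'_def field_simps)
    qed (simp add: b'_def fps_const_add_X_minus_nth)
  qed
  define W where "W = wnorm w \<psi>"
  have "ennreal (w k * (cmod (fps_nth \<psi>' k))\<^sup>2)
     \<le> 2 * ennreal (w k * (cmod (fps_nth \<psi> k))\<^sup>2) + (if k < N then ennreal (2 / real (Suc N)) * W else 0)" for k
  proof (cases "k < N")
    case True
    define Y where "Y = (\<Sum>i=Suc k..N. (cmod (fps_nth \<psi> i))\<^sup>2)"
    have N0: "real (Suc N) > 0" by simp
    have split: "T' k = of_nat (N - k) / of_nat (Suc N) * T k + (- 1 / of_nat (Suc N)) * (\<Sum>i=Suc k..N. T i)"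
      by (simp add: T'_def diff_divide_distrib)
    have "(cmod (T' k))\<^sup>2 \<le> 2 * (cmod (of_nat (N - k) / of_nat (Suc N) * T k))\<^sup>2
        + 2 * (cmod ((- 1 / of_nat (Suc N)) * (\<Sum>i=Suc k..N. T i)))\<^sup>2"
      unfolding split by (rule cmod_add_sq_le)
    also have "(cmod (of_nat (N - k) / of_nat (Suc N) * T k))\<^sup>2 \<le> (cmod (T k))\<^sup>2"
    proof -
      have "cmod (of_nat (N - k) / of_nat (Suc N) * T k) = (real (N - k) / real (Suc N)) * cmod (T k)"
        by (simp add: norm_mult norm_divide del: of_nat_Suc)
      also have "\<dots> \<le> 1 * cmod (T k)"
        by (intro mult_right_mono) (auto simp: divide_le_eq)
      finally show ?thesis by (intro power_mono) simp_all
    qed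
    also have "(cmod ((- 1 / of_nat (Suc N)) * (\<Sum>i=Suc k..N. T i)))\<^sup>2 \<le> 1 / real (Suc N) * Y"
    proof -
      have "(cmod (\<Sum>i=Suc k..N. T i))\<^sup>2 \<le> real (card {Suc k..N}) * Y"
        using cmod_sum_sq_le[of T "{Suc k..N}"] by (simp only: Y_def nT)
      also have "\<dots> \<le> real (Suc N) * Y"
        by (intro mult_right_mono) (auto simp: Y_def intro: sum_nonneg)
      finally have "(cmod (\<Sum>i=Suc k..N. T i))\<^sup>2 \<le> real (Suc N) * Y" .
      then have "(1 / real (Suc N))\<^sup>2 * (cmod (\<Sum>i=Suc k..N. T i))\<^sup>2 \<le> (1 / real (Suc N))\<^sup>2 * (real (Suc N) * Y)"
        by (intro mult_left_mono) auto
      also have "\<dots> = 1 / real (Suc N) * Y"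
        using N0 by (simp add: power2_eq_square del: of_nat_Suc)
      finally show ?thesis
        by (simp add: norm_mult norm_divide power_mult_distrib power_divide del: of_nat_Suc)
    qed
    finally have "w k * (cmod (T' k))\<^sup>2 \<le> w k * (2 * (cmod (T k))\<^sup>2 + 2 * (1 / real (Suc N) * Y))"
      using w by (intro mult_left_mono) auto
    also have "\<dots> = 2 * (w k * (cmod (T k))\<^sup>2) + 2 / real (Suc N) * (w k * Y)"
      by (simp add: algebra_simps)
    also have "w k * Y \<le> (\<Sum>i=Suc k..N. w i * (cmod (fps_nth \<psi> i))\<^sup>2)"
      unfolding Y_def sum_distrib_left
      by (intro sum_mono mult_right_mono) (auto intro: monoD[OF w(2)])
    finally have le: "w k * (cmod (T' k))\<^sup>2
      \<le> 2 * (w k * (cmod (T k))\<^sup>2) + 2 / real (Suc N) * (\<Sum>i=Suc k..N. w i * (cmod (fps_nth \<psi> i))\<^sup>2)"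
      using N0 by (simp add: divide_right_mono mult_left_mono del: of_nat_Suc)
    have "ennreal (\<Sum>i=Suc k..N. w i * (cmod (fps_nth \<psi> i))\<^sup>2) \<le> W"
    proof -
      have "ennreal (\<Sum>i=Suc k..N. w i * (cmod (fps_nth \<psi> i))\<^sup>2) = (\<Sum>i=Suc k..N. ennreal (w i * (cmod (fps_nth \<psi> i))\<^sup>2))"
        using w by (intro sum_ennreal[symmetric]) simp
      also have "\<dots> \<le> W" unfolding W_def wnorm_def by (rule sum_le_suminf) auto
      finally show ?thesis .
    qed
    then have "2 * ennreal (w k * (cmod (T k))\<^sup>2)
        + ennreal (2 / real (Suc N)) * ennreal (\<Sum>i=Suc k..N. w i * (cmod (fps_nth \<psi> i))\<^sup>2)
        \<le> 2 * ennreal (w k * (cmod (T k))\<^sup>2) + ennreal (2 / real (Suc N)) * W"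
      by (intro add_mono mult_left_mono) auto
    moreover have "ennreal (w k * (cmod (T' k))\<^sup>2) \<le> 2 * ennreal (w k * (cmod (T k))\<^sup>2)
        + ennreal (2 / real (Suc N)) * ennreal (\<Sum>i=Suc k..N. w i * (cmod (fps_nth \<psi> i))\<^sup>2)"
    proof -
      have "ennreal (2 * a + b * s) = 2 * ennreal a + ennreal b * ennreal s" if "a \<ge> 0" "b \<ge> 0" "s \<ge> 0" for a b s
        using that by (simp add: ennreal_plus ennreal_mult)
      from this[of "w k * (cmod (T k))\<^sup>2" "2 / real (Suc N)" "\<Sum>i=Suc k..N. w i * (cmod (fps_nth \<psi> i))\<^sup>2"]
      show ?thesis using ennreal_leI[OF le] w by (simp add: sum_nonneg del: of_nat_Suc)
    qed
    ultimately have "ennreal (w k * (cmod (T' k))\<^sup>2)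
        \<le> 2 * ennreal (w k * (cmod (T k))\<^sup>2) + ennreal (2 / real (Suc N)) * W"
      by (rule order.trans[rotated])
    then show ?thesis using True by (simp only: nT if_True)
  next
    case False
    then show ?thesis by (simp add: nT[symmetric] T'_def)
  qed
  then have "wnorm w \<psi>' \<le> (\<Sum>k. 2 * ennreal (w k * (cmod (fps_nth \<psi> k))\<^sup>2)
      + (if k < N then ennreal (2 / real (Suc N)) * W else 0))"
    unfolding wnorm_def by (intro suminf_le summableI)
  also have "\<dots> = 2 * W + (\<Sum>k. if k < N then ennreal (2 / real (Suc N)) * W else 0)"
    by (subst suminf_add[symmetric]) (simp_all add: W_def wnorm_def)
  also have "(\<Sum>k. if k < N then ennreal (2 / real (Suc N)) * W else 0)
      = (\<Sum>k<N. if k < N then ennreal (2 / real (Suc N)) * W else 0)"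
    by (rule suminf_finite) auto
  also have "\<dots> = ennreal (real N * (2 / real (Suc N))) * W"
    by (subst ennreal_mult) (simp_all add: ennreal_of_nat_eq_real_of_nat mult.assoc del: of_nat_Suc times_divide_eq_right)
  also have "\<dots> \<le> ennreal 2 * W"
    by (intro mult_right_mono ennreal_leI) (auto simp: divide_le_eq)
  also have "2 * W + ennreal 2 * W = 4 * W"
    by (simp flip: distrib_right)
  finally show "wnorm w \<psi>' \<le> 4 * wnorm w \<psi>" by (simp add: W_def add_left_mono)
qed

section \<open>From the seminorm of \<open>D_sigma\<close> to a full norm, and the local estimate
  for Fejer means\<close>

abbreviation sigw :: "nat \<Rightarrow> nat \<Rightarrow> real" where
  "sigw j k \<equiv> 1 + binw j k"

abbreviation h2norm :: "complex fps \<Rightarrow> ennreal" where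
  "h2norm \<equiv> wnorm (\<lambda>_. 1)"

lemma mono_sigw: "mono (sigw j)"
  by (intro monoI add_left_mono of_nat_mono binomial_right_mono)

lemma wnorm_sigw: "wnorm (sigw j) g = h2norm g + wnorm (binw j) g"
proof -
  have "wnorm (sigw j) g = (\<Sum>k. ennreal (1 * (cmod (fps_nth g k))\<^sup>2) + ennreal (binw j k * (cmod (fps_nth g k))\<^sup>2))"
    unfolding wnorm_def by (simp add: distrib_right ennreal_plus)
  also have "\<dots> = h2norm g + wnorm (binw j) g"
    unfolding wnorm_def by (rule suminf_add[symmetric]) (rule summableI)+
  finally show ?thesis .
qed

text \<open>From index \<open>j\<close> on, \<open>binw j k \<ge> 1\<close>, so only finitely many
  coefficients escape the seminorm. The weight \<open>sigw j\<close> is preferred because it is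
  positive everywhere, as \<open>multiplier_bounded\<close> demands, and monotone, as
  \<open>fejer_linear_factor\<close> demands.\<close>

lemma wnorm_sigw_fin:
  assumes "wnorm (binw j) g < \<infinity>"
  shows "wnorm (sigw j) g < \<infinity>"
proof -
  have "h2norm g \<le> (\<Sum>k. ennreal (1 * (cmod (fps_nth (fps_cutoff j g) k))\<^sup>2)
      + ennreal (binw j k * (cmod (fps_nth g k))\<^sup>2))"
    unfolding wnorm_def
  proof (intro suminf_le summableI)
    fix k
    have "1 \<le> binw j k" if "k \<ge> j"
    proof -
      have "0 < k choose j" using that by simp
      then show ?thesis by linarith
    qed
    then have "1 * (cmod (fps_nth g k))\<^sup>2 \<le> binw j k * (cmod (fps_nth g k))\<^sup>2" if "k \<ge> j"
      using that by (intro mult_right_mono) auto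
    then show "ennreal (1 * (cmod (fps_nth g k))\<^sup>2) \<le> ennreal (1 * (cmod (fps_nth (fps_cutoff j g) k))\<^sup>2) +
         ennreal (binw j k * (cmod (fps_nth g k))\<^sup>2)"
      by (cases "k < j") (simp_all add: ennreal_leI)
  qed
  also have "\<dots> = h2norm (fps_cutoff j g) + wnorm (binw j) g"
    unfolding wnorm_def by (rule suminf_add[symmetric]) (rule summableI)+
  also have "\<dots> < \<infinity>"
    using assms wnorm_finite_support_lt[of j "fps_cutoff j g" "\<lambda>_. 1"] by (simp add: less_top)
  finally show ?thesis using assms unfolding wnorm_sigw by (simp add: less_top)
qed

text \<open>With \<open>j = Suc i\<close>, Pascal's rule adds \<open>k choose i\<close>. For
  \<open>k > i\<close> this is at most
  \<open>(k - i) * (k choose i) = Suc i * (k choose Suc i)\<close>. At \<open>k = i\<close> that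
  product is 0 while the coefficient is 1, and the summand 1 of \<open>sigw\<close> absorbs
  it.\<close>

lemma sigw_Suc_le: "sigw j (Suc k) \<le> real (Suc j) * sigw j k"
proof (cases j)
  case (Suc i)
  have "k choose i \<le> Suc i * (k choose Suc i) + 1"
  proof (cases "k \<le> i")
    case True
    then show ?thesis by (cases "k = i") (auto simp: binomial_eq_0)
  next
    case False
    have "k choose i \<le> (k - i) * (k choose i)" using False by simp
    also have "\<dots> = Suc i * (k choose Suc i)"
      by (simp only: binomial_absorb_comp binomial_absorption)
    finally show ?thesis by simp
  qed
  then have "Suc k choose j \<le> Suc j * (k choose j) + 1"
    by (simp add: Suc)
  then have "binw j (Suc k) \<le> real (Suc j * (k choose j) + 1)" by (rule of_nat_mono)
  then have "binw j (Suc k) \<le> real (Suc j) * binw j k + 1" by (simp only: of_nat_add of_nat_mult of_nat_1)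
  then show ?thesis unfolding Suc by (simp add: algebra_simps)
qed simp

lemma wnorm_X_mult_le: "wnorm (sigw j) (fps_X * g) \<le> of_nat (Suc j) * wnorm (sigw j) g"
proof -
  have "wnorm (sigw j) (fps_X * g) = (\<Sum>k. ennreal (sigw j (Suc k) * (cmod (fps_nth g k))\<^sup>2))"
    unfolding wnorm_def by (subst suminf_offset[of _ 1]) auto
  also have "\<dots> \<le> (\<Sum>k. of_nat (Suc j) * ennreal (sigw j k * (cmod (fps_nth g k))\<^sup>2))"
  proof (intro suminf_le summableI)
    fix k
    have "sigw j (Suc k) * (cmod (fps_nth g k))\<^sup>2 \<le> real (Suc j) * sigw j k * (cmod (fps_nth g k))\<^sup>2"
      by (intro mult_right_mono sigw_Suc_le) simp
    then have "ennreal (sigw j (Suc k) * (cmod (fps_nth g k))\<^sup>2)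
        \<le> ennreal (real (Suc j) * (sigw j k * (cmod (fps_nth g k))\<^sup>2))"
      by (intro ennreal_leI) (simp only: mult.assoc)
    then show "ennreal (sigw j (Suc k) * (cmod (fps_nth g k))\<^sup>2)
        \<le> of_nat (Suc j) * ennreal (sigw j k * (cmod (fps_nth g k))\<^sup>2)"
      by (simp add: ennreal_mult ennreal_of_nat_eq_real_of_nat del: of_nat_Suc)
  qed
  finally show ?thesis by (simp add: wnorm_def del: of_nat_Suc)
qed

lemma wnorm_linear_factor_lt:
  assumes "wnorm (sigw j) g < \<infinity>"
  shows "wnorm (sigw j) (fps_const a + (fps_X - fps_const l) * g) < \<infinity>"
proof -
  have "wnorm (sigw j) (fps_const a + (fps_X * g - fps_const l * g))
     \<le> 2 * wnorm (sigw j) (fps_const a) + 2 * (2 * wnorm (sigw j) (fps_X * g) + 2 * wnorm (sigw j) (fps_const l * g))"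
    by (rule order.trans[OF wnorm_add_le add_left_mono[OF mult_left_mono[OF wnorm_diff_le]]]) auto
  also have "\<dots> \<le> 2 * wnorm (sigw j) (fps_const a) + 2 * (2 * (of_nat (Suc j) * wnorm (sigw j) g)
      + 2 * (ennreal ((cmod l)\<^sup>2) * wnorm (sigw j) g))"
    unfolding wnorm_const_mult by (intro add_mono mult_left_mono order.refl wnorm_X_mult_le) simp_all
  also have "\<dots> < \<infinity>"
    using assms wnorm_finite_support_lt[of 1 "fps_const a" "sigw j"]
    by (auto simp: ennreal_mult_less_top of_nat_less_top simp del: of_nat_Suc)
  finally show ?thesis by (simp add: left_diff_distrib)
qed

lemma h2norm_nth_le: "ennreal ((cmod (fps_nth f k))\<^sup>2) \<le> h2norm f"
proof -
  have "(\<Sum>k\<in>{k}. ennreal (1 * (cmod (fps_nth f k))\<^sup>2)) \<le> h2norm f"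
    unfolding wnorm_def by (rule sum_le_suminf) auto
  then show ?thesis by simp
qed

text \<open>The seminorm \<open>wnorm (binw j)\<close> ignores the coefficients of index below \<open>j\<close>; they are recovered from
  the coefficient of index \<open>j\<close> by the recursion \<open>g (k - 1) = f k + l * g k\<close>.\<close>

lemma wnorm_sigw_linear_factor_le:
  assumes l: "cmod l = 1" and f: "f = fps_const a + (fps_X - fps_const l) * g"
  shows "wnorm (sigw j) g \<le> (of_nat j * 4 ^ j + 2) * (wnorm (binw j) g + h2norm f)"
proof -
  define D N where "D = wnorm (binw j) g" and "N = h2norm f"
  have low: "ennreal ((cmod (fps_nth g (j - i)))\<^sup>2) \<le> 4 ^ i * (D + N)" if "i \<le> j" for i
    using that
  proof (induction i)
    case 0
    have "(\<Sum>k\<in>{j}. ennreal (binw j k * (cmod (fps_nth g k))\<^sup>2)) \<le> D"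
      unfolding D_def wnorm_def by (rule sum_le_suminf) auto
    then show ?case by (simp add: add_increasing2)
  next
    case (Suc i)
    define k where "k = j - Suc i"
    have k: "Suc k = j - i" using Suc.prems by (simp add: k_def)
    have "fps_nth g k = fps_nth f (Suc k) + l * fps_nth g (Suc k)"
      unfolding f fps_const_add_X_minus_nth by simp
    then have "(cmod (fps_nth g k))\<^sup>2 \<le> 2 * (cmod (fps_nth f (Suc k)))\<^sup>2 + 2 * (cmod (fps_nth g (Suc k)))\<^sup>2"
      using cmod_add_sq_le[of "fps_nth f (Suc k)" "l * fps_nth g (Suc k)"] l by (simp add: norm_mult)
    then have "ennreal ((cmod (fps_nth g k))\<^sup>2)
        \<le> 2 * ennreal ((cmod (fps_nth f (Suc k)))\<^sup>2) + 2 * ennreal ((cmod (fps_nth g (Suc k)))\<^sup>2)"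
      by (subst (asm) ennreal_le_iff[symmetric]) (simp_all add: ennreal_plus ennreal_mult)
    also have "\<dots> \<le> 2 * N + 2 * (4 ^ i * (D + N))"
      using Suc unfolding k N_def by (intro add_mono mult_left_mono h2norm_nth_le) auto
    also have "\<dots> \<le> 2 * (4 ^ i * (D + N)) + 2 * (4 ^ i * (D + N))"
    proof (intro add_right_mono mult_left_mono)
      have "1 * N \<le> 4 ^ i * (D + N)" by (intro mult_mono one_le_power) auto
      then show "N \<le> 4 ^ i * (D + N)" by simp
    qed simp
    also have "\<dots> = 4 ^ Suc i * (D + N)"
      by (simp add: mult.assoc flip: distrib_right)
    finally show ?case by (simp add: k_def)
  qed
  have "h2norm g \<le> (\<Sum>k. (if k < j then 4 ^ j * (D + N) else 0) + ennreal (binw j k * (cmod (fps_nth g k))\<^sup>2))"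
    unfolding wnorm_def
  proof (intro suminf_le summableI)
    fix k
    show "ennreal (1 * (cmod (fps_nth g k))\<^sup>2)
      \<le> (if k < j then 4 ^ j * (D + N) else 0) + ennreal (binw j k * (cmod (fps_nth g k))\<^sup>2)"
    proof (cases "k < j")
      case True
      then have "ennreal ((cmod (fps_nth g k))\<^sup>2) \<le> 4 ^ (j - k) * (D + N)" using low[of "j - k"] by simp
      also have "\<dots> \<le> 4 ^ j * (D + N)" by (intro mult_right_mono power_increasing) auto
      finally show ?thesis using True by (simp add: add_increasing2)
    next
      case False
      then have "0 < k choose j" by simp
      then have "1 \<le> binw j k" by linarith
      then have "1 * (cmod (fps_nth g k))\<^sup>2 \<le> binw j k * (cmod (fps_nth g k))\<^sup>2"
        by (intro mult_right_mono) auto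
      then show ?thesis using False by (simp add: ennreal_leI)
    qed
  qed
  also have "\<dots> = (\<Sum>k. if k < j then 4 ^ j * (D + N) else 0) + D"
    unfolding D_def wnorm_def by (rule suminf_add[symmetric]) (rule summableI)+
  also have "(\<Sum>k. if k < j then 4 ^ j * (D + N) else 0) = (\<Sum>k<j. if k < j then 4 ^ j * (D + N) else 0)"
    by (rule suminf_finite) auto
  also have "\<dots> = of_nat j * (4 ^ j * (D + N))" by simp
  finally have "wnorm (sigw j) g \<le> of_nat j * (4 ^ j * (D + N)) + D + D"
    unfolding wnorm_sigw by (simp add: D_def add_right_mono)
  also have "\<dots> \<le> of_nat j * (4 ^ j * (D + N)) + (D + N) + (D + N)"
    by (intro add_mono order.refl) simp_all
  also have "\<dots> = (of_nat j * 4 ^ j + 2) * (D + N)"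
    by (simp add: distrib_right mult.assoc add.assoc flip: mult_2)
  finally show ?thesis by (simp add: D_def N_def)
qed

text \<open>The point is uniformity: the constant depends on \<open>j\<close> only, not on
  \<open>l\<close> or \<open>f\<close>, so that estimates based on it can be integrated over the
  circle.\<close>

lemma loc_D_obtain:
  assumes l: "cmod l = 1" and fin: "loc_D (Suc j) l f < \<infinity>"
  obtains a g where "f = fps_const a + (fps_X - fps_const l) * g"
    and "wnorm (sigw j) g \<le> (of_nat j * 4 ^ j + 2) * (loc_D (Suc j) l f + h2norm f)"
proof -
  obtain a g where g: "f = fps_const a + (fps_X - fps_const l) * g" "wnorm (binw j) g \<le> loc_D (Suc j) l f"
    by (rule wnorm_le_loc_D[OF assms])
  have "wnorm (sigw j) g \<le> (of_nat j * 4 ^ j + 2) * (wnorm (binw j) g + h2norm f)"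
    by (rule wnorm_sigw_linear_factor_le[OF l g(1)])
  also have "\<dots> \<le> (of_nat j * 4 ^ j + 2) * (loc_D (Suc j) l f + h2norm f)"
    by (intro mult_left_mono add_right_mono g) simp
  finally show ?thesis using g(1) that by blast
qed

text \<open>A single boundary point with finite local integral places \<open>f\<close> in the
  \<open>\<sigma>\<close> space: the quotient \<open>g\<close> lies there, and multiplication by
  \<open>z - l\<close> preserves it.\<close>

lemma loc_D_imp_wnorm_lt:
  assumes "cmod l = 1" "loc_D (Suc j) l f < \<infinity>"
  shows "wnorm (sigw j) f < \<infinity>"
proof -
  obtain a g where g: "f = fps_const a + (fps_X - fps_const l) * g" "wnorm (binw j) g \<le> loc_D (Suc j) l f"
    by (rule wnorm_le_loc_D[OF assms])
  then have "wnorm (sigw j) g < \<infinity>"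
    by (intro wnorm_sigw_fin le_less_trans[OF g(2) assms(2)])
  then show ?thesis unfolding g(1) by (rule wnorm_linear_factor_lt)
qed

text \<open>Writing \<open>f = a + (z - l) g\<close> and \<open>\<phi> f = b + (z - l) q\<close> gives \<open>a \<phi> = b + (z - l) (q - \<phi> g)\<close>, a
  form that Fejer means preserve.\<close>

lemma loc_D_fejer_mult_le:
  assumes l: "cmod l = 1" and B: "B \<ge> 0" "\<And>g. wnorm (sigw j) (\<phi> * g) \<le> B * wnorm (sigw j) g"
  shows "loc_D (Suc j) l (fejer N \<phi> * f) \<le> (18 * B + 16) * (of_nat j * 4 ^ j + 2) *
    (loc_D (Suc j) l (\<phi> * f) + h2norm (\<phi> * f) + (loc_D (Suc j) l f + h2norm f))"
    (is "_ \<le> ?C * ?K * (?R1 + ?R2)")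
proof (cases "loc_D (Suc j) l (\<phi> * f) < \<infinity> \<and> loc_D (Suc j) l f < \<infinity>")
  case False
  then have "?R1 + ?R2 = \<infinity>" by (auto simp: less_top[symmetric])
  moreover have "?C * ?K \<noteq> 0" by simp
  ultimately have "?C * ?K * (?R1 + ?R2) = \<infinity>"
    by (simp only: infinity_ennreal_def ennreal_mult_eq_top_iff) simp
  then show ?thesis by (simp only: infinity_ennreal_def top_greatest)
next
  case True
  have w0: "sigw j k \<ge> 0" for k by simp
  obtain a g where g: "f = fps_const a + (fps_X - fps_const l) * g" "wnorm (sigw j) g \<le> ?K * ?R2"
    by (rule loc_D_obtain[OF l conjunct2[OF True]])
  obtain b q where q: "\<phi> * f = fps_const b + (fps_X - fps_const l) * q" "wnorm (sigw j) q \<le> ?K * ?R1"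
    by (rule loc_D_obtain[OF l conjunct1[OF True]])
  define \<psi> where "\<psi> = q - \<phi> * g"
  have "fps_const a * \<phi> = \<phi> * f - (fps_X - fps_const l) * (\<phi> * g)"
    by (subst g(1)) (simp add: algebra_simps)
  also have "\<dots> = fps_const b + (fps_X - fps_const l) * \<psi>"
    unfolding q(1) \<psi>_def by (simp add: algebra_simps)
  \<comment> \<open>There is no division by \<open>a\<close>, which may vanish; only the product
    \<open>fps_const a * fejer N \<phi>\<close> enters below.\<close>
  finally have fac: "fps_const a * \<phi> = fps_const b + (fps_X - fps_const l) * \<psi>" .
  obtain b' \<psi>' where \<psi>': "fejer N (fps_const a * \<phi>) = fps_const b' + (fps_X - fps_const l) * \<psi>'"
    "wnorm (sigw j) \<psi>' \<le> 4 * wnorm (sigw j) \<psi>"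
    by (rule fejer_linear_factor[OF l fac w0 mono_sigw])
  have "fejer N \<phi> * f = fps_const b' + (fps_X - fps_const l) * (\<psi>' + fejer N \<phi> * g)"
    using \<psi>'(1) unfolding fejer_const_mult by (subst g(1)) (simp add: algebra_simps)
  then have "loc_D (Suc j) l (fejer N \<phi> * f) \<le> wnorm (binw j) (\<psi>' + fejer N \<phi> * g)"
    by (rule loc_D_le_wnorm[OF l])
  also have "\<dots> \<le> wnorm (sigw j) (\<psi>' + fejer N \<phi> * g)"
    by (simp add: wnorm_sigw)
  also have "\<dots> \<le> 2 * wnorm (sigw j) \<psi>' + 2 * wnorm (sigw j) (fejer N \<phi> * g)"
    by (rule wnorm_add_le) simp
  \<comment> \<open>The cost of \<open>q\<close> is \<open>2 * 4 * 2 = 16\<close>; \<open>g\<close>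
    costs \<open>16 * B\<close> through \<open>\<psi>\<close> and \<open>2 * B\<close> directly. The
    factor \<open>18 * B + 16\<close> dominates both.\<close>
  also have "\<dots> \<le> 2 * (4 * (2 * wnorm (sigw j) q + 2 * (B * wnorm (sigw j) g))) + 2 * (B * wnorm (sigw j) g)"
  proof (intro add_mono mult_left_mono)
    have "wnorm (sigw j) \<psi> \<le> 2 * wnorm (sigw j) q + 2 * wnorm (sigw j) (\<phi> * g)"
      unfolding \<psi>_def by (rule wnorm_diff_le) simp
    also have "\<dots> \<le> 2 * wnorm (sigw j) q + 2 * (B * wnorm (sigw j) g)"
      by (intro add_left_mono mult_left_mono B) simp
    finally show "wnorm (sigw j) \<psi>' \<le> 4 * (2 * wnorm (sigw j) q + 2 * (B * wnorm (sigw j) g))"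
      by (intro order.trans[OF \<psi>'(2)] mult_left_mono) simp_all
    show "wnorm (sigw j) (fejer N \<phi> * g) \<le> B * wnorm (sigw j) g"
      by (rule wnorm_fejer_mult_le[OF w0 B(2)])
  qed simp_all
  also have "\<dots> = 16 * wnorm (sigw j) q + 18 * B * wnorm (sigw j) g"
    by (simp add: distrib_left mult.assoc[symmetric] add.assoc flip: distrib_right)
  also have "\<dots> \<le> ?C * (?K * ?R1) + ?C * (?K * ?R2)"
    using B(1) by (intro add_mono mult_mono q g) (auto simp: add_increasing add_increasing2)
  also have "\<dots> = ?C * ?K * (?R1 + ?R2)"
  proof -
    have "c * (k * r) + c * (k * s) = c * k * (r + s)" for c k r s :: ennreal
      by (simp only: distrib_left mult.assoc)
    then show ?thesis .
  qed
  finally show ?thesis .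
qed

section \<open>Area integrals over the disc\<close>

lemma nn_integral_lborel_plus:
  fixes f :: "'a::euclidean_space \<Rightarrow> ennreal"
  assumes [measurable]: "f \<in> borel_measurable borel"
  shows "(\<integral>\<^sup>+ x. f (c + x) \<partial>lborel) = (\<integral>\<^sup>+ x. f x \<partial>lborel)"
proof -
  have "(\<integral>\<^sup>+ x. f x \<partial>lborel) = (\<integral>\<^sup>+ x. f x \<partial>distr lborel borel ((+) c))"
    by (simp add: lborel_distr_plus)
  then show ?thesis by (simp add: nn_integral_distr)
qed

lemma nn_integral_lborel_uminus:
  fixes f :: "'a::euclidean_space \<Rightarrow> ennreal"
  assumes [measurable]: "f \<in> borel_measurable borel"
  shows "(\<integral>\<^sup>+ x. f (- x) \<partial>lborel) = (\<integral>\<^sup>+ x. f x \<partial>lborel)"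
proof -
  have "distr lborel borel uminus = (lborel :: 'a measure)"
    by (subst (2) lborel_affine[of "- 1" 0]) (simp_all add: density_1)
  then have "(\<integral>\<^sup>+ x. f x \<partial>lborel) = (\<integral>\<^sup>+ x. f x \<partial>distr lborel borel uminus)"
    by simp
  then show ?thesis by (simp add: nn_integral_distr)
qed

text \<open>Uniqueness of translation invariant measures, in the form of a Fubini argument against the
  indicator of the unit disc.\<close>

lemma nn_integral_lborel_rotate:
  fixes f :: "complex \<Rightarrow> ennreal"
  assumes [measurable]: "f \<in> borel_measurable borel" and u: "cmod u = 1"
  shows "(\<integral>\<^sup>+ z. f (u * z) \<partial>lborel) = (\<integral>\<^sup>+ z. f z \<partial>lborel)"
proof -
  define g :: "complex \<Rightarrow> ennreal" where "g = indicator (ball 0 1)"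
  have [measurable]: "g \<in> borel_measurable borel"
    unfolding g_def by (intro borel_measurable_indicator) simp
  define v where "v = (\<integral>\<^sup>+ z. g z \<partial>lborel)"
  have v: "v \<noteq> 0" "v \<noteq> \<infinity>"
  proof -
    have "v = emeasure lborel (ball (0::complex) 1)" by (simp add: v_def g_def)
    then show "v \<noteq> 0" "v \<noteq> \<infinity>"
      using emeasure_lborel_ball_finite[of "0::complex" 1] by (auto simp: emeasure_ball unit_ball_vol_2)
  qed
  have pair: "pair_sigma_finite (lborel :: complex measure) (lborel :: complex measure)"
    by (intro pair_sigma_finite.intro sigma_finite_lborel)
  have u0: "u \<noteq> 0" using u by auto
  have gu: "g (u * z) = g z" for z using u by (simp add: g_def indicator_def norm_mult)
  have "(\<integral>\<^sup>+ x. f (u * x) \<partial>lborel) * v = (\<integral>\<^sup>+ x. f (u * x) * v \<partial>lborel)"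
    by (subst nn_integral_multc) simp_all
  also have "\<dots> = (\<integral>\<^sup>+ x. \<integral>\<^sup>+ y. f (u * x) * g (u * x + y) \<partial>lborel \<partial>lborel)"
    unfolding v_def by (subst nn_integral_cmult) (simp_all add: nn_integral_lborel_plus)
  also have "\<dots> = (\<integral>\<^sup>+ y. \<integral>\<^sup>+ x. f (u * x) * g (u * x + y) \<partial>lborel \<partial>lborel)"
    by (rule pair_sigma_finite.Fubini'[OF pair]) simp
  \<comment> \<open>Translating \<open>x\<close> by \<open>- (y / u)\<close> moves the shift from
    \<open>g\<close> to \<open>f\<close>, and the disc is rotation invariant, so
    \<open>g (u * x) = g x\<close>. Integrating in \<open>y\<close> first then removes the rotation
    from \<open>f\<close>.\<close>
  also have "\<dots> = (\<integral>\<^sup>+ y. \<integral>\<^sup>+ x. f (u * x - y) * g x \<partial>lborel \<partial>lborel)"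
  proof (rule nn_integral_cong)
    fix y
    have "(\<integral>\<^sup>+ x. f (u * x) * g (u * x + y) \<partial>lborel)
        = (\<integral>\<^sup>+ x. f (u * (- (y / u) + x)) * g (u * (- (y / u) + x) + y) \<partial>lborel)"
      by (rule nn_integral_lborel_plus[symmetric]) simp
    also have "\<dots> = (\<integral>\<^sup>+ x. f (u * x - y) * g (u * x) \<partial>lborel)"
      using u0 by (simp add: right_diff_distrib)
    finally show "(\<integral>\<^sup>+ x. f (u * x) * g (u * x + y) \<partial>lborel) = (\<integral>\<^sup>+ x. f (u * x - y) * g x \<partial>lborel)"
      by (simp only: gu)
  qed
  also have "\<dots> = (\<integral>\<^sup>+ x. \<integral>\<^sup>+ y. f (u * x - y) * g x \<partial>lborel \<partial>lborel)"
    by (rule pair_sigma_finite.Fubini'[OF pair]) simp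
  also have "\<dots> = (\<integral>\<^sup>+ x. (\<integral>\<^sup>+ y. f y \<partial>lborel) * g x \<partial>lborel)"
  proof (rule nn_integral_cong)
    fix x
    have "(\<integral>\<^sup>+ y. f (u * x - y) * g x \<partial>lborel) = (\<integral>\<^sup>+ y. f (u * x + - y) \<partial>lborel) * g x"
      by (subst nn_integral_multc) simp_all
    also have "(\<integral>\<^sup>+ y. f (u * x + - y) \<partial>lborel) = (\<integral>\<^sup>+ y. f (u * x + y) \<partial>lborel)"
      by (rule nn_integral_lborel_uminus[of "\<lambda>y. f (u * x + y)"]) simp
    also have "\<dots> = (\<integral>\<^sup>+ y. f y \<partial>lborel)"
      by (rule nn_integral_lborel_plus) simp
    finally show "(\<integral>\<^sup>+ y. f (u * x - y) * g x \<partial>lborel) = (\<integral>\<^sup>+ y. f y \<partial>lborel) * g x" .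
  qed
  also have "\<dots> = (\<integral>\<^sup>+ y. f y \<partial>lborel) * v"
    unfolding v_def by (subst nn_integral_cmult) simp_all
  finally show ?thesis using v
    by (simp add: mult.commute[of _ v] ennreal_mult_cancel_left)
qed

text \<open>Induction on \<open>p\<close> for all \<open>k\<close> at once, splitting one factor
  \<open>1 - t\<close> off \<open>(1 - t) ^ Suc p\<close>.\<close>

lemma has_integral_power_beta:
  "((\<lambda>t::real. t ^ k * (1 - t) ^ p) has_integral fact k * fact p / fact (k + p + 1)) {0..1}"
proof (induction p arbitrary: k)
  case 0
  have "((\<lambda>t::real. t ^ k) has_integral (1 ^ Suc k / real (Suc k) - 0 ^ Suc k / real (Suc k))) {0..1}"
  proof (rule fundamental_theorem_of_calculus)
    fix x :: real
    have "((\<lambda>t. t ^ Suc k / real (Suc k)) has_real_derivative real (Suc k) * (1 * x ^ (Suc k - Suc 0)) / real (Suc k))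
        (at x within {0..1})"
      by (intro DERIV_cdivide DERIV_power DERIV_ident)
    then show "((\<lambda>t. t ^ Suc k / real (Suc k)) has_vector_derivative x ^ k) (at x within {0..1})"
      by (simp add: has_real_derivative_iff_has_vector_derivative[symmetric] del: of_nat_Suc power_Suc)
  qed simp
  then show ?case by simp
next
  case (Suc p)
  have "((\<lambda>t::real. t ^ k * (1 - t) ^ p - t ^ Suc k * (1 - t) ^ p) has_integral
      fact k * fact p / fact (k + p + 1) - fact (Suc k) * fact p / fact (Suc k + p + 1)) {0..1}"
    by (intro has_integral_diff Suc.IH)
  also have "(\<lambda>t::real. t ^ k * (1 - t) ^ p - t ^ Suc k * (1 - t) ^ p) = (\<lambda>t. t ^ k * (1 - t) ^ Suc p)"
    by (simp add: fun_eq_iff algebra_simps)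
  also have "fact k * fact p / fact (k + p + 1) - fact (Suc k) * fact p / fact (Suc k + p + 1)
      = (fact k * fact (Suc p) / fact (k + Suc p + 1) :: real)"
  proof -
    define Q where "Q = (fact (k + p + 1) :: real)"
    have "fact (Suc k + p + 1) = (real k + real p + 2) * Q" "fact (k + Suc p + 1) = (real k + real p + 2) * Q"
      by (simp_all add: Q_def algebra_simps)
    moreover have "Q > 0" "real k + real p + 2 \<noteq> 0" by (simp_all add: Q_def)
    ultimately show ?thesis unfolding Q_def[symmetric]
      by (simp add: divide_simps) (simp add: algebra_simps)
  qed
  finally show ?case .
qed

text \<open>The part of the disc with squared modulus above \<open>x\<close> has area
  \<open>pi * (1 - x)\<close> for \<open>x\<close> in the unit interval, so the squared modulus is
  uniformly distributed. This does the work of polar coordinates for radial integrands.\<close>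

lemma distr_norm_square_disc:
  "distr (density lborel (indicator (ball 0 1))) borel (\<lambda>z::complex. (cmod z)\<^sup>2)
    = density lborel (\<lambda>t. ennreal pi * indicator {0..1} t)" (is "?M = ?N")
proof (rule measure_eqI_lessThan)
  have area: "emeasure lborel (cball (0::complex) r) = ennreal (pi * r\<^sup>2)" if "r \<ge> 0" for r
    using that by (subst emeasure_cball) (simp_all add: unit_ball_vol_2)
  have area': "emeasure lborel (ball (0::complex) 1) = ennreal pi"
    by (subst emeasure_ball) (simp_all add: unit_ball_vol_2)
  have M: "emeasure ?M {x<..} = emeasure lborel ({z::complex. (cmod z)\<^sup>2 > x} \<inter> ball 0 1)" for x
  proof -
    have [measurable]: "{z::complex. (cmod z)\<^sup>2 > x} \<in> sets borel" by measurable
    have [measurable]: "indicator (ball 0 1) \<in> borel_measurable (borel :: complex measure)"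
      by (intro borel_measurable_indicator) simp
    have "emeasure ?M {x<..} = (\<integral>\<^sup>+ z. indicator (ball 0 1) z * indicator {z::complex. (cmod z)\<^sup>2 > x} z \<partial>lborel)"
      by (subst emeasure_distr) (simp_all add: emeasure_density vimage_def)
    also have "\<dots> = (\<integral>\<^sup>+ z. indicator ({z::complex. (cmod z)\<^sup>2 > x} \<inter> ball 0 1) z \<partial>lborel)"
      by (intro nn_integral_cong) (simp split: split_indicator)
    finally show ?thesis by simp
  qed
  have N: "emeasure ?N {x<..} = ennreal pi * emeasure lborel ({x<..} \<inter> {0..1})" for x
  proof -
    have "emeasure ?N {x<..} = (\<integral>\<^sup>+ t. ennreal pi * indicator ({x<..} \<inter> {0..1}) t \<partial>lborel)"
      by (subst emeasure_density) (auto intro!: nn_integral_cong simp: mult.assoc split: split_indicator)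
    then show ?thesis by (simp add: nn_integral_cmult)
  qed
  show "emeasure ?M {x<..} < \<infinity>" for x
  proof -
    have "emeasure ?M {x<..} \<le> emeasure lborel (ball (0::complex) 1)"
      unfolding M by (rule emeasure_mono) auto
    then show ?thesis using area' by (simp add: le_less_trans)
  qed
  show "emeasure ?M {x<..} = emeasure ?N {x<..}" for x
  proof -
    consider "x < 0" | "0 \<le> x" "x < 1" | "1 \<le> x" by linarith
    then show ?thesis
    proof cases
      case 1
      then have "x < (cmod z)\<^sup>2" for z by (rule less_le_trans) simp
      then have "{z::complex. (cmod z)\<^sup>2 > x} \<inter> ball 0 1 = ball 0 1" by simp
      moreover have "{x<..} \<inter> {0..1} = {0..1}" using 1 by auto
      ultimately show ?thesis unfolding M N using area' by simp
    next
      case 2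
      have iff: "(cmod z)\<^sup>2 > x \<longleftrightarrow> \<not> cmod z \<le> sqrt x" for z
      proof -
        have "cmod z \<le> sqrt x \<longleftrightarrow> sqrt ((cmod z)\<^sup>2) \<le> sqrt x" by simp
        also have "\<dots> \<longleftrightarrow> (cmod z)\<^sup>2 \<le> x" by (rule real_sqrt_le_iff)
        finally show ?thesis by auto
      qed
      have "{z::complex. (cmod z)\<^sup>2 > x} \<inter> ball 0 1 = ball 0 1 - cball 0 (sqrt x)"
        by (auto simp: iff)
      moreover have "cball (0::complex) (sqrt x) \<subseteq> ball 0 1"
      proof
        fix z :: complex assume "z \<in> cball 0 (sqrt x)"
        then have "cmod z \<le> sqrt x" by simp
        also have "\<dots> < 1" using 2 by simp
        finally show "z \<in> ball 0 1" by simp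
      qed
      ultimately have "emeasure lborel ({z::complex. (cmod z)\<^sup>2 > x} \<inter> ball 0 1)
          = ennreal pi - ennreal (pi * (sqrt x)\<^sup>2)"
        using 2 by (simp add: emeasure_Diff area area')
      also have "\<dots> = ennreal (pi - pi * x)"
        using 2 by (subst ennreal_minus) auto
      also have "\<dots> = ennreal pi * emeasure lborel ({x<..} \<inter> {0..1})"
      proof -
        have "{x<..} \<inter> {0..1} = {x<..1}" using 2 by auto
        then show ?thesis using 2 by (simp add: ennreal_mult[symmetric] algebra_simps)
      qed
      finally show ?thesis unfolding M N .
    next
      case 3
      have "\<not> (cmod z)\<^sup>2 > x" if "cmod z < 1" for z
        using that 3 power_mono[of "cmod z" 1 2] by simp
      then have "{z::complex. (cmod z)\<^sup>2 > x} \<inter> ball 0 1 = {}" by auto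
      moreover have "{x<..} \<inter> {0..1} = {}" using 3 by auto
      ultimately show ?thesis unfolding M N by simp
    qed
  qed
qed simp_all

lemma nn_integral_disc_moment:
  "(\<integral>\<^sup>+ z\<in>ball 0 1. ennreal ((cmod z) ^ (2 * k) * (1 - (cmod z)\<^sup>2) ^ p) \<partial>lborel)
    = ennreal (pi * (fact k * fact p / fact (k + p + 1)))"
proof -
  define f where "f = (\<lambda>t::real. t ^ k * (1 - t) ^ p)"
  have [measurable]: "f \<in> borel_measurable borel" by (simp add: f_def)
  have [measurable]: "indicator (ball 0 1) \<in> borel_measurable (borel :: complex measure)"
    by (intro borel_measurable_indicator) simp
  have "(\<integral>\<^sup>+ z\<in>ball 0 1. ennreal ((cmod z) ^ (2 * k) * (1 - (cmod z)\<^sup>2) ^ p) \<partial>lborel)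
     = (\<integral>\<^sup>+ z. ennreal (f ((cmod z)\<^sup>2)) \<partial>density lborel (indicator (ball 0 1)))"
    by (subst nn_integral_density) (simp_all add: f_def power_mult mult.commute[of "indicator _ _"] del: power_even_eq)
  also have "\<dots> = (\<integral>\<^sup>+ t. ennreal (f t) \<partial>density lborel (\<lambda>t. ennreal pi * indicator {0..1} t))"
    unfolding distr_norm_square_disc[symmetric] by (subst nn_integral_distr) simp_all
  also have "\<dots> = (\<integral>\<^sup>+ t. ennreal pi * (ennreal (f t) * indicator {0..1} t) \<partial>lborel)"
    by (subst nn_integral_density) (simp_all add: mult_ac)
  also have "\<dots> = ennreal pi * (\<integral>\<^sup>+ t. ennreal (f t) * indicator {0..1} t \<partial>lborel)"
    by (rule nn_integral_cmult) simp
  also have "(\<integral>\<^sup>+ t. ennreal (f t) * indicator {0..1} t \<partial>lborel) = ennreal (fact k * fact p / fact (k + p + 1))"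
    using has_integral_power_beta[of k p] unfolding f_def
    by (intro nn_integral_has_integral_lebesgue') auto
  finally show ?thesis by (subst ennreal_mult) simp_all
qed

text \<open>Exponents below \<open>K\<close> give orthogonal characters on the \<open>K\<close>-th
  roots of unity, so this finite average replaces integration over the angle for polynomials of
  degree below \<open>K\<close>.\<close>

lemma parseval_roots_of_unity:
  fixes a :: "nat \<Rightarrow> complex" and K :: nat
  defines "u \<equiv> \<lambda>j. cis (2 * pi * real j / real K)"
  shows "(\<Sum>j<K. (cmod (\<Sum>k<K. a k * (u j * z) ^ k))\<^sup>2) = real K * (\<Sum>k<K. (cmod (a k))\<^sup>2 * cmod z ^ (2 * k))"
proof -
  have uK: "u j ^ K = 1" if "K > 0" for j
  proof -
    have "u j ^ K = cis (2 * pi * real j)" unfolding u_def Complex.DeMoivre using that by simp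
    also have "\<dots> = 1" by (rule cis_multiple_2pi) simp
    finally show ?thesis .
  qed
  \<comment> \<open>Exchanging base and exponent turns the sum over \<open>j\<close> into a
    geometric sum with ratio \<open>u k / u l\<close>.\<close>
  have up: "u j ^ k = u k ^ j" for j k
    by (simp add: u_def Complex.DeMoivre mult_ac)
  have uc: "cnj (u j) = inverse (u j)" "u j \<noteq> 0" for j
    by (simp_all add: u_def cis_cnj)
  have orth: "(\<Sum>j<K. u j ^ k * cnj (u j ^ l)) = (if k = l then of_nat K else 0)" if "k < K" "l < K" for k l
  proof -
    define c where "c = u k / u l"
    have e: "u j ^ k * cnj (u j ^ l) = c ^ j" for j
    proof -
      have "u j ^ k * cnj (u j ^ l) = u k ^ j * inverse (u l ^ j)"
        by (simp only: up[of j k] up[of j l] complex_cnj_power uc(1) power_inverse)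
      then show ?thesis by (simp only: c_def divide_inverse power_mult_distrib power_inverse)
    qed
    show ?thesis
    proof (cases "k = l")
      case True
      then show ?thesis unfolding e using uc(2) by (simp add: c_def)
    next
      case False
      have "inj_on u {..<K}"
        using Complex.bij_betw_roots_unity[of K] that unfolding u_def by (auto simp: bij_betw_def)
      then have "u k \<noteq> u l" using that False by (auto simp: inj_on_def)
      then have "c \<noteq> 1" using uc(2)[of l] by (simp add: c_def)
      moreover have "c ^ K = 1" using that uK by (simp add: c_def power_divide)
      ultimately show ?thesis unfolding e using False by (simp add: geometric_sum)
    qed
  qed
  have "complex_of_real (\<Sum>j<K. (cmod (\<Sum>k<K. a k * (u j * z) ^ k))\<^sup>2)
     = (\<Sum>j<K. \<Sum>k<K. \<Sum>l<K. (a k * z ^ k) * cnj (a l * z ^ l) * (u j ^ k * cnj (u j ^ l)))"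
    unfolding of_real_sum complex_norm_square
    by (intro sum.cong refl) (simp add: sum_product power_mult_distrib mult_ac)
  also have "\<dots> = (\<Sum>k<K. \<Sum>l<K. \<Sum>j<K. (a k * z ^ k) * cnj (a l * z ^ l) * (u j ^ k * cnj (u j ^ l)))"
    by (subst sum.swap, rule sum.cong[OF refl], subst sum.swap) (rule refl)
  also have "\<dots> = (\<Sum>k<K. \<Sum>l<K. if l = k then (a k * z ^ k) * cnj (a k * z ^ k) * of_nat K else 0)"
    unfolding sum_distrib_left[symmetric] by (intro sum.cong refl, subst orth) auto
  also have "\<dots> = (\<Sum>k<K. of_real ((cmod (a k * z ^ k))\<^sup>2) * of_nat K)"
    unfolding complex_norm_square by simp
  also have "\<dots> = of_real (real K * (\<Sum>k<K. (cmod (a k))\<^sup>2 * cmod z ^ (2 * k)))"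
    by (simp add: norm_mult norm_power power_mult_distrib sum_distrib_left mult_ac flip: power_mult)
  finally show ?thesis by (simp only: of_real_eq_iff)
qed

text \<open>By rotation invariance the integral equals its average over \<open>K\<close> rotations,
  and under the integral sign that average is the discrete Parseval formula. The radial weight
  \<open>\<rho>\<close> is left general so that it can also contain a cutoff at a radius.\<close>

lemma nn_integral_disc_polynomial:
  fixes a :: "nat \<Rightarrow> complex" and \<rho> :: "real \<Rightarrow> ennreal"
  assumes [measurable]: "\<rho> \<in> borel_measurable borel"
  shows "(\<integral>\<^sup>+ z. ennreal ((cmod (\<Sum>k<K. a k * z ^ k))\<^sup>2) * \<rho> (cmod z) \<partial>lborel)
    = (\<Sum>k<K. \<integral>\<^sup>+ z. ennreal ((cmod (a k))\<^sup>2 * cmod z ^ (2 * k)) * \<rho> (cmod z) \<partial>lborel)"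
proof (cases "K = 0")
  case False
  define u where "u j = cis (2 * pi * real j / real K)" for j
  define F where "F z = ennreal ((cmod (\<Sum>k<K. a k * z ^ k))\<^sup>2) * \<rho> (cmod z)" for z
  have [measurable]: "F \<in> borel_measurable borel" unfolding F_def[abs_def] by measurable
  have "of_nat K * (\<integral>\<^sup>+ z. F z \<partial>lborel) = (\<Sum>j<K. \<integral>\<^sup>+ z. F (u j * z) \<partial>lborel)"
    by (subst nn_integral_lborel_rotate) (simp_all add: u_def)
  also have "\<dots> = (\<integral>\<^sup>+ z. (\<Sum>j<K. F (u j * z)) \<partial>lborel)"
    by (subst nn_integral_sum) simp_all
  also have "\<dots> = (\<integral>\<^sup>+ z. of_nat K * (\<Sum>k<K. ennreal ((cmod (a k))\<^sup>2 * cmod z ^ (2 * k)) * \<rho> (cmod z)) \<partial>lborel)"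
  proof (rule nn_integral_cong)
    fix z
    have "(\<Sum>j<K. F (u j * z)) = ennreal (\<Sum>j<K. (cmod (\<Sum>k<K. a k * (u j * z) ^ k))\<^sup>2) * \<rho> (cmod z)"
    proof -
      have "F (u j * z) = ennreal ((cmod (\<Sum>k<K. a k * (u j * z) ^ k))\<^sup>2) * \<rho> (cmod z)" for j
        by (simp only: F_def norm_mult u_def norm_cis mult_1)
      then show ?thesis by (simp only: sum_distrib_right[symmetric] sum_ennreal zero_le_power2)
    qed
    also have "(\<Sum>j<K. (cmod (\<Sum>k<K. a k * (u j * z) ^ k))\<^sup>2) = real K * (\<Sum>k<K. (cmod (a k))\<^sup>2 * cmod z ^ (2 * k))"
      unfolding u_def by (rule parseval_roots_of_unity)
    also have "ennreal \<dots> = of_nat K * (\<Sum>k<K. ennreal ((cmod (a k))\<^sup>2 * cmod z ^ (2 * k)))"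
    proof -
      have "ennreal (real K * s) = of_nat K * ennreal s" if "s \<ge> 0" for s
        using that by (simp add: ennreal_mult ennreal_of_nat_eq_real_of_nat)
      then show ?thesis by (simp add: sum_nonneg)
    qed
    finally show "(\<Sum>j<K. F (u j * z)) = of_nat K * (\<Sum>k<K. ennreal ((cmod (a k))\<^sup>2 * cmod z ^ (2 * k)) * \<rho> (cmod z))"
      by (simp only: sum_distrib_right[symmetric] mult.assoc)
  qed
  also have "\<dots> = of_nat K * (\<Sum>k<K. \<integral>\<^sup>+ z. ennreal ((cmod (a k))\<^sup>2 * cmod z ^ (2 * k)) * \<rho> (cmod z) \<partial>lborel)"
    by (subst nn_integral_cmult, simp, subst nn_integral_sum) simp_all
  finally show ?thesis
    using False by (simp add: ennreal_mult_cancel_left F_def)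
qed simp

text \<open>On a disc of radius \<open>r < 1\<close> the partial sums are uniformly bounded, and
  dominated convergence extends the polynomial case. Letting \<open>r\<close> tend to 1 is monotone
  convergence, which allows both sides to be infinite.\<close>

lemma nn_integral_disc_power_series:
  fixes a :: "nat \<Rightarrow> complex" and h :: "complex \<Rightarrow> complex"
  assumes h: "\<And>z. cmod z < 1 \<Longrightarrow> (\<lambda>k. a k * z ^ k) sums h z"
  shows "(\<integral>\<^sup>+ z\<in>ball 0 1. ennreal ((cmod (h z))\<^sup>2 * (1 - (cmod z)\<^sup>2) ^ p) \<partial>lborel)
    = (\<Sum>k. ennreal (pi * (cmod (a k))\<^sup>2 * (fact k * fact p / fact (k + p + 1))))"
proof -
  \<comment> \<open>Off the disc \<open>h\<close> is arbitrary, hence perhaps not Borel. The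
    function \<open>g\<close> agrees with \<open>h\<close> on the disc and is measurable everywhere,
    whatever \<open>suminf\<close> returns where the series diverges.\<close>
  define g where "g z = (\<Sum>k. a k * z ^ k)" for z
  have [measurable]: "g \<in> borel_measurable borel" unfolding g_def[abs_def] by measurable
  have gh: "g z = h z" if "cmod z < 1" for z using h[OF that] by (simp add: g_def sums_iff)
  define \<rho> where "\<rho> t = ennreal ((1 - t\<^sup>2) ^ p)" for t :: real
  have [measurable]: "\<rho> \<in> borel_measurable borel" unfolding \<rho>_def[abs_def] by measurable
  have \<rho>1: "\<rho> t \<le> 1" if "0 \<le> t" "t < 1" for t
    using that by (auto simp: \<rho>_def power_le_one power2_le_iff_abs_le abs_square_le_1 intro!: ennreal_leI[of _ 1, simplified])
  define G where "G z = (\<Sum>k. ennreal ((cmod (a k))\<^sup>2 * cmod z ^ (2 * k)))" for z :: complex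
  have [measurable]: "G \<in> borel_measurable borel" unfolding G_def[abs_def] by measurable
  have inner: "(\<integral>\<^sup>+ z. ennreal ((cmod (g z))\<^sup>2) * (\<rho> (cmod z) * indicator {..<r} (cmod z)) \<partial>lborel)
      = (\<integral>\<^sup>+ z. G z * (\<rho> (cmod z) * indicator {..<r} (cmod z)) \<partial>lborel)" if r: "0 \<le> r" "r < 1" for r
  proof -
    define \<rho>r where "\<rho>r t = \<rho> t * indicator {..<r} t" for t
    have [measurable]: "\<rho>r \<in> borel_measurable borel" unfolding \<rho>r_def[abs_def] by measurable
    have sm: "summable (\<lambda>k. cmod (a k) * r ^ k)"
    proof -
      \<comment> \<open>Convergence at the larger radius \<open>(1 + r) / 2\<close> yields absolute
        convergence at \<open>r\<close>.\<close>
      have "summable (\<lambda>k. a k * of_real ((1 + r) / 2) ^ k)"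
        using h[of "of_real ((1 + r) / 2)"] r by (simp add: sums_iff norm_of_real del: of_real_divide of_real_add)
      then have "summable (\<lambda>k. norm (a k * of_real r ^ k))"
        by (rule powser_insidea) (use r in \<open>simp del: of_real_divide of_real_add\<close>)
      then show ?thesis using r by (simp add: norm_mult norm_power)
    qed
    define C where "C = (\<Sum>k. cmod (a k) * r ^ k)"
    have bound: "cmod (\<Sum>k<K. a k * z ^ k) \<le> C" if "cmod z < r" for K z
    proof -
      have "cmod (\<Sum>k<K. a k * z ^ k) \<le> (\<Sum>k<K. cmod (a k) * r ^ k)"
        by (intro order.trans[OF norm_sum] sum_mono)
          (use that in \<open>auto simp: norm_mult norm_power intro!: mult_left_mono power_mono\<close>)
      also have "\<dots> \<le> C" unfolding C_def by (rule sum_le_suminf[OF sm]) (use r in auto)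
      finally show ?thesis .
    qed
    have lim1: "(\<lambda>K. \<integral>\<^sup>+ z. ennreal ((cmod (\<Sum>k<K. a k * z ^ k))\<^sup>2) * \<rho>r (cmod z) \<partial>lborel)
      \<longlonglongrightarrow> (\<integral>\<^sup>+ z. ennreal ((cmod (g z))\<^sup>2) * \<rho>r (cmod z) \<partial>lborel)"
    proof (rule nn_integral_dominated_convergence[where w = "\<lambda>z. ennreal (C\<^sup>2) * indicator (ball 0 1) z"])
      show "(\<lambda>z. ennreal (C\<^sup>2) * indicator (ball 0 1) z) \<in> borel_measurable (lborel :: complex measure)"
        by (intro borel_measurable_times_ennreal borel_measurable_indicator) auto
      show "(\<integral>\<^sup>+ z. ennreal (C\<^sup>2) * indicator (ball (0::complex) 1) z \<partial>lborel) < \<infinity>"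
        using emeasure_lborel_ball_finite[of "0::complex" 1]
        by (subst nn_integral_cmult_indicator) (auto simp: ennreal_mult_less_top)
      show "AE z in lborel. ennreal ((cmod (\<Sum>k<K. a k * z ^ k))\<^sup>2) * \<rho>r (cmod z)
          \<le> ennreal (C\<^sup>2) * indicator (ball 0 1) z" for K
      proof (rule AE_I2)
        fix z :: complex
        show "ennreal ((cmod (\<Sum>k<K. a k * z ^ k))\<^sup>2) * \<rho>r (cmod z) \<le> ennreal (C\<^sup>2) * indicator (ball 0 1) z"
        proof (cases "cmod z < r")
          case True
          have "ennreal ((cmod (\<Sum>k<K. a k * z ^ k))\<^sup>2) * \<rho> (cmod z) \<le> ennreal (C\<^sup>2) * 1"
            using True r by (intro mult_mono ennreal_leI power_mono bound \<rho>1) auto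
          then show ?thesis using True r by (simp add: \<rho>r_def)
        next
          case False
          then show ?thesis by (simp add: \<rho>r_def)
        qed
      qed
      show "AE z in lborel. (\<lambda>K. ennreal ((cmod (\<Sum>k<K. a k * z ^ k))\<^sup>2) * \<rho>r (cmod z))
          \<longlonglongrightarrow> ennreal ((cmod (g z))\<^sup>2) * \<rho>r (cmod z)"
      proof (rule AE_I2)
        fix z :: complex
        show "(\<lambda>K. ennreal ((cmod (\<Sum>k<K. a k * z ^ k))\<^sup>2) * \<rho>r (cmod z))
          \<longlonglongrightarrow> ennreal ((cmod (g z))\<^sup>2) * \<rho>r (cmod z)"
        proof (cases "cmod z < r")
          case True
          then have "(\<lambda>K. \<Sum>k<K. a k * z ^ k) \<longlonglongrightarrow> g z"
            using h[of z] gh[of z] r by (simp add: sums_def)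
          then have "(\<lambda>K. ennreal ((cmod (\<Sum>k<K. a k * z ^ k))\<^sup>2)) \<longlonglongrightarrow> ennreal ((cmod (g z))\<^sup>2)"
            by (intro tendsto_ennrealI tendsto_intros)
          moreover have "\<rho>r (cmod z) \<noteq> \<infinity>" using True by (simp add: \<rho>r_def \<rho>_def)
          ultimately show ?thesis by (intro tendsto_mult_ennreal tendsto_const) auto
        next
          case False
          then show ?thesis by (simp add: \<rho>r_def)
        qed
      qed
    qed simp_all
    have lim2: "(\<lambda>K. \<integral>\<^sup>+ z. ennreal ((cmod (\<Sum>k<K. a k * z ^ k))\<^sup>2) * \<rho>r (cmod z) \<partial>lborel)
      \<longlonglongrightarrow> (\<Sum>k. \<integral>\<^sup>+ z. ennreal ((cmod (a k))\<^sup>2 * cmod z ^ (2 * k)) * \<rho>r (cmod z) \<partial>lborel)"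
      by (subst nn_integral_disc_polynomial) (simp_all add: summable_LIMSEQ)
    have "(\<integral>\<^sup>+ z. ennreal ((cmod (g z))\<^sup>2) * \<rho>r (cmod z) \<partial>lborel)
        = (\<Sum>k. \<integral>\<^sup>+ z. ennreal ((cmod (a k))\<^sup>2 * cmod z ^ (2 * k)) * \<rho>r (cmod z) \<partial>lborel)"
      by (rule LIMSEQ_unique[OF lim1 lim2])
    also have "\<dots> = (\<integral>\<^sup>+ z. (\<Sum>k. ennreal ((cmod (a k))\<^sup>2 * cmod z ^ (2 * k)) * \<rho>r (cmod z)) \<partial>lborel)"
      by (rule nn_integral_suminf[symmetric]) simp
    finally show ?thesis by (simp add: G_def \<rho>r_def)
  qed
  define U where "U i = ball (0::complex) (1 - 1 / real (Suc i))" for i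
  have sup: "(SUP i. \<integral>\<^sup>+ z. F z * indicator (U i) z \<partial>lborel) = (\<integral>\<^sup>+ z. F z * indicator (ball 0 1) z \<partial>lborel)"
    if [measurable]: "F \<in> borel_measurable borel" for F :: "complex \<Rightarrow> ennreal"
  proof -
    have U: "U i \<in> sets borel" for i by (simp add: U_def)
    have "incseq U"
      unfolding U_def by (intro monoI subset_ball diff_left_mono divide_left_mono) auto
    then have "(SUP i. emeasure (density lborel F) (U i)) = emeasure (density lborel F) (\<Union>i. U i)"
      using U by (intro SUP_emeasure_incseq) auto
    also have "(\<Union>i. U i) = ball 0 1"
    proof
      show "(\<Union>i. U i) \<subseteq> ball 0 1"
        unfolding U_def by (intro UN_least subset_ball) simp
      show "ball 0 1 \<subseteq> (\<Union>i. U i)"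
      proof
        fix z :: complex assume "z \<in> ball 0 1"
        then have "1 - cmod z > 0" by simp
        then obtain i where "inverse (real (Suc i)) < 1 - cmod z" using reals_Archimedean by blast
        then have "z \<in> U i" by (simp add: U_def inverse_eq_divide)
        then show "z \<in> (\<Union>i. U i)" by blast
      qed
    qed
    finally show ?thesis using U by (simp add: emeasure_density)
  qed
  have "(\<integral>\<^sup>+ z\<in>ball 0 1. ennreal ((cmod (h z))\<^sup>2 * (1 - (cmod z)\<^sup>2) ^ p) \<partial>lborel)
      = (\<integral>\<^sup>+ z. (ennreal ((cmod (g z))\<^sup>2) * \<rho> (cmod z)) * indicator (ball 0 1) z \<partial>lborel)"
  proof (rule nn_integral_cong)
    fix z :: complex
    have "0 \<le> (1 - (cmod z)\<^sup>2) ^ p" if "cmod z < 1"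
      using that by (intro zero_le_power) (simp add: abs_square_le_1)
    then show "ennreal ((cmod (h z))\<^sup>2 * (1 - (cmod z)\<^sup>2) ^ p) * indicator (ball 0 1) z
        = (ennreal ((cmod (g z))\<^sup>2) * \<rho> (cmod z)) * indicator (ball 0 1) z"
      by (auto simp: gh \<rho>_def ennreal_mult split: split_indicator)
  qed
  also have "\<dots> = (SUP i. \<integral>\<^sup>+ z. (ennreal ((cmod (g z))\<^sup>2) * \<rho> (cmod z)) * indicator (U i) z \<partial>lborel)"
    by (rule sup[symmetric]) simp
  also have "\<dots> = (SUP i. \<integral>\<^sup>+ z. (G z * \<rho> (cmod z)) * indicator (U i) z \<partial>lborel)"
  proof (rule SUP_cong[OF refl])
    fix i
    have ind: "indicator (U i) z = (indicator {..<1 - 1 / real (Suc i)} (cmod z) :: ennreal)" for z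
      by (simp add: U_def indicator_def)
    show "(\<integral>\<^sup>+ z. (ennreal ((cmod (g z))\<^sup>2) * \<rho> (cmod z)) * indicator (U i) z \<partial>lborel)
        = (\<integral>\<^sup>+ z. (G z * \<rho> (cmod z)) * indicator (U i) z \<partial>lborel)"
      unfolding ind mult.assoc by (rule inner) auto
  qed
  also have "\<dots> = (\<integral>\<^sup>+ z. (G z * \<rho> (cmod z)) * indicator (ball 0 1) z \<partial>lborel)"
    by (rule sup) simp
  also have "\<dots> = (\<integral>\<^sup>+ z. (\<Sum>k. ennreal ((cmod (a k))\<^sup>2) *
      (ennreal (cmod z ^ (2 * k) * (1 - (cmod z)\<^sup>2) ^ p) * indicator (ball 0 1) z)) \<partial>lborel)"
  proof (rule nn_integral_cong)
    fix z :: complex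
    have "(G z * \<rho> (cmod z)) * indicator (ball 0 1) z
        = (\<Sum>k. ennreal ((cmod (a k))\<^sup>2 * cmod z ^ (2 * k)) * (\<rho> (cmod z) * indicator (ball 0 1) z))"
      by (simp add: G_def mult.assoc)
    also have "\<dots> = (\<Sum>k. ennreal ((cmod (a k))\<^sup>2) *
      (ennreal (cmod z ^ (2 * k) * (1 - (cmod z)\<^sup>2) ^ p) * indicator (ball 0 1) z))"
    proof (rule suminf_cong)
      fix k
      have "0 \<le> (1 - (cmod z)\<^sup>2) ^ p" if "cmod z < 1"
        using that by (intro zero_le_power) (simp add: abs_square_le_1)
      then show "ennreal ((cmod (a k))\<^sup>2 * cmod z ^ (2 * k)) * (\<rho> (cmod z) * indicator (ball 0 1) z)
         = ennreal ((cmod (a k))\<^sup>2) * (ennreal (cmod z ^ (2 * k) * (1 - (cmod z)\<^sup>2) ^ p) * indicator (ball 0 1) z)"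
        by (auto simp: \<rho>_def ennreal_mult mult.assoc split: split_indicator)
    qed
    finally show "(G z * \<rho> (cmod z)) * indicator (ball 0 1) z = (\<Sum>k. ennreal ((cmod (a k))\<^sup>2) *
      (ennreal (cmod z ^ (2 * k) * (1 - (cmod z)\<^sup>2) ^ p) * indicator (ball 0 1) z))" .
  qed
  also have "\<dots> = (\<Sum>k. ennreal ((cmod (a k))\<^sup>2) *
      (\<integral>\<^sup>+ z\<in>ball 0 1. ennreal (cmod z ^ (2 * k) * (1 - (cmod z)\<^sup>2) ^ p) \<partial>lborel))"
  proof -
    have [measurable]: "indicator (ball 0 1) \<in> borel_measurable (borel :: complex measure)"
      by (intro borel_measurable_indicator) simp
    show ?thesis by (subst nn_integral_suminf, simp, subst nn_integral_cmult) simp_all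
  qed
  also have "\<dots> = (\<Sum>k. ennreal (pi * (cmod (a k))\<^sup>2 * (fact k * fact p / fact (k + p + 1))))"
    unfolding nn_integral_disc_moment by (intro suminf_cong) (simp add: ennreal_mult[symmetric] mult_ac)
  finally show ?thesis .
qed

text \<open>The coefficients of \<open>(deriv ^^ Suc j) f z / (z - l)\<close> are the
  \<open>loc_sum\<close> values up to unimodular factors, so the power series formula applies. The
  exponent of the radial weight is \<open>Suc j\<close> rather than \<open>j\<close> because the
  Poisson kernel at \<open>l\<close> supplies one more factor; its normalised moments are
  \<open>loc_weight\<close>.\<close>

lemma loc_D_eq_disc_integral:
  assumes f: "f holomorphic_on ball 0 1" and l: "cmod l = 1"
  shows "ennreal (1 / (fact (Suc j) * fact j * pi)) *
      (\<integral>\<^sup>+ z\<in>ball 0 1. ennreal ((cmod ((deriv ^^ Suc j) f z / (z - l)))\<^sup>2 * (1 - (cmod z)\<^sup>2) ^ Suc j) \<partial>lborel)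
    = loc_D (Suc j) l (fps_expansion f 0)"
proof -
  define F where "F = fps_expansion f 0"
  define d where "d = (deriv ^^ Suc j) f"
  define h where "h z = d z / (z - l)" for z
  have "d holomorphic_on ball 0 1" unfolding d_def by (intro holomorphic_higher_deriv f) simp
  moreover have ne: "z - l \<noteq> 0" if "z \<in> ball 0 1" for z using that l by auto
  ultimately have h: "h holomorphic_on ball 0 1" unfolding h_def by (intro holomorphic_intros)
  define H where "H = fps_expansion h 0"
  define D where "D = Abs_fps (\<lambda>k. fact (k + Suc j) / fact k * fps_nth F (k + Suc j))"
  have "d has_fps_expansion fps_expansion d 0"
    by (rule has_fps_expansion_fps_expansion[of "ball 0 1"]) (use \<open>d holomorphic_on _\<close> in auto)
  moreover have "fps_expansion d 0 = D"
  proof (rule fps_ext)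
    fix k
    have "(deriv ^^ k) d 0 = (deriv ^^ (k + Suc j)) f 0" by (simp only: d_def funpow_add o_apply)
    then show "fps_nth (fps_expansion d 0) k = fps_nth D k"
      by (simp only: D_def F_def fps_expansion_def fps_nth_Abs_fps)
        (simp del: fact_Suc funpow.simps add_Suc_right)
  qed
  ultimately have dD: "d has_fps_expansion D" by simp
  have "h has_fps_expansion H"
    unfolding H_def by (rule has_fps_expansion_fps_expansion[of "ball 0 1"]) (use h in auto)
  then have prod: "(\<lambda>z. (z - l) * h z) has_fps_expansion (fps_X - fps_const l) * H"
    by (intro fps_expansion_intros)
  have ev: "eventually (\<lambda>z. (z - l) * h z = d z) (nhds 0)"
  proof (rule eventually_mono)
    show "eventually (\<lambda>z. z \<in> ball (0::complex) 1) (nhds 0)"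
      by (rule eventually_nhds_in_open) auto
    show "(z - l) * h z = d z" if "z \<in> ball 0 1" for z using ne[OF that] by (simp add: h_def)
  qed
  have "d has_fps_expansion (fps_X - fps_const l) * H"
    using prod has_fps_expansion_cong[OF ev refl] by simp
  with dD have DH: "D = (fps_X - fps_const l) * H" by (rule fps_expansion_unique_complex)
  have sums: "(\<lambda>k. fps_nth H k * z ^ k) sums h z" if "cmod z < 1" for z
    using holomorphic_power_series[OF h, of z] that by (simp add: H_def fps_expansion_def)
  \<comment> \<open>Telescoping: the summand of index \<open>i\<close> is a difference of
    consecutive values of \<open>l ^ (i + Suc (Suc j)) * fps_nth H i\<close>.\<close>
  have S: "loc_sum (Suc j) l F m = - (l ^ (m + Suc (Suc j)) * fps_nth H m)" for m
  proof -
    have "loc_sum (Suc j) l F m = (\<Sum>i\<le>m. l ^ (i + Suc j) * fps_nth D i)"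
      unfolding loc_sum_def D_def by (intro sum.cong refl) simp
    also have "\<dots> = - (l ^ (m + Suc (Suc j)) * fps_nth H m)"
      unfolding DH by (induction m) (simp_all add: left_diff_distrib algebra_simps)
    finally show ?thesis .
  qed
  have nS: "cmod (loc_sum (Suc j) l F m) = cmod (fps_nth H m)" for m
    unfolding S using l by (simp add: norm_mult norm_power)
  have "(\<integral>\<^sup>+ z\<in>ball 0 1. ennreal ((cmod (h z))\<^sup>2 * (1 - (cmod z)\<^sup>2) ^ Suc j) \<partial>lborel)
      = (\<Sum>k. ennreal (pi * (cmod (fps_nth H k))\<^sup>2 * (fact k * fact (Suc j) / fact (k + Suc j + 1))))"
    by (rule nn_integral_disc_power_series[OF sums])
  then have "ennreal (1 / (fact (Suc j) * fact j * pi)) *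
      (\<integral>\<^sup>+ z\<in>ball 0 1. ennreal ((cmod (h z))\<^sup>2 * (1 - (cmod z)\<^sup>2) ^ Suc j) \<partial>lborel)
      = (\<Sum>k. ennreal (1 / (fact (Suc j) * fact j * pi)) *
          ennreal (pi * (cmod (fps_nth H k))\<^sup>2 * (fact k * fact (Suc j) / fact (k + Suc j + 1))))"
    by (simp only: ennreal_suminf_cmult)
  also have "\<dots> = loc_D (Suc j) l F"
    unfolding loc_D_def
  proof (rule suminf_cong)
    fix k
    have "1 / (fact (Suc j) * fact j * pi) * (pi * (cmod (fps_nth H k))\<^sup>2 * (fact k * fact (Suc j) / fact (k + Suc j + 1)))
      = loc_weight (Suc j) k * (cmod (loc_sum (Suc j) l F k))\<^sup>2"
      unfolding nS loc_weight_def by (simp add: divide_simps del: fact_Suc)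
    then show "ennreal (1 / (fact (Suc j) * fact j * pi)) *
          ennreal (pi * (cmod (fps_nth H k))\<^sup>2 * (fact k * fact (Suc j) / fact (k + Suc j + 1)))
        = ennreal (loc_weight (Suc j) k * (cmod (loc_sum (Suc j) l F k))\<^sup>2)"
      by (subst ennreal_mult[symmetric]) simp_all
  qed
  finally show ?thesis by (simp only: h_def d_def F_def)
qed

text \<open>Writing the Poisson integral out and exchanging two nonnegative integrals leaves, for
  each \<open>l\<close>, the area integral of \<open>loc_D_eq_disc_integral\<close>. Finiteness of
  \<open>mu\<close> provides sigma-finiteness for the exchange and integrability of the
  kernel.\<close>

lemma D_mu_eq:
  fixes mu :: "complex measure"
  assumes sets: "sets mu = sets (restrict_space borel (sphere (0::complex) 1))"
    and fin: "finite_measure mu" and f: "f holomorphic_on ball 0 1"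
  shows "D_mu mu (Suc j) f = (\<integral>\<^sup>+ l. loc_D (Suc j) l (fps_expansion f 0) \<partial>mu)"
proof -
  have pair: "pair_sigma_finite (lborel :: complex measure) mu"
    by (intro pair_sigma_finite.intro sigma_finite_lborel finite_measure.axioms(1) fin)
  have space: "space mu = sphere 0 1"
    using sets_eq_imp_space_eq[OF sets] by (simp add: space_restrict_space)
  have id: "(\<lambda>l. l) \<in> borel_measurable mu"
    by (subst measurable_cong_sets[OF sets refl]) (rule measurable_restrict_space1, simp)
  \<comment> \<open>The derivative is set to zero off the disc, since its continuity, and with it
    measurability, is known only inside.\<close>
  define d where "d z = indicator (ball 0 1) z *\<^sub>R (deriv ^^ Suc j) f z" for z
  have [measurable]: "d \<in> borel_measurable borel"
    unfolding d_def[abs_def]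
    by (intro borel_measurable_continuous_on_indicator holomorphic_on_imp_continuous_on
        holomorphic_higher_deriv f) simp_all
  have [measurable]: "snd \<in> borel_measurable ((lborel :: complex measure) \<Otimes>\<^sub>M mu)"
    by (rule measurable_compose[OF measurable_snd id])
  define k where "k z l = (1 - (cmod z)\<^sup>2) / (cmod (z - l))\<^sup>2" for z l :: complex
  define g where "g z l = ennreal ((cmod (d z))\<^sup>2 * (1 - (cmod z)\<^sup>2) ^ j) * ennreal (k z l)" for z l
  have g_meas [measurable]: "(\<lambda>(z, l). g z l) \<in> borel_measurable (lborel \<Otimes>\<^sub>M mu)"
    unfolding g_def[abs_def] k_def[abs_def] case_prod_beta by measurable
  have k0: "k z l \<ge> 0" if "cmod z < 1" for z l
    using that by (simp add: k_def abs_square_le_1)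
  \<comment> \<open>\<open>poisson\<close> is a Bochner integral, which defaults to 0 for a
    non-integrable kernel. For fixed \<open>z\<close> the kernel is bounded in \<open>l\<close>, so
    it agrees with the nonnegative integral.\<close>
  have poisson: "ennreal (poisson mu z) = (\<integral>\<^sup>+ l. ennreal (k z l) \<partial>mu)" if z: "cmod z < 1" for z
  proof -
    have [measurable]: "(\<lambda>l. k z l) \<in> borel_measurable mu"
      using measurable_compose[OF id, of "k z" borel] unfolding k_def[abs_def] by simp
    have "AE l in mu. norm (k z l) \<le> 1 / (1 - cmod z)\<^sup>2"
    proof (rule AE_I2)
      fix l assume "l \<in> space mu"
      then have l: "cmod l = 1" by (simp add: space)
      have "1 - cmod z \<le> cmod (z - l)" using norm_triangle_ineq2[of l z] l by (simp add: norm_minus_commute)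
      then have "(1 - cmod z)\<^sup>2 \<le> (cmod (z - l))\<^sup>2" using z by (intro power_mono) auto
      then have "k z l \<le> 1 / (1 - cmod z)\<^sup>2"
        unfolding k_def using z by (intro frac_le) auto
      then show "norm (k z l) \<le> 1 / (1 - cmod z)\<^sup>2" using k0[OF z] by simp
    qed
    then have "integrable mu (\<lambda>l. k z l)" by (intro finite_measure.integrable_const_bound[OF fin]) auto
    then show ?thesis
      unfolding poisson_def k_def[symmetric] using k0[OF z]
      by (intro nn_integral_eq_integral[symmetric]) auto
  qed
  have "D_mu mu (Suc j) f = ennreal (1 / (fact (Suc j) * fact j * pi)) * (\<integral>\<^sup>+ z. \<integral>\<^sup>+ l. g z l \<partial>mu \<partial>lborel)"
    unfolding D_mu_def diff_Suc_1
  proof (intro arg_cong2[where f = times] refl nn_integral_cong)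
    fix z :: complex
    show "ennreal ((cmod ((deriv ^^ Suc j) f z))\<^sup>2 * poisson mu z * (1 - (cmod z)\<^sup>2) ^ j) * indicator (ball 0 1) z
        = (\<integral>\<^sup>+ l. g z l \<partial>mu)"
    proof (cases "z \<in> ball 0 1")
      case True
      then have z: "cmod z < 1" by simp
      define c where "c = (cmod (d z))\<^sup>2 * (1 - (cmod z)\<^sup>2) ^ j"
      have c: "c \<ge> 0" using z by (auto simp: c_def abs_square_le_1 intro!: mult_nonneg_nonneg zero_le_power)
      have p: "poisson mu z \<ge> 0"
        unfolding poisson_def k_def[symmetric] by (rule Bochner_Integration.integral_nonneg) (rule k0[OF z])
      have [measurable]: "(\<lambda>l. k z l) \<in> borel_measurable mu"
        using measurable_compose[OF id, of "k z" borel] unfolding k_def[abs_def] by simp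
      have "ennreal ((cmod ((deriv ^^ Suc j) f z))\<^sup>2 * poisson mu z * (1 - (cmod z)\<^sup>2) ^ j) * indicator (ball 0 1) z
          = ennreal (c * poisson mu z)"
        using True by (simp add: c_def d_def mult_ac)
      also have "\<dots> = ennreal c * (\<integral>\<^sup>+ l. ennreal (k z l) \<partial>mu)"
        using c p by (simp add: ennreal_mult poisson[OF z])
      also have "\<dots> = (\<integral>\<^sup>+ l. g z l \<partial>mu)"
        unfolding g_def c_def[symmetric] by (rule nn_integral_cmult[symmetric]) simp
      finally show ?thesis .
    next
      case False
      then show ?thesis by (simp add: g_def d_def)
    qed
  qed
  also have "(\<integral>\<^sup>+ z. \<integral>\<^sup>+ l. g z l \<partial>mu \<partial>lborel) = (\<integral>\<^sup>+ l. \<integral>\<^sup>+ z. g z l \<partial>lborel \<partial>mu)"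
    by (rule pair_sigma_finite.Fubini'[OF pair, symmetric]) simp
  also have "ennreal (1 / (fact (Suc j) * fact j * pi)) * \<dots>
      = (\<integral>\<^sup>+ l. ennreal (1 / (fact (Suc j) * fact j * pi)) * (\<integral>\<^sup>+ z. g z l \<partial>lborel) \<partial>mu)"
  proof (rule nn_integral_cmult[symmetric])
    have "(\<lambda>(l, z). g z l) \<in> borel_measurable (mu \<Otimes>\<^sub>M lborel)"
      using measurable_pair_swap[OF g_meas] by simp
    then show "(\<lambda>l. \<integral>\<^sup>+ z. g z l \<partial>lborel) \<in> borel_measurable mu"
      by (rule sigma_finite_measure.borel_measurable_nn_integral[OF sigma_finite_lborel])
  qed
  also have "\<dots> = (\<integral>\<^sup>+ l. loc_D (Suc j) l (fps_expansion f 0) \<partial>mu)"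
  proof (rule nn_integral_cong)
    fix l assume "l \<in> space mu"
    then have l: "cmod l = 1" by (simp add: space)
    have "(\<integral>\<^sup>+ z. g z l \<partial>lborel) = (\<integral>\<^sup>+ z\<in>ball 0 1. ennreal ((cmod ((deriv ^^ Suc j) f z / (z - l)))\<^sup>2
        * (1 - (cmod z)\<^sup>2) ^ Suc j) \<partial>lborel)"
    proof (rule nn_integral_cong)
      fix z :: complex
      show "g z l = ennreal ((cmod ((deriv ^^ Suc j) f z / (z - l)))\<^sup>2 * (1 - (cmod z)\<^sup>2) ^ Suc j) * indicator (ball 0 1) z"
      proof (cases "z \<in> ball 0 1")
        case True
        then have "cmod z < 1" by simp
        then have "g z l = ennreal ((cmod (d z))\<^sup>2 * (1 - (cmod z)\<^sup>2) ^ j * k z l)"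
          unfolding g_def using k0 by (intro ennreal_mult[symmetric]) (auto simp: abs_square_le_1)
        then show ?thesis
          using True by (simp add: d_def k_def norm_divide power_divide mult_ac)
      next
        case False
        then show ?thesis by (simp add: g_def d_def)
      qed
    qed
    then show "ennreal (1 / (fact (Suc j) * fact j * pi)) * (\<integral>\<^sup>+ z. g z l \<partial>lborel)
        = loc_D (Suc j) l (fps_expansion f 0)"
      using loc_D_eq_disc_integral[OF f l] by simp
  qed
  finally show ?thesis .
qed

lemma loc_D_measurable:
  fixes mu :: "complex measure"
  assumes sets: "sets mu = sets (restrict_space borel (sphere (0::complex) 1))"
  shows "(\<lambda>l. loc_D n l F) \<in> borel_measurable mu"
proof (subst measurable_cong_sets[OF sets refl], rule measurable_restrict_space1)
  show "(\<lambda>l. loc_D n l F) \<in> borel_measurable borel"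
    unfolding loc_D_def loc_sum_def by measurable
qed

section \<open>Weak limits\<close>

lemma ennreal_suminf_parallelogram:
  fixes x y :: "nat \<Rightarrow> complex"
  assumes c: "\<And>m. c m \<ge> 0"
  shows "(\<Sum>m. ennreal (c m * (cmod (x m + y m))\<^sup>2)) + (\<Sum>m. ennreal (c m * (cmod (x m - y m))\<^sup>2))
    = 2 * (\<Sum>m. ennreal (c m * (cmod (x m))\<^sup>2)) + 2 * (\<Sum>m. ennreal (c m * (cmod (y m))\<^sup>2))"
proof -
  have "ennreal (c m * (cmod (x m + y m))\<^sup>2) + ennreal (c m * (cmod (x m - y m))\<^sup>2)
      = 2 * ennreal (c m * (cmod (x m))\<^sup>2) + 2 * ennreal (c m * (cmod (y m))\<^sup>2)" for m
  proof -
    have "(cmod (x m + y m))\<^sup>2 + (cmod (x m - y m))\<^sup>2 = 2 * (cmod (x m))\<^sup>2 + 2 * (cmod (y m))\<^sup>2"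
      unfolding cmod_power2 by (simp add: power2_eq_square algebra_simps)
    then have "c m * ((cmod (x m + y m))\<^sup>2 + (cmod (x m - y m))\<^sup>2) = c m * (2 * (cmod (x m))\<^sup>2 + 2 * (cmod (y m))\<^sup>2)"
      by (rule arg_cong)
    then have "c m * (cmod (x m + y m))\<^sup>2 + c m * (cmod (x m - y m))\<^sup>2
        = 2 * (c m * (cmod (x m))\<^sup>2) + 2 * (c m * (cmod (y m))\<^sup>2)"
      by (simp only: distrib_left mult.left_commute)
    moreover have "ennreal (2 * s + 2 * t) = 2 * ennreal s + 2 * ennreal t" if "s \<ge> 0" "t \<ge> 0" for s t
      using that by (simp add: ennreal_plus ennreal_mult)
    ultimately show ?thesis
      using c[of m] by (subst ennreal_plus[symmetric]) (auto simp del: ennreal_plus)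
  qed
  then show ?thesis
    unfolding ennreal_suminf_cmult[symmetric]
    by (simp only: suminf_add[OF summableI summableI])
qed

text \<open>Fatou's lemma for counting measure: finite partial sums converge, and each is at most
  the full sum.\<close>

lemma ennreal_suminf_le_liminf:
  fixes x :: "nat \<Rightarrow> nat \<Rightarrow> complex"
  assumes lim: "\<And>m. (\<lambda>i. x i m) \<longlonglongrightarrow> y m"
  shows "(\<Sum>m. ennreal (c m * (cmod (y m))\<^sup>2)) \<le> liminf (\<lambda>i. \<Sum>m. ennreal (c m * (cmod (x i m))\<^sup>2))"
proof (rule ennreal_suminf_leI)
  fix N
  have "(\<lambda>i. \<Sum>m<N. ennreal (c m * (cmod (x i m))\<^sup>2)) \<longlonglongrightarrow> (\<Sum>m<N. ennreal (c m * (cmod (y m))\<^sup>2))"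
    by (intro tendsto_sum tendsto_ennrealI tendsto_intros lim)
  then have "(\<Sum>m<N. ennreal (c m * (cmod (y m))\<^sup>2)) = liminf (\<lambda>i. \<Sum>m<N. ennreal (c m * (cmod (x i m))\<^sup>2))"
    by (rule lim_imp_Liminf[OF sequentially_bot, symmetric])
  also have "\<dots> \<le> liminf (\<lambda>i. \<Sum>m. ennreal (c m * (cmod (x i m))\<^sup>2))"
    by (intro Liminf_mono always_eventually allI sum_le_suminf) auto
  finally show "(\<Sum>m<N. ennreal (c m * (cmod (y m))\<^sup>2)) \<le> liminf (\<lambda>i. \<Sum>m. ennreal (c m * (cmod (x i m))\<^sup>2))" .
qed

lemma loc_sum_add: "loc_sum n l (f + g) m = loc_sum n l f m + loc_sum n l g m"
  and loc_sum_diff: "loc_sum n l (f - g) m = loc_sum n l f m - loc_sum n l g m"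
  and loc_sum_const_mult: "loc_sum n l (fps_const c * f) m = c * loc_sum n l f m"
  by (simp_all add: loc_sum_def sum.distrib sum_subtractf sum_distrib_left ring_distribs mult_ac)

text \<open>The squared norm of \<open>H_mu\<close> read off the Taylor series, by
  \<open>D_mu_eq\<close>. In this form it is built from weighted squares of linear functionals of
  finitely many coefficients, whence the parallelogram law and lower semicontinuity under
  coefficientwise convergence.\<close>

definition mu_norm :: "complex measure \<Rightarrow> nat \<Rightarrow> complex fps \<Rightarrow> ennreal" where
  "mu_norm mu n F = h2norm F + (\<integral>\<^sup>+ l. loc_D n l F \<partial>mu)"

lemma mu_norm_const_mult:
  assumes "\<And>F. (\<lambda>l. loc_D n l F) \<in> borel_measurable mu"
  shows "mu_norm mu n (fps_const c * F) = ennreal ((cmod c)\<^sup>2) * mu_norm mu n F"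
proof -
  have "loc_D n l (fps_const c * F) = ennreal ((cmod c)\<^sup>2) * loc_D n l F" for l
    unfolding loc_D_def ennreal_suminf_cmult[symmetric] loc_sum_const_mult
    by (simp add: norm_mult power_mult_distrib ennreal_mult'[symmetric] mult_ac)
  then show ?thesis
    by (simp add: mu_norm_def wnorm_const_mult nn_integral_cmult assms distrib_left)
qed

lemma mu_norm_parallelogram:
  assumes [measurable]: "\<And>F. (\<lambda>l. loc_D n l F) \<in> borel_measurable mu"
  shows "mu_norm mu n (F + G) + mu_norm mu n (F - G) = 2 * mu_norm mu n F + 2 * mu_norm mu n G"
proof -
  have h: "h2norm (F + G) + h2norm (F - G) = 2 * h2norm F + 2 * h2norm G"
    unfolding wnorm_def fps_add_nth fps_sub_nth by (rule ennreal_suminf_parallelogram) simp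
  have l: "loc_D n l (F + G) + loc_D n l (F - G) = 2 * loc_D n l F + 2 * loc_D n l G" for l
    unfolding loc_D_def loc_sum_add loc_sum_diff by (rule ennreal_suminf_parallelogram) simp
  have "(\<integral>\<^sup>+ l. loc_D n l (F + G) \<partial>mu) + (\<integral>\<^sup>+ l. loc_D n l (F - G) \<partial>mu)
      = 2 * (\<integral>\<^sup>+ l. loc_D n l F \<partial>mu) + 2 * (\<integral>\<^sup>+ l. loc_D n l G \<partial>mu)"
    by (simp add: nn_integral_add[symmetric] nn_integral_cmult[symmetric] l)
  then have "(h2norm (F + G) + h2norm (F - G)) + ((\<integral>\<^sup>+ l. loc_D n l (F + G) \<partial>mu) + (\<integral>\<^sup>+ l. loc_D n l (F - G) \<partial>mu))
      = (2 * h2norm F + 2 * h2norm G) + (2 * (\<integral>\<^sup>+ l. loc_D n l F \<partial>mu) + 2 * (\<integral>\<^sup>+ l. loc_D n l G \<partial>mu))"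
    by (simp only: h)
  then show ?thesis by (simp only: mu_norm_def distrib_left add_ac)
qed

text \<open>Fatou is applied to the two summands of \<open>mu_norm\<close> separately, which costs
  the factor 2. It does no harm, as the bounds \<open>C\<close> to be inserted tend to 0.\<close>

lemma mu_norm_lsc:
  assumes meas: "\<And>F. (\<lambda>l. loc_D n l F) \<in> borel_measurable mu"
    and lim: "\<And>k. (\<lambda>i. fps_nth (F i) k) \<longlonglongrightarrow> fps_nth G k"
    and le: "\<And>i. i \<ge> i0 \<Longrightarrow> mu_norm mu n (F i) \<le> C"
  shows "mu_norm mu n G \<le> 2 * C"
proof -
  have ev: "eventually (\<lambda>i. mu_norm mu n (F i) \<le> C) sequentially"
    using le by (auto simp: eventually_sequentially)
  have bound: "liminf u \<le> C" if "\<And>i. u i \<le> mu_norm mu n (F i)" for u :: "nat \<Rightarrow> ennreal"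
  proof -
    have "liminf u \<le> liminf (\<lambda>_. C)"
      by (intro Liminf_mono eventually_mono[OF ev] order.trans[OF that])
    then show ?thesis by (simp add: Liminf_const)
  qed
  have "h2norm G \<le> liminf (\<lambda>i. h2norm (F i))"
    unfolding wnorm_def by (rule ennreal_suminf_le_liminf[OF lim])
  also have "\<dots> \<le> C" by (rule bound) (simp add: mu_norm_def)
  finally have h: "h2norm G \<le> C" .
  have "(\<integral>\<^sup>+ l. loc_D n l G \<partial>mu) \<le> (\<integral>\<^sup>+ l. liminf (\<lambda>i. loc_D n l (F i)) \<partial>mu)"
    unfolding loc_D_def
    by (intro nn_integral_mono ennreal_suminf_le_liminf) (unfold loc_sum_def, intro tendsto_intros lim)
  also have "\<dots> \<le> liminf (\<lambda>i. \<integral>\<^sup>+ l. loc_D n l (F i) \<partial>mu)"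
    by (rule nn_integral_liminf) (rule meas)
  also have "\<dots> \<le> C" by (rule bound) (simp add: mu_norm_def)
  finally show ?thesis using h unfolding mu_norm_def mult_2 by (rule add_mono[rotated])
qed

text \<open>Mazur's lemma for \<open>mu_norm mu n\<close>. The convex set at stage \<open>i\<close> consists of all elements of
  \<open>V\<close> whose first coefficients nearly agree with those of the limit, which replaces convex hulls of tails;
  lower semicontinuity replaces completeness.\<close>

lemma mu_norm_mazur:
  assumes meas: "\<And>F. (\<lambda>l. loc_D n l F) \<in> borel_measurable mu"
    and mid: "\<And>F G. F \<in> V \<Longrightarrow> G \<in> V \<Longrightarrow> fps_const (1 / 2) * (F + G) \<in> V"
    and u: "\<And>i. u i \<in> V" "\<And>k. (\<lambda>i. fps_nth (u i) k) \<longlonglongrightarrow> fps_nth x k"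
    and C: "\<And>i. mu_norm mu n (u i - x) \<le> C" "C < \<infinity>"
  obtains w where "\<And>i. w i \<in> V" "(\<lambda>i. mu_norm mu n (w i - x)) \<longlonglongrightarrow> 0"
proof -
  define Q where "Q F = mu_norm mu n F" for F
  define e where "e i = 1 / real (Suc i)" for i
  have e0: "e i > 0" for i by (simp add: e_def)
  have e_mono: "e i' \<le> e i" if "i \<le> i'" for i i' using that by (simp add: e_def frac_le)
  define K where "K i = {F \<in> V. \<forall>k\<le>i. cmod (fps_nth F k - fps_nth x k) \<le> e i}" for i
  have K_mono: "K i' \<subseteq> K i" if "i \<le> i'" for i i'
  proof
    fix F assume F: "F \<in> K i'"
    have "cmod (fps_nth F k - fps_nth x k) \<le> e i" if "k \<le> i" for k
      using F that \<open>i \<le> i'\<close> e_mono[OF \<open>i \<le> i'\<close>] by (auto simp: K_def intro: order.trans)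
    then show "F \<in> K i" using F by (simp add: K_def)
  qed
  have K_mid: "fps_const (1 / 2) * (F + G) \<in> K i" if "F \<in> K i" "G \<in> K i" for F G i
  proof -
    have "cmod (fps_nth (fps_const (1 / 2) * (F + G)) k - fps_nth x k) \<le> e i" if "k \<le> i" for k
    proof -
      define a b where "a = fps_nth F k - fps_nth x k" and "b = fps_nth G k - fps_nth x k"
      have ab: "cmod a \<le> e i" "cmod b \<le> e i"
        using \<open>F \<in> K i\<close> \<open>G \<in> K i\<close> that by (auto simp: K_def a_def b_def)
      have eq: "fps_nth (fps_const (1 / 2) * (F + G)) k - fps_nth x k = (a + b) / 2"
        by (simp add: a_def b_def field_simps)
      have "cmod ((a + b) / 2) \<le> e i"
        using norm_triangle_ineq[of a b] ab by (simp add: norm_divide)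
      then show ?thesis unfolding eq .
    qed
    then show ?thesis using mid that by (auto simp: K_def)
  qed
  \<comment> \<open>The squared distance from \<open>x\<close> to \<open>K i\<close>. It increases
    with \<open>i\<close> and stays below \<open>C\<close>, since every \<open>K i\<close> contains
    some \<open>u p\<close>; its convergence makes near-minimisers Cauchy.\<close>
  define m where "m i = (INF F\<in>K i. Q (F - x))" for i
  have mC: "m i \<le> C" for i
  proof -
    have "\<forall>\<^sub>F p in sequentially. \<forall>k\<in>{..i}. cmod (fps_nth (u p) k - fps_nth x k) < e i"
    proof (rule eventually_ball_finite, simp, intro ballI)
      fix k
      show "\<forall>\<^sub>F p in sequentially. cmod (fps_nth (u p) k - fps_nth x k) < e i"
        using tendstoD[OF u(2)[of k] e0[of i]] by (simp add: dist_norm)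
    qed
    then obtain p where "\<forall>k\<in>{..i}. cmod (fps_nth (u p) k - fps_nth x k) < e i"
      by (auto simp: eventually_sequentially)
    then have "u p \<in> K i" using u(1) by (auto simp: K_def intro: less_imp_le)
    then have "m i \<le> Q (u p - x)" unfolding m_def by (rule INF_lower)
    then show ?thesis using C(1)[of p] by (simp add: Q_def)
  qed
  have mfin: "m i < \<infinity>" for i using mC[of i] C(2) by (rule le_less_trans)
  have "\<exists>F\<in>K i. Q (F - x) < m i + ennreal (e i)" for i
  proof -
    have "m i < m i + ennreal (e i)"
      using mfin[of i] e0[of i] by (cases "m i") (auto simp: ennreal_less_iff simp flip: ennreal_plus)
    then show ?thesis unfolding m_def INF_less_iff by simp
  qed
  then obtain w where w: "\<And>i. w i \<in> K i" "\<And>i. Q (w i - x) < m i + ennreal (e i)" by metis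
  define r where "r i = enn2real (m i)" for i
  have mr: "m i = ennreal (r i)" and r0: "r i \<ge> 0" for i
    using mfin[of i] by (auto simp: r_def less_top)
  have r_mono: "r i \<le> r i'" if "i \<le> i'" for i i'
  proof -
    have "m i \<le> m i'" unfolding m_def by (rule INF_superset_mono[OF K_mono[OF that]]) simp
    then show ?thesis using r0 by (simp add: mr)
  qed
  obtain R where R: "r \<longlonglongrightarrow> R" "\<And>i. r i \<le> R"
  proof (rule incseq_convergent)
    show "incseq r" using r_mono by (simp add: incseq_def)
    show "\<forall>i. r i \<le> enn2real C"
      unfolding r_def using mC C(2) by (auto intro: enn2real_mono)
  qed blast
  \<comment> \<open>The midpoint of \<open>w i\<close> and \<open>w j\<close> lies in
    \<open>K j\<close>, so \<open>Q (s + t)\<close> is at least \<open>4 * m j\<close>. The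
    parallelogram law then leaves at most \<open>2 * (r i - r j) + 2 * e i + 2 * e j\<close> for
    \<open>Q (s - t)\<close>.\<close>
  have close: "Q (w i - w j) \<le> ennreal (2 * (R - r j) + 4 * e j)" if ij: "j \<le> i" for i j
  proof -
    define s t where "s = w i - x" and "t = w j - x"
    have "w i \<in> K j" "w j \<in> K j" using w(1) K_mono[OF ij] by auto
    then have "m j \<le> Q (fps_const (1 / 2) * (w i + w j) - x)"
      unfolding m_def by (intro INF_lower K_mid)
    also have "fps_const (1 / 2) * (w i + w j) - x = fps_const (1 / 2) * (s + t)"
    proof (rule fps_ext)
      show "fps_nth (fps_const (1 / 2) * (w i + w j) - x) k = fps_nth (fps_const (1 / 2) * (s + t)) k" for k
        by (simp only: s_def t_def fps_sub_nth fps_add_nth fps_mult_left_const_nth) (simp add: field_simps)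
    qed
    also have "Q \<dots> = ennreal (1 / 4) * Q (s + t)"
      unfolding Q_def by (subst mu_norm_const_mult[OF meas]) (simp add: norm_divide power_divide)
    finally have "ennreal 4 * m j \<le> ennreal 4 * (ennreal (1 / 4) * Q (s + t))"
      by (rule mult_left_mono) simp
    also have "\<dots> = Q (s + t)"
    proof -
      have "ennreal 4 * ennreal (1 / 4) = 1" by (subst ennreal_mult[symmetric]) simp_all
      then show ?thesis by (simp only: mult.assoc[symmetric] mult_1)
    qed
    finally have st: "ennreal 4 * m j \<le> Q (s + t)" .
    have "w i - w j = s - t" by (simp add: s_def t_def)
    then have "ennreal 4 * m j + Q (w i - w j) \<le> Q (s + t) + Q (s - t)"
      using st by (simp add: add_right_mono)
    also have "\<dots> = 2 * Q s + 2 * Q t"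
      unfolding Q_def by (rule mu_norm_parallelogram[OF meas])
    also have "\<dots> \<le> 2 * (m i + ennreal (e i)) + 2 * (m j + ennreal (e j))"
      unfolding s_def t_def by (intro add_mono mult_left_mono less_imp_le w(2)) simp_all
    also have "\<dots> = ennreal (2 * (r i + e i) + 2 * (r j + e j))"
      using r0 e0 by (simp add: mr ennreal_plus ennreal_mult less_imp_le)
    finally have le: "ennreal (4 * r j) + Q (w i - w j) \<le> ennreal (2 * (r i + e i) + 2 * (r j + e j))"
      using r0 by (simp add: mr ennreal_mult)
    then have "Q (w i - w j) \<noteq> \<infinity>" by (auto simp: top_unique)
    then obtain q where q: "Q (w i - w j) = ennreal q" "q \<ge> 0" by (cases "Q (w i - w j)") auto
    have pos: "0 \<le> 2 * (r i + e i) + 2 * (r j + e j)"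
      using r0 e0 by (intro add_nonneg_nonneg mult_nonneg_nonneg) (simp_all add: less_imp_le)
    have "4 * r j + q \<le> 2 * (r i + e i) + 2 * (r j + e j)"
      using le r0[of j] q pos by (simp flip: ennreal_plus)
    then have "q \<le> 2 * (R - r j) + 4 * e j"
      using R(2)[of i] e_mono[OF ij] by simp
    then show ?thesis using q by (simp add: ennreal_leI)
  qed
  have wlim: "(\<lambda>i. fps_nth (w i) k) \<longlonglongrightarrow> fps_nth x k" for k
  proof (rule LIM_zero_cancel, rule Lim_null_comparison)
    show "eventually (\<lambda>i. cmod (fps_nth (w i) k - fps_nth x k) \<le> e i) sequentially"
      using w(1) by (intro eventually_sequentiallyI[of k]) (auto simp: K_def)
    show "e \<longlonglongrightarrow> 0" unfolding e_def[abs_def] by (rule LIMSEQ_Suc[OF lim_1_over_n])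
  qed
  \<comment> \<open>Here \<open>j\<close> is fixed and \<open>i\<close> tends to infinity:
    \<open>w j - w i\<close> tends coefficientwise to \<open>w j - x\<close>, so the limit of the
    Cauchy sequence is identified as \<open>x\<close> itself.\<close>
  have final: "Q (w j - x) \<le> ennreal (2 * (2 * (R - r j) + 4 * e j))" for j
  proof -
    have "mu_norm mu n (w j - x) \<le> 2 * ennreal (2 * (R - r j) + 4 * e j)"
    proof (rule mu_norm_lsc[OF meas])
      show "(\<lambda>i. fps_nth (w j - w i) k) \<longlonglongrightarrow> fps_nth (w j - x) k" for k
        by (simp, intro tendsto_intros wlim)
      show "mu_norm mu n (w j - w i) \<le> ennreal (2 * (R - r j) + 4 * e j)" if "i \<ge> j" for i
      proof -
        have "mu_norm mu n (fps_const (- 1) * (w i - w j)) = mu_norm mu n (w i - w j)"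
          by (subst mu_norm_const_mult[OF meas]) simp
        moreover have "fps_const (- 1) * (w i - w j) = w j - w i"
          by (simp flip: fps_const_neg)
        ultimately show ?thesis using close[OF that] by (simp add: Q_def)
      qed
    qed
    moreover have "2 * ennreal y = ennreal (2 * y)" if "y \<ge> 0" for y
      using that by (simp add: ennreal_mult)
    moreover have "2 * (R - r j) + 4 * e j \<ge> 0"
      using R(2)[of j] e0[of j] by simp
    ultimately show ?thesis by (simp only: Q_def)
  qed
  have "(\<lambda>j. Q (w j - x)) \<longlonglongrightarrow> 0"
  proof (rule tendsto_sandwich[OF _ _ tendsto_const])
    show "\<forall>\<^sub>F j in sequentially. Q (w j - x) \<le> ennreal (2 * (2 * (R - r j) + 4 * e j))"
      using final by simp
    have "e \<longlonglongrightarrow> 0" unfolding e_def[abs_def] by (rule LIMSEQ_Suc[OF lim_1_over_n])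
    then have "(\<lambda>j. 2 * (2 * (R - r j) + 4 * e j)) \<longlonglongrightarrow> 2 * (2 * (R - R) + 4 * 0)"
      by (intro tendsto_intros R(1))
    then show "(\<lambda>j. ennreal (2 * (2 * (R - r j) + 4 * e j))) \<longlonglongrightarrow> 0"
      using tendsto_ennrealI by fastforce
  qed simp
  moreover have "w i \<in> V" for i using w(1) by (auto simp: K_def)
  ultimately show ?thesis using that unfolding Q_def by blast
qed

section \<open>Translation between holomorphic functions and Taylor series, and the
  conclusion\<close>

lemma fps_expansion_holomorphic:
  assumes "f holomorphic_on ball 0 1"
  shows "f has_fps_expansion fps_expansion f 0"
  by (rule has_fps_expansion_fps_expansion[of "ball 0 1"]) (use assms in auto)

lemma taylor_coeff_eq: "taylor_coeff f k = fps_nth (fps_expansion f 0) k"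
  by (simp add: taylor_coeff_def fps_expansion_def)

lemma fps_expansion_mult_holomorphic:
  assumes "f holomorphic_on ball 0 1" "g holomorphic_on ball 0 1"
  shows "fps_expansion (\<lambda>z. f z * g z) 0 = fps_expansion f 0 * fps_expansion g 0"
  by (intro fps_expansion_eqI has_fps_expansion_mult fps_expansion_holomorphic assms)

lemma H2_norm2_eq: "H2_norm2 f = h2norm (fps_expansion f 0)"
  by (simp add: H2_norm2_def wnorm_def taylor_coeff_eq)

lemma D_sigma_eq: "D_sigma j f = wnorm (binw j) (fps_expansion f 0)"
  unfolding D_sigma_def wnorm_def taylor_coeff_eq
  by (intro suminf_cong) (simp add: binomial_eq_0)

lemma norm_mu2_eq:
  assumes "sets mu = sets (restrict_space borel (sphere (0::complex) 1))" "finite_measure mu"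
    and "f holomorphic_on ball 0 1"
  shows "norm_mu2 mu (Suc j) f = mu_norm mu (Suc j) (fps_expansion f 0)"
  by (simp add: norm_mu2_def mu_norm_def H2_norm2_eq D_mu_eq[OF assms])

lemma fps_conv_radius_ge_1:
  assumes "h2norm g < \<infinity>"
  shows "fps_conv_radius g \<ge> 1"
proof -
  obtain C where C: "h2norm g = ennreal C" "C \<ge> 0" using assms by (cases "h2norm g") auto
  have bound: "cmod (fps_nth g k) \<le> sqrt C" for k
  proof -
    have "ennreal ((cmod (fps_nth g k))\<^sup>2) \<le> ennreal C" using h2norm_nth_le[of g k] C(1) by simp
    then have "(cmod (fps_nth g k))\<^sup>2 \<le> C" using C(2) by simp
    then show ?thesis by (rule real_le_rsqrt)
  qed
  show ?thesis
    unfolding fps_conv_radius_def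
  proof (rule conv_radius_geI_ex)
    fix r :: real assume r: "0 < r" "ereal r < 1"
    have "summable (\<lambda>k. sqrt C * r ^ k)"
      using r by (intro summable_mult summable_geometric) simp
    then have "summable (\<lambda>k. fps_nth g k * of_real r ^ k)"
    proof (rule summable_comparison_test'[where N = 0])
      show "norm (fps_nth g k * of_real r ^ k) \<le> sqrt C * r ^ k" for k
        using bound[of k] r by (simp add: norm_mult norm_power mult_right_mono)
    qed
    then show "\<exists>z. norm z = r \<and> summable (\<lambda>k. fps_nth g k * z ^ k)"
      using r by (intro exI[of _ "of_real r"]) simp
  qed
qed

text \<open>\<open>Mult\<close> speaks of functions, \<open>multiplier_bounded\<close> of power
  series. A series of finite norm has bounded coefficients, hence sums to a holomorphic function on
  the disc to which the multiplier property applies.\<close>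

lemma Mult_H_sigma_wnorm_lt:
  assumes \<phi>: "\<phi> \<in> Mult (H_sigma j)" and g: "wnorm (sigw j) g < \<infinity>"
  shows "wnorm (sigw j) (fps_expansion \<phi> 0 * g) < \<infinity>"
proof -
  have hol: "\<phi> holomorphic_on ball 0 1" using \<phi> by (simp add: Mult_def)
  have "h2norm g < \<infinity>" "wnorm (binw j) g < \<infinity>"
    using g by (auto simp: wnorm_sigw less_top[symmetric])
  have rad: "fps_conv_radius g \<ge> 1" by (rule fps_conv_radius_ge_1) fact
  then have "0 < fps_conv_radius g" by (rule less_le_trans[rotated]) simp
  then have "eval_fps g has_fps_expansion g" by (rule eval_fps_has_fps_expansion)
  then have eg: "fps_expansion (eval_fps g) 0 = g" by (rule fps_expansion_eqI)
  have holg: "eval_fps g holomorphic_on ball 0 1"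
  proof (rule holomorphic_on_eval_fps, rule subsetI)
    fix z :: complex assume "z \<in> ball 0 1"
    then have "ereal (cmod z) < 1" by simp
    then show "z \<in> eball 0 (fps_conv_radius g)"
      using less_le_trans[OF _ rad] by (simp add: in_eball_iff)
  qed
  have "eval_fps g \<in> H_sigma j"
    using holg \<open>wnorm (binw j) g < \<infinity>\<close> by (simp add: H_sigma_def D_sigma_eq eg)
  then have "(\<lambda>z. \<phi> z * eval_fps g z) \<in> H_sigma j" using \<phi> by (simp add: Mult_def)
  then have "wnorm (binw j) (fps_expansion \<phi> 0 * g) < \<infinity>"
    by (simp add: H_sigma_def D_sigma_eq fps_expansion_mult_holomorphic[OF hol holg] eg)
  then show ?thesis by (rule wnorm_sigw_fin)
qed

text \<open>As \<open>mu\<close> is nonzero, a finite integral forces the local integral to be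
  finite at some point \<open>l\<close>, and one such point suffices.\<close>

lemma H_mu_wnorm_lt:
  assumes sets: "sets mu = sets (restrict_space borel (sphere (0::complex) 1))" and fin: "finite_measure mu"
    and nz: "emeasure mu (space mu) \<noteq> 0" and f: "f \<in> H_mu mu (Suc j)"
  shows "wnorm (sigw j) (fps_expansion f 0) < \<infinity>"
proof -
  have hol: "f holomorphic_on ball 0 1" using f by (simp add: H_mu_def)
  have lt: "(\<integral>\<^sup>+ l. loc_D (Suc j) l (fps_expansion f 0) \<partial>mu) < \<infinity>"
    using f by (simp add: H_mu_def D_mu_eq[OF sets fin hol])
  have "\<not> (\<forall>l\<in>space mu. \<not> loc_D (Suc j) l (fps_expansion f 0) < \<infinity>)"
  proof
    assume top: "\<forall>l\<in>space mu. \<not> loc_D (Suc j) l (fps_expansion f 0) < \<infinity>"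
    have "(\<integral>\<^sup>+ l. loc_D (Suc j) l (fps_expansion f 0) \<partial>mu) = (\<integral>\<^sup>+ l. \<infinity> \<partial>mu)"
      using top by (intro nn_integral_cong) (simp add: less_top[symmetric])
    then show False using nz lt by (simp add: ennreal_top_mult)
  qed
  then obtain l where "l \<in> space mu" and l: "loc_D (Suc j) l (fps_expansion f 0) < \<infinity>" by auto
  moreover have "space mu = sphere 0 1"
    using sets_eq_imp_space_eq[OF sets] by (simp add: space_restrict_space)
  ultimately have "cmod l = 1" by simp
  then show ?thesis by (rule loc_D_imp_wnorm_lt[OF _ l])
qed

lemma fejer_nth_tendsto: "(\<lambda>N. fps_nth (fejer N \<phi> * f) k) \<longlonglongrightarrow> fps_nth (\<phi> * f) k"
proof -
  have "(\<lambda>N. of_nat (Suc N - i) / of_nat (Suc N) :: complex) \<longlonglongrightarrow> 1" for i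
  proof -
    have "(\<lambda>N. 1 - of_nat i * (1 / of_nat (Suc N)) :: complex) \<longlonglongrightarrow> 1 - of_nat i * 0"
      by (intro tendsto_intros LIMSEQ_Suc[OF lim_1_over_n])
    then have "(\<lambda>N. 1 - of_nat i * (1 / of_nat (Suc N)) :: complex) \<longlonglongrightarrow> 1"
      by (simp only: mult_zero_right diff_zero)
    then show ?thesis
    proof (rule Lim_transform_eventually)
      show "\<forall>\<^sub>F N in sequentially. 1 - of_nat i * (1 / of_nat (Suc N)) = (of_nat (Suc N - i) / of_nat (Suc N) :: complex)"
      proof (rule eventually_sequentiallyI[of i])
        fix N assume "i \<le> N"
        then show "1 - of_nat i * (1 / of_nat (Suc N)) = (of_nat (Suc N - i) / of_nat (Suc N) :: complex)"
          by (subst of_nat_diff) (simp_all add: diff_divide_distrib del: of_nat_Suc)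
      qed
    qed
  qed
  then have "(\<lambda>N. \<Sum>i=0..k. of_nat (Suc N - i) / of_nat (Suc N) * fps_nth \<phi> i * fps_nth f (k - i))
      \<longlonglongrightarrow> (\<Sum>i=0..k. 1 * fps_nth \<phi> i * fps_nth f (k - i))"
    by (intro tendsto_sum tendsto_mult tendsto_const)
  then show ?thesis by (simp add: fps_mult_nth fejer_def)
qed

lemma polynomial_multiple_mem:
  assumes add: "\<And>f g. f \<in> W \<Longrightarrow> g \<in> W \<Longrightarrow> (\<lambda>z. f z + g z) \<in> W"
    and scale: "\<And>c f. f \<in> W \<Longrightarrow> (\<lambda>z. c * f z) \<in> W"
    and shift: "\<And>f. f \<in> W \<Longrightarrow> (\<lambda>z. z * f z) \<in> W"
    and zero: "(\<lambda>z. 0) \<in> W" and f: "f \<in> W"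
  shows "(\<lambda>z :: complex. (\<Sum>k<K. c k * z ^ k) * f z :: complex) \<in> W"
proof (induction K)
  case (Suc K)
  have "(\<lambda>z. z ^ k * f z) \<in> W" for k
    by (induction k) (use f shift in \<open>force simp: mult.assoc\<close>)+
  from add[OF Suc.IH scale[OF this[of K], of "c K"]] show ?case
    by (simp add: algebra_simps)
qed (simp add: zero)

theorem theorem3p10:
  fixes mu :: "complex measure" and n :: nat
    and W :: "(complex \<Rightarrow> complex) set" and \<phi> f :: "complex \<Rightarrow> complex"
  assumes "sets mu = sets (restrict_space borel (sphere (0::complex) 1))"
    and "finite_measure mu"
    and "emeasure mu (space mu) \<noteq> 0"
    and "n \<ge> 1"
    and "closed_subspace_mu mu n W"
    and "\<forall>g\<in>W. (\<lambda>z. z * g z) \<in> W"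
    and "\<phi> \<in> Mult (H_sigma (n - 1))"
    and "f \<in> W"
    and "(\<lambda>z. \<phi> z * f z) \<in> H_mu mu n"
  shows "(\<lambda>z. \<phi> z * f z) \<in> W"
proof -
  obtain j where n: "n = Suc j" using assms(4) by (cases n) auto
  note sets = assms(1) and fin = assms(2) and nz = assms(3)
  have W: "W \<subseteq> H_mu mu (Suc j)" "(\<lambda>z. 0) \<in> W"
    "\<And>f g. f \<in> W \<Longrightarrow> g \<in> W \<Longrightarrow> (\<lambda>z. f z + g z) \<in> W" "\<And>c f. f \<in> W \<Longrightarrow> (\<lambda>z. c * f z) \<in> W"
    using assms(5) unfolding closed_subspace_mu_def n by auto
  have closed: "\<And>F g. (\<And>i. F i \<in> W) \<Longrightarrow> g \<in> H_mu mu (Suc j) \<Longrightarrow>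
        (\<lambda>i. norm_mu2 mu (Suc j) (\<lambda>z. F i z - g z)) \<longlonglongrightarrow> 0 \<Longrightarrow> g \<in> W"
    using assms(5) unfolding closed_subspace_mu_def n by blast
  have mult: "\<phi> \<in> Mult (H_sigma j)" using assms(7) by (simp add: n)
  have \<phi>f: "(\<lambda>z. \<phi> z * f z) \<in> H_mu mu (Suc j)" using assms(9) by (simp add: n)
  have fH: "f \<in> H_mu mu (Suc j)" using W(1) assms(8) by auto
  have hol: "\<phi> holomorphic_on ball 0 1" "f holomorphic_on ball 0 1" "(\<lambda>z. \<phi> z * f z) holomorphic_on ball 0 1"
    using mult fH \<phi>f by (auto simp: Mult_def H_mu_def)
  have Whol: "g holomorphic_on ball 0 1" if "g \<in> W" for g using that W(1) by (auto simp: H_mu_def)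
  define \<Phi> F x where "\<Phi> = fps_expansion \<phi> 0" and "F = fps_expansion f 0" and "x = \<Phi> * F"
  have x: "fps_expansion (\<lambda>z. \<phi> z * f z) 0 = x"
    unfolding x_def \<Phi>_def F_def by (rule fps_expansion_mult_holomorphic[OF hol(1,2)])
  have meas: "(\<lambda>l. loc_D (Suc j) l G) \<in> borel_measurable mu" for G
    by (rule loc_D_measurable[OF sets])
  have space: "space mu = sphere 0 1"
    using sets_eq_imp_space_eq[OF sets] by (simp add: space_restrict_space)
  obtain B where B: "B < \<infinity>" "\<And>g. wnorm (sigw j) (\<Phi> * g) \<le> B * wnorm (sigw j) g"
  proof -
    have "\<exists>B<\<infinity>. \<forall>g. wnorm (sigw j) (\<Phi> * g) \<le> B * wnorm (sigw j) g"
      unfolding \<Phi>_def by (intro multiplier_bounded Mult_H_sigma_wnorm_lt[OF mult]) simp_all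
    then show ?thesis using that by blast
  qed
  have finD: "(\<integral>\<^sup>+ l. loc_D (Suc j) l F \<partial>mu) < \<infinity>" "(\<integral>\<^sup>+ l. loc_D (Suc j) l x \<partial>mu) < \<infinity>"
    using fH \<phi>f D_mu_eq[OF sets fin hol(2)] D_mu_eq[OF sets fin hol(3)] by (simp_all add: H_mu_def F_def x)
  have finS: "wnorm (sigw j) F < \<infinity>" "wnorm (sigw j) x < \<infinity>"
    using H_mu_wnorm_lt[OF sets fin nz fH] H_mu_wnorm_lt[OF sets fin nz \<phi>f] by (simp_all add: F_def x)
  have finH: "h2norm F < \<infinity>" "h2norm x < \<infinity>"
    using finS by (auto simp: wnorm_sigw less_top[symmetric])
  define u where "u N = fejer N \<Phi> * F" for N
  define V where "V = (\<lambda>g. fps_expansion g 0) ` W"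
  define K where "K = (18 * B + 16) * (of_nat j * 4 ^ j + 2)"
  \<comment> \<open>The first summand bounds the Hardy norm of every \<open>u N\<close>. The rest is
    the pointwise estimate integrated over \<open>mu\<close>: the Hardy norms are constant in
    \<open>l\<close> and contribute the finite total mass.\<close>
  define C where "C = B * wnorm (sigw j) F + K *
    ((\<integral>\<^sup>+ l. loc_D (Suc j) l x \<partial>mu) + h2norm x * emeasure mu (space mu) +
      ((\<integral>\<^sup>+ l. loc_D (Suc j) l F \<partial>mu) + h2norm F * emeasure mu (space mu)))"
  have Cfin: "C < \<infinity>"
    unfolding C_def K_def using finD finS finH B(1) finite_measure.emeasure_finite[OF fin]
    by (auto simp: ennreal_mult_eq_top_iff power_eq_top_ennreal less_top[symmetric])
  have uC: "mu_norm mu (Suc j) (u N) \<le> C" for N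
    unfolding mu_norm_def C_def
  proof (rule add_mono)
    have "h2norm (u N) \<le> wnorm (sigw j) (u N)" by (simp add: wnorm_sigw)
    also have "\<dots> \<le> B * wnorm (sigw j) F"
      unfolding u_def by (rule wnorm_fejer_mult_le[OF _ B(2)]) simp
    finally show "h2norm (u N) \<le> B * wnorm (sigw j) F" .
    have "(\<integral>\<^sup>+ l. loc_D (Suc j) l (u N) \<partial>mu)
       \<le> (\<integral>\<^sup>+ l. K * (loc_D (Suc j) l x + h2norm x + (loc_D (Suc j) l F + h2norm F)) \<partial>mu)"
    proof (rule nn_integral_mono)
      fix l assume "l \<in> space mu"
      then have "cmod l = 1" by (simp add: space)
      then show "loc_D (Suc j) l (u N) \<le> K * (loc_D (Suc j) l x + h2norm x + (loc_D (Suc j) l F + h2norm F))"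
        unfolding u_def K_def x_def by (rule loc_D_fejer_mult_le) (simp, rule B(2))
    qed
    also have "\<dots> = K * ((\<integral>\<^sup>+ l. loc_D (Suc j) l x \<partial>mu) + h2norm x * emeasure mu (space mu) +
      ((\<integral>\<^sup>+ l. loc_D (Suc j) l F \<partial>mu) + h2norm F * emeasure mu (space mu)))"
      using meas by (simp add: nn_integral_cmult nn_integral_add)
    finally show "(\<integral>\<^sup>+ l. loc_D (Suc j) l (u N) \<partial>mu) \<le> K *
      ((\<integral>\<^sup>+ l. loc_D (Suc j) l x \<partial>mu) + h2norm x * emeasure mu (space mu) +
      ((\<integral>\<^sup>+ l. loc_D (Suc j) l F \<partial>mu) + h2norm F * emeasure mu (space mu)))" .
  qed
  have xfin: "mu_norm mu (Suc j) x < \<infinity>"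
    using finH finD by (simp add: mu_norm_def less_top[symmetric])
  have bound: "mu_norm mu (Suc j) (u N - x) \<le> 2 * C + 2 * mu_norm mu (Suc j) x" for N
  proof -
    have "mu_norm mu (Suc j) (u N - x) \<le> mu_norm mu (Suc j) (u N + x) + mu_norm mu (Suc j) (u N - x)" by simp
    also have "\<dots> = 2 * mu_norm mu (Suc j) (u N) + 2 * mu_norm mu (Suc j) x"
      by (rule mu_norm_parallelogram[OF meas])
    also have "\<dots> \<le> 2 * C + 2 * mu_norm mu (Suc j) x"
      by (intro add_right_mono mult_left_mono uC) simp
    finally show ?thesis .
  qed
  have uV: "u N \<in> V" for N
  proof -
    define c where "c k = fps_nth (fejer N \<Phi>) k" for k
    define p where "p z = (\<Sum>k<Suc N. c k * z ^ k)" for z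
    have "p has_fps_expansion (\<Sum>k<Suc N. fps_const (c k) * fps_X ^ k)"
      unfolding p_def[abs_def] by (intro fps_expansion_intros)
    also have "(\<Sum>k<Suc N. fps_const (c k) * fps_X ^ k) = fps_cutoff (Suc N) (fejer N \<Phi>)"
      unfolding c_def by (rule fps_cutoff_eq_sum[symmetric])
    \<comment> \<open>Fejer coefficients of index above \<open>N\<close> vanish, so cutting off at
      \<open>Suc N\<close> changes nothing and the mean is the expansion of a polynomial.\<close>
    also have "\<dots> = fejer N \<Phi>"
      by (rule fps_ext) (simp add: fejer_def)
    finally have "(\<lambda>z. p z * f z) has_fps_expansion fejer N \<Phi> * F"
      unfolding F_def by (intro has_fps_expansion_mult fps_expansion_holomorphic hol(2))
    then have eq: "fps_expansion (\<lambda>z. p z * f z) 0 = u N"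
      unfolding u_def by (rule fps_expansion_eqI)
    have mem: "(\<lambda>z. p z * f z) \<in> W"
      unfolding p_def by (rule polynomial_multiple_mem) (use W(2,3,4) assms(6,8) in auto)
    show ?thesis unfolding V_def by (rule image_eqI) (rule eq[symmetric], rule mem)
  qed
  obtain w where w: "\<And>i. w i \<in> V" "(\<lambda>i. mu_norm mu (Suc j) (w i - x)) \<longlonglongrightarrow> 0"
  proof (rule mu_norm_mazur[OF meas _ uV _ bound])
    show "fps_const (1 / 2) * (G + H) \<in> V" if GH: "G \<in> V" "H \<in> V" for G H
    proof -
      obtain g h where gh: "g \<in> W" "h \<in> W" "G = fps_expansion g 0" "H = fps_expansion h 0"
        using GH by (auto simp: V_def)
      have "(\<lambda>z. 1 / 2 * (g z + h z)) has_fps_expansion fps_const (1 / 2) * (G + H)"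
        unfolding gh by (intro fps_expansion_intros fps_expansion_holomorphic Whol gh)
      then have eq: "fps_expansion (\<lambda>z. 1 / 2 * (g z + h z)) 0 = fps_const (1 / 2) * (G + H)"
        by (rule fps_expansion_eqI)
      have mem: "(\<lambda>z. 1 / 2 * (g z + h z)) \<in> W" by (intro W gh)
      show ?thesis unfolding V_def by (rule image_eqI) (rule eq[symmetric], rule mem)
    qed
    show "(\<lambda>i. fps_nth (u i) k) \<longlonglongrightarrow> fps_nth x k" for k
      unfolding u_def x_def by (rule fejer_nth_tendsto)
    show "2 * C + 2 * mu_norm mu (Suc j) x < \<infinity>"
      using Cfin xfin by (simp add: ennreal_mult_less_top)
  qed blast
  \<comment> \<open>Any preimage in \<open>W\<close> will do: the norm of a function holomorphic on
    the disc depends only on its Taylor series at 0, whatever its values elsewhere.\<close>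
  have "\<exists>g\<in>W. fps_expansion g 0 = w i" for i
    using w(1)[of i] unfolding V_def by (elim imageE) auto
  then obtain g where g: "\<And>i. g i \<in> W" "\<And>i. fps_expansion (g i) 0 = w i" by metis
  have "norm_mu2 mu (Suc j) (\<lambda>z. g i z - \<phi> z * f z) = mu_norm mu (Suc j) (w i - x)" for i
  proof -
    have "(\<lambda>z. g i z - \<phi> z * f z) has_fps_expansion w i - x"
      unfolding g(2)[symmetric] x[symmetric]
      by (intro has_fps_expansion_diff fps_expansion_holomorphic Whol g hol)
    then have "fps_expansion (\<lambda>z. g i z - \<phi> z * f z) 0 = w i - x" by (rule fps_expansion_eqI)
    then show ?thesis
      using norm_mu2_eq[OF sets fin holomorphic_on_diff[OF Whol[OF g(1)] hol(3)]] by simp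
  qed
  then show ?thesis
    using w(2) by (intro closed[OF g(1) \<phi>f]) simp
qed

end
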